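(* Let $\mathcal M$ be a von Neumann factor acting on a separable Hilbert space $H$ with a separating and cyclic unit vector. The following are equivalent: (i) the map $\tilde\phi$ extends to a normal completely bounded map on $\mathcal B(H)$ for every $\phi\in\mathbb{CB}^\sigma(\mathcal M)$; (ii) the map $\tilde\phi$ extends to a normal map on $\mathcal B(H)$ for every $\phi\in\mathbb{CB}^\sigma(\mathcal M)$; (iii) $\mathcal M$ is of type ${\rm I}$.
   Context: A map is normal if it is continuous for the $\sigma$-weak topologies. $\mathbb{CB}^\sigma(\mathcal M)$ is the space of all normal completely bounded linear maps $\phi:\mathcal M\to\mathcal M$. $\mathcal M'$ is the commutant of $\mathcal M$ in $\mathcal B(H)$ and $\mathrm{alg}(\mathcal M',\mathcal M)$ is the algebra generated by $\mathcal M$ and $\mathcal M'$, i.e. the linear span of products $A'B$ with $A'\in\mathcal M'$, $B\in\mathcal M$; it is $*$-isomorphic to the algebraic tensor product $\mathcal M'\otimes\mathcal M$ and weakly dense in $\mathcal B(H)$. For a linear map $\phi:\mathcal M\to\mathcal M$, the (well-defined) linear map $\tilde\phi$ on $\mathrm{alg}(\mathcal M',\mathcal M)$ is given by $\tilde\phi(\sum_i A_i'B_i)=\sum_i A_i'\phi(B_i)$. *)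

theory Defs
  imports "HOL-Analysis.Analysis"
begin

text \<open>
  Complex inner product spaces extend the library class \<^class>\<open>real_inner\<close>, whose inner product
  is the real part of the complex one. Hence norm, metric and topology are the usual ones. The
  complex inner product is linear in its first argument.
\<close>

class complex_inner = real_inner +
  fixes scaleC :: "complex \<Rightarrow> 'a \<Rightarrow> 'a"
    and cinner :: "'a \<Rightarrow> 'a \<Rightarrow> complex"
  assumes scaleC_add_right: "scaleC c (x + y) = scaleC c x + scaleC c y"
    and scaleC_add_left: "scaleC (c + d) x = scaleC c x + scaleC d x"
    and scaleC_scaleC: "scaleC c (scaleC d x) = scaleC (c * d) x"
    and scaleC_of_real: "scaleC (complex_of_real r) x = scaleR r x"
    and cinner_commute: "cinner x y = cnj (cinner y x)"
    and cinner_add_left: "cinner (x + y) z = cinner x z + cinner y z"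
    and cinner_scaleC_left: "cinner (scaleC c x) y = c * cinner x y"
    and inner_eq_Re_cinner: "inner x y = Re (cinner x y)"

class complex_hilbert = complex_inner + complete_space

lemma cinner_self: "cinner x x = complex_of_real ((norm (x :: 'a::complex_inner))\<^sup>2)"
proof (rule complex_eqI)
  show "Re (cinner x x) = Re (complex_of_real ((norm x)\<^sup>2))"
    by (simp add: power2_norm_eq_inner inner_eq_Re_cinner)
  have "Im (cinner x x) = Im (cnj (cinner x x))"
    using cinner_commute[of x x] by simp
  then show "Im (cinner x x) = Im (complex_of_real ((norm x)\<^sup>2))"
    by simp
qed

lemma norm_scaleC: "norm (scaleC c x) = cmod c * norm (x :: 'a::complex_inner)"
proof -
  have "cinner (scaleC c x) (scaleC c x) = c * cnj (c * cinner x x)"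
    by (metis cinner_commute cinner_scaleC_left)
  also have "\<dots> = complex_of_real ((cmod c * norm x)\<^sup>2)"
    by (simp add: cinner_self power_mult_distrib complex_norm_square[symmetric] mult.assoc[symmetric]
          flip: of_real_power)
  finally have "(norm (scaleC c x))\<^sup>2 = (cmod c * norm x)\<^sup>2"
    by (metis cinner_self of_real_eq_iff)
  then show ?thesis
    by simp
qed

lemma bounded_linear_scaleC: "bounded_linear (scaleC c :: 'a::complex_inner \<Rightarrow> 'a)"
proof (rule bounded_linear_intro[where K = "cmod c"])
  fix x y :: 'a and r :: real
  show "scaleC c (x + y) = scaleC c x + scaleC c y"
    by (rule scaleC_add_right)
  show "scaleC c (r *\<^sub>R x) = r *\<^sub>R scaleC c x"
    by (simp add: scaleC_of_real[symmetric] scaleC_scaleC mult.commute)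
  show "norm (scaleC c x) \<le> norm x * cmod c"
    by (simp add: norm_scaleC)
qed


section \<open>Bounded operators\<close>

text \<open>
  The type \<^typ>\<open>'h \<Rightarrow>\<^sub>L 'h\<close> consists of the bounded \<^emph>\<open>real\<close>-linear operators; \<open>BH\<close> singles out
  the complex-linear ones. The operator norm is that of the type.
\<close>

definition BH :: "('h::complex_hilbert \<Rightarrow>\<^sub>L 'h) set" where
  "BH = {T. \<forall>c x. blinfun_apply T (scaleC c x) = scaleC c (blinfun_apply T x)}"

definition scalar_op :: "complex \<Rightarrow> ('h::complex_hilbert \<Rightarrow>\<^sub>L 'h)" where
  "scalar_op c = Blinfun (scaleC c)"

lemma scalar_op_apply: "blinfun_apply (scalar_op c) x = scaleC c x"
  by (simp add: scalar_op_def bounded_linear_Blinfun_apply bounded_linear_scaleC)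

text \<open>The adjoint exists, and is unique, for every member of \<open>BH\<close>.\<close>

definition adj :: "('h::complex_hilbert \<Rightarrow>\<^sub>L 'h) \<Rightarrow> ('h \<Rightarrow>\<^sub>L 'h)" where
  "adj T = (THE S. \<forall>x y. cinner (blinfun_apply T x) y = cinner x (blinfun_apply S y))"

definition commutant :: "('h::complex_hilbert \<Rightarrow>\<^sub>L 'h) set \<Rightarrow> ('h \<Rightarrow>\<^sub>L 'h) set" where
  "commutant S = {T \<in> BH. \<forall>A\<in>S. T o\<^sub>L A = A o\<^sub>L T}"


section \<open>Von Neumann algebras\<close>

definition star_subalgebra :: "('h::complex_hilbert \<Rightarrow>\<^sub>L 'h) set \<Rightarrow> bool" where
  "star_subalgebra M \<longleftrightarrow> M \<subseteq> BH \<and> 0 \<in> M \<and>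
     (\<forall>A\<in>M. \<forall>B\<in>M. A + B \<in> M \<and> A o\<^sub>L B \<in> M) \<and>
     (\<forall>A\<in>M. \<forall>c. scalar_op c o\<^sub>L A \<in> M) \<and>
     (\<forall>A\<in>M. adj A \<in> M)"

definition von_neumann_algebra :: "('h::complex_hilbert \<Rightarrow>\<^sub>L 'h) set \<Rightarrow> bool" where
  "von_neumann_algebra M \<longleftrightarrow> star_subalgebra M \<and> commutant (commutant M) = M"

definition center :: "('h::complex_hilbert \<Rightarrow>\<^sub>L 'h) set \<Rightarrow> ('h \<Rightarrow>\<^sub>L 'h) set" where
  "center M = M \<inter> commutant M"

definition factor :: "('h::complex_hilbert \<Rightarrow>\<^sub>L 'h) set \<Rightarrow> bool" where
  "factor M \<longleftrightarrow> von_neumann_algebra M \<and> center M = range scalar_op"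

definition cyclic :: "('h::complex_hilbert \<Rightarrow>\<^sub>L 'h) set \<Rightarrow> 'h \<Rightarrow> bool" where
  "cyclic M \<xi> \<longleftrightarrow> closure ((\<lambda>A. blinfun_apply A \<xi>) ` M) = UNIV"

definition separating :: "('h::complex_hilbert \<Rightarrow>\<^sub>L 'h) set \<Rightarrow> 'h \<Rightarrow> bool" where
  "separating M \<xi> \<longleftrightarrow> (\<forall>A\<in>M. blinfun_apply A \<xi> = 0 \<longrightarrow> A = 0)"

definition is_projection :: "('h::complex_hilbert \<Rightarrow>\<^sub>L 'h) \<Rightarrow> bool" where
  "is_projection p \<longleftrightarrow> p \<in> BH \<and> p o\<^sub>L p = p \<and> adj p = p"

definition proj_le :: "('h::complex_hilbert \<Rightarrow>\<^sub>L 'h) \<Rightarrow> ('h \<Rightarrow>\<^sub>L 'h) \<Rightarrow> bool" where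
  "proj_le p q \<longleftrightarrow> range (blinfun_apply p) \<subseteq> range (blinfun_apply q)"

definition abelian_projection :: "('h::complex_hilbert \<Rightarrow>\<^sub>L 'h) set \<Rightarrow> ('h \<Rightarrow>\<^sub>L 'h) \<Rightarrow> bool" where
  "abelian_projection M p \<longleftrightarrow> p \<in> M \<and> is_projection p \<and>
     (\<forall>A\<in>M. \<forall>B\<in>M. (p o\<^sub>L A o\<^sub>L p) o\<^sub>L (p o\<^sub>L B o\<^sub>L p) = (p o\<^sub>L B o\<^sub>L p) o\<^sub>L (p o\<^sub>L A o\<^sub>L p))"

text \<open>Type I: every nonzero central projection majorizes a nonzero abelian projection.\<close>

definition type_I :: "('h::complex_hilbert \<Rightarrow>\<^sub>L 'h) set \<Rightarrow> bool" where
  "type_I M \<longleftrightarrow> (\<forall>z\<in>center M. is_projection z \<and> z \<noteq> 0 \<longrightarrow>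
     (\<exists>p. abelian_projection M p \<and> p \<noteq> 0 \<and> proj_le p z))"


section \<open>The \<open>\<sigma>\<close>-weak topology and normal maps\<close>

definition square_summable :: "(nat \<Rightarrow> 'h::complex_hilbert) \<Rightarrow> bool" where
  "square_summable x \<longleftrightarrow> summable (\<lambda>n. (norm (x n))\<^sup>2)"

definition sigma_weak_functional ::
    "(nat \<Rightarrow> 'h::complex_hilbert) \<Rightarrow> (nat \<Rightarrow> 'h) \<Rightarrow> ('h \<Rightarrow>\<^sub>L 'h) \<Rightarrow> complex" where
  "sigma_weak_functional x y A = (\<Sum>n. cinner (blinfun_apply A (x n)) (y n))"

text \<open>
  The coarsest topology on \<open>BH\<close> for which all these functionals are continuous; a von Neumann
  algebra carries the subspace topology.
\<close>

definition sigma_weak :: "('h::complex_hilbert \<Rightarrow>\<^sub>L 'h) topology" where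
  "sigma_weak = topology_generated_by
     {{A \<in> BH. sigma_weak_functional x y A \<in> U} | x y U.
        square_summable x \<and> square_summable y \<and> open U}"

lemma topspace_sigma_weak: "topspace (sigma_weak :: ('h::complex_hilbert \<Rightarrow>\<^sub>L 'h) topology) = BH"
proof -
  have "square_summable (\<lambda>_. 0 :: 'h)"
    by (simp add: square_summable_def)
  then have "(BH :: ('h \<Rightarrow>\<^sub>L 'h) set) \<in> {{A \<in> BH. sigma_weak_functional x y A \<in> U} | x y U.
        square_summable x \<and> square_summable y \<and> open U}"
    by (intro CollectI exI[of _ "\<lambda>_. 0"] exI[of _ UNIV]) auto
  then show ?thesis
    unfolding sigma_weak_def topology_generated_by_topspace by blast
qed

definition normal_map ::
    "('h::complex_hilbert \<Rightarrow>\<^sub>L 'h) set \<Rightarrow> (('h \<Rightarrow>\<^sub>L 'h) \<Rightarrow> ('h \<Rightarrow>\<^sub>L 'h)) \<Rightarrow> bool" where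
  "normal_map S \<phi> \<longleftrightarrow> continuous_map (subtopology sigma_weak S) (subtopology sigma_weak S) \<phi>"


section \<open>Completely bounded maps\<close>

text \<open>
  In the following, \<open>S\<close> is a linear subspace of \<open>BH\<close> and a map of \<open>S\<close> to itself is a function of
  which only the values on \<open>S\<close> matter.
\<close>

definition linear_map ::
    "('h::complex_hilbert \<Rightarrow>\<^sub>L 'h) set \<Rightarrow> (('h \<Rightarrow>\<^sub>L 'h) \<Rightarrow> ('h \<Rightarrow>\<^sub>L 'h)) \<Rightarrow> bool" where
  "linear_map S \<phi> \<longleftrightarrow> \<phi> ` S \<subseteq> S \<and>
     (\<forall>A\<in>S. \<forall>B\<in>S. \<phi> (A + B) = \<phi> A + \<phi> B) \<and>
     (\<forall>A\<in>S. \<forall>c. \<phi> (scalar_op c o\<^sub>L A) = scalar_op c o\<^sub>L \<phi> A)"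

text \<open>
  The norm of the \<open>n \<times> n\<close> operator matrix with entries \<open>A i j\<close>, \<open>i, j < n\<close>, acting on the direct
  sum of \<open>n\<close> copies of the Hilbert space.
\<close>

definition matrix_norm :: "nat \<Rightarrow> (nat \<Rightarrow> nat \<Rightarrow> ('h::complex_hilbert \<Rightarrow>\<^sub>L 'h)) \<Rightarrow> real" where
  "matrix_norm n A =
     (SUP x \<in> {x :: nat \<Rightarrow> 'h. L2_set (\<lambda>j. norm (x j)) {..<n} \<le> 1}.
        L2_set (\<lambda>i. norm (\<Sum>j<n. blinfun_apply (A i j) (x j))) {..<n})"

definition completely_bounded ::
    "('h::complex_hilbert \<Rightarrow>\<^sub>L 'h) set \<Rightarrow> (('h \<Rightarrow>\<^sub>L 'h) \<Rightarrow> ('h \<Rightarrow>\<^sub>L 'h)) \<Rightarrow> bool" where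
  "completely_bounded S \<phi> \<longleftrightarrow> (\<exists>K. \<forall>n A. (\<forall>i<n. \<forall>j<n. A i j \<in> S) \<longrightarrow>
     matrix_norm n (\<lambda>i j. \<phi> (A i j)) \<le> K * matrix_norm n A)"

definition CB_sigma ::
    "('h::complex_hilbert \<Rightarrow>\<^sub>L 'h) set \<Rightarrow> (('h \<Rightarrow>\<^sub>L 'h) \<Rightarrow> ('h \<Rightarrow>\<^sub>L 'h)) set" where
  "CB_sigma S = {\<phi>. linear_map S \<phi> \<and> normal_map S \<phi> \<and> completely_bounded S \<phi>}"


section \<open>The map \<open>\<phi>\<close>-tilde on the algebra generated by \<open>M\<close> and its commutant\<close>

text \<open>
  The map is given by its graph, whose domain is the span of the products of an element of the
  commutant and an element of \<open>M\<close> (scalars are absorbed by the first factor). For a factor \<open>M\<close>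
  and linear \<open>\<phi>\<close> the graph is single-valued; working with it avoids a choice operator.
\<close>

definition tilde_graph ::
    "('h::complex_hilbert \<Rightarrow>\<^sub>L 'h) set \<Rightarrow> (('h \<Rightarrow>\<^sub>L 'h) \<Rightarrow> ('h \<Rightarrow>\<^sub>L 'h)) \<Rightarrow>
       (('h \<Rightarrow>\<^sub>L 'h) \<times> ('h \<Rightarrow>\<^sub>L 'h)) set" where
  "tilde_graph M \<phi> =
     {(\<Sum>i<n. A i o\<^sub>L B i, \<Sum>i<n. A i o\<^sub>L \<phi> (B i)) | (n::nat) A B.
        (\<forall>i<n. A i \<in> commutant M \<and> B i \<in> M)}"

definition extends_tilde ::
    "('h::complex_hilbert \<Rightarrow>\<^sub>L 'h) set \<Rightarrow> (('h \<Rightarrow>\<^sub>L 'h) \<Rightarrow> ('h \<Rightarrow>\<^sub>L 'h)) \<Rightarrow>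
       (('h \<Rightarrow>\<^sub>L 'h) \<Rightarrow> ('h \<Rightarrow>\<^sub>L 'h)) \<Rightarrow> bool" where
  "extends_tilde M \<phi> \<Phi> \<longleftrightarrow> (\<forall>(T, S) \<in> tilde_graph M \<phi>. \<Phi> T = S)"

end

theory Submission
  imports Defs
begin

text \<open>
  (ii) \<open>\<Rightarrow>\<close> (iii): It suffices to extend the single map \<open>\<phi> B = \<langle>B \<xi>, \<xi>\<rangle> 1\<close>. A normal extension \<open>\<Phi>\<close> sends
  \<open>A' B\<close> to \<open>\<langle>B \<xi>, \<xi>\<rangle> A'\<close>. As these products span a \<open>\<sigma>\<close>-weakly dense algebra, \<open>\<Phi>\<close> is a map of \<open>\<B>(H)\<close> into
  \<open>M'\<close> that commutes with right multiplication by elements of \<open>M'\<close>, and by normality it does not vanish on all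
  rank-one operators. If \<open>M'\<close> had no minimal projection, then cutting a suitable rank-one operator into small
  pieces by projections of \<open>M'\<close> would make \<open>\<Phi>\<close> unbounded. So \<open>M'\<close>, and with it \<open>M\<close>, has a minimal projection.

  (iii) \<open>\<Rightarrow>\<close> (i): For a factor of type I there are a minimal projection and a sequence of matrix units \<open>u n\<close> in
  \<open>M'\<close>, which turn operators on \<open>H\<close> into infinite matrices with entries in \<open>M\<close>. Applying \<open>\<phi>\<close> to the entries
  gives the extension. It is bounded as \<open>\<phi>\<close> is completely bounded, and normal since a bounded functional on \<open>\<B>(H)\<close> that
  respects strong limits of bounded sequences is given by a trace class operator.
\<close>

section \<open>Complex inner products\<close>

text \<open>The tilde map leaves the factor from M' alone, so a normal extension is right-linear
  over M'. Composing \<open>rank_one \<eta> \<zeta>\<close> with a projection r of M' merely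
  replaces \<zeta> by r \<zeta>, and orthogonal pieces of \<zeta> can thus be rescaled independently
  of each other. A minimal projection goes from one algebra to its commutant by way of the closed
  orbit of a vector in its range. In the converse the obstacle is normality: the extension is a
  limit of finite matrices and is controlled only along bounded sequences, whereas sigma-weak
  continuity refers to arbitrary open sets. The bridge is a density operator, whose positive and
  negative parts must have finite trace. They come from square roots, given by a norm-convergent
  iteration, and from the kernel of |D| - D, so no functional calculus is involved. Type I is used
  in the form of a minimal projection. An abelian projection of a factor is minimal because A M B =
  0 forces A = 0 or B = 0.\<close>

instance complex_hilbert \<subseteq> banach ..

interpretation scaleC: bounded_bilinear "scaleC :: complex \<Rightarrow> 'a::complex_inner \<Rightarrow> 'a"
proof (standard, goal_cases)
  case (3 r a b)
  have "scaleC (complex_of_real r * a) b = r *\<^sub>R scaleC a b"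
    by (simp add: scaleC_scaleC[symmetric] scaleC_of_real)
  then show ?case by (simp add: scaleR_conv_of_real)
next
  case (4 a r b)
  then show ?case
    by (simp add: scaleC_of_real[symmetric] scaleC_scaleC mult.commute)
next
  case 5
  show ?case by (rule exI[of _ 1]) (simp add: norm_scaleC)
qed (simp_all add: scaleC_add_right scaleC_add_left)

lemma scaleC_one [simp]: "scaleC 1 x = (x::'a::complex_inner)"
  using scaleC_of_real[of 1 x] by simp

lemma cinner_add_right: "cinner x (y + z :: 'a::complex_inner) = cinner x y + cinner x z"
  by (metis cinner_commute cinner_add_left complex_cnj_add)

lemma cinner_scaleC_right: "cinner x (scaleC c y :: 'a::complex_inner) = cnj c * cinner x y"
  by (metis cinner_commute cinner_scaleC_left complex_cnj_mult)

lemma cinner_conv_inner: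
  "cinner x y = complex_of_real (inner x y) + \<i> * complex_of_real (inner x (scaleC \<i> (y::'a::complex_inner)))"
  by (rule complex_eqI) (simp_all add: inner_eq_Re_cinner cinner_scaleC_right)

lemma norm_cinner_le: "cmod (cinner x y) \<le> norm x * norm (y::'a::complex_inner)"
proof (cases "cinner x y = 0")
  case False
  \<comment> \<open>Rotating x by this phase makes the complex product real and nonnegative, so that
    the real Cauchy-Schwarz inequality applies.\<close>
  define c where "c = cnj (cinner x y) / cmod (cinner x y)"
  have c: "cmod c = 1" using False by (simp add: c_def norm_divide)
  have "cnj (cinner x y) * cinner x y = complex_of_real ((cmod (cinner x y))\<^sup>2)"
    by (metis complex_norm_square mult.commute)
  then have "cinner (scaleC c x) y = complex_of_real (cmod (cinner x y))"
    using False by (simp add: cinner_scaleC_left c_def power2_eq_square)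
  then have "cmod (cinner x y) = inner (scaleC c x) y"
    by (simp add: inner_eq_Re_cinner)
  also have "\<dots> \<le> norm (scaleC c x) * norm y" by (rule norm_cauchy_schwarz)
  finally show ?thesis by (simp add: norm_scaleC c)
qed simp

interpretation cinner: bounded_bilinear "cinner :: 'a::complex_inner \<Rightarrow> 'a \<Rightarrow> complex"
proof (standard, goal_cases)
  case (3 r a b)
  then show ?case by (metis cinner_scaleC_left scaleC_of_real scaleR_conv_of_real)
next
  case (4 a r b)
  then show ?case
    by (metis cinner_scaleC_right complex_cnj_complex_of_real scaleC_of_real scaleR_conv_of_real)
next
  case 5
  show ?case by (rule exI[of _ 1]) (simp add: norm_cinner_le)
qed (simp_all add: cinner_add_right cinner_add_left)

declare scaleC.zero_left [simp] scaleC.zero_right [simp] cinner.zero_left [simp] cinner.zero_right [simp]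

lemma cinner_eq_zero_commute: "cinner x y = 0 \<longleftrightarrow> cinner y (x::'a::complex_inner) = 0"
  by (metis cinner_commute complex_cnj_zero)

lemma cinner_self_zero: "cinner x x = 0 \<longleftrightarrow> (x::'a::complex_inner) = 0"
  by (simp add: cinner_self)

lemma Re_cinner_self: "Re (cinner x x) = (norm (x::'a::complex_inner))\<^sup>2"
  by (simp add: cinner_self)

lemma cinner_eqI: "(\<And>z. cinner x z = cinner y z) \<Longrightarrow> x = (y::'a::complex_inner)"
  by (metis cinner.diff_left cinner_self_zero eq_iff_diff_eq_0)

lemma cinner_eqI2: "(\<And>z. cinner z x = cinner z y) \<Longrightarrow> x = (y::'a::complex_inner)"
  by (metis cinner_commute cinner_eqI)

lemma norm_add_orthogonal:
  "cinner x y = 0 \<Longrightarrow> (norm (x + y))\<^sup>2 = (norm x)\<^sup>2 + (norm (y::'a::complex_inner))\<^sup>2"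
  by (simp add: power2_norm_eq_inner inner_add inner_eq_Re_cinner[of x y] inner_commute[of y x])

section \<open>Closed subspaces and adjoints\<close>

definition csubspace :: "'a::complex_inner set \<Rightarrow> bool" where
  "csubspace L \<longleftrightarrow> 0 \<in> L \<and> (\<forall>x\<in>L. \<forall>y\<in>L. x + y \<in> L) \<and> (\<forall>x\<in>L. \<forall>c. scaleC c x \<in> L)"

lemma csubspaceD:
  assumes "csubspace L"
  shows "0 \<in> L" "x \<in> L \<Longrightarrow> y \<in> L \<Longrightarrow> x + y \<in> L" "x \<in> L \<Longrightarrow> scaleC c x \<in> L"
    "x \<in> L \<Longrightarrow> - x \<in> L" "x \<in> L \<Longrightarrow> y \<in> L \<Longrightarrow> x - y \<in> L"
proof -
  have m: "- x \<in> L" if "x \<in> L" for x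
  proof -
    have "scaleC (-1) x \<in> L" using assms that by (simp add: csubspace_def)
    then show ?thesis by (simp add: scaleC.minus_left)
  qed
  show "0 \<in> L" "x \<in> L \<Longrightarrow> y \<in> L \<Longrightarrow> x + y \<in> L" "x \<in> L \<Longrightarrow> scaleC c x \<in> L"
    using assms by (auto simp: csubspace_def)
  show "x \<in> L \<Longrightarrow> - x \<in> L" by (rule m)
  show "x \<in> L \<Longrightarrow> y \<in> L \<Longrightarrow> x - y \<in> L"
    using assms m[of y] unfolding csubspace_def by (metis add_uminus_conv_diff)
qed

lemma csubspace_sum: "csubspace L \<Longrightarrow> (\<And>i. i \<in> I \<Longrightarrow> f i \<in> L) \<Longrightarrow> sum f I \<in> L"
  by (induction I rule: infinite_finite_induct) (auto intro: csubspaceD)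

lemma csubspace_closure:
  assumes "csubspace (L :: 'a::complex_inner set)"
  shows "csubspace (closure L)"
  unfolding csubspace_def
proof (intro conjI ballI allI)
  show "0 \<in> closure L" using csubspaceD(1)[OF assms] closure_subset by blast
  fix x y and c assume x: "x \<in> closure L"
  obtain f where f: "\<And>n. f n \<in> L" "f \<longlonglongrightarrow> x" using x unfolding closure_sequential by auto
  have "\<And>n. scaleC c (f n) \<in> L" "(\<lambda>n. scaleC c (f n)) \<longlonglongrightarrow> scaleC c x"
    using f(1) csubspaceD(3)[OF assms] scaleC.tendsto[OF tendsto_const f(2)] by simp_all
  then show "scaleC c x \<in> closure L" unfolding closure_sequential by (intro exI[of _ "\<lambda>n. scaleC c (f n)"]) blast
  assume "y \<in> closure L"
  then obtain g where g: "\<And>n. g n \<in> L" "g \<longlonglongrightarrow> y" unfolding closure_sequential by auto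
  have "\<And>n. f n + g n \<in> L" "(\<lambda>n. f n + g n) \<longlonglongrightarrow> x + y"
    using f(1) g(1) csubspaceD(2)[OF assms] tendsto_add[OF f(2) g(2)] by simp_all
  then show "x + y \<in> closure L" unfolding closure_sequential by (intro exI[of _ "\<lambda>n. f n + g n"]) blast
qed

text \<open>A minimizing sequence is Cauchy: midpoints stay in L, so the parallelogram identity
  bounds \<open>y m - y n\<close> by the excess of both squared distances over the infimum.\<close>

lemma closed_subspace_nearest:
  fixes x :: "'a::complex_hilbert"
  assumes L: "csubspace L" and cl: "closed L"
  shows "\<exists>y\<in>L. \<forall>z\<in>L. norm (x - y) \<le> norm (x - z)"
proof -
  define d where "d = (INF z\<in>L. (norm (x - z))\<^sup>2)"
  have ne: "L \<noteq> {}" using csubspaceD(1)[OF L] by auto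
  have bdd: "bdd_below ((\<lambda>z. (norm (x - z))\<^sup>2) ` L)" by (rule bdd_belowI[of _ 0]) auto
  have dle: "d \<le> (norm (x - z))\<^sup>2" if "z \<in> L" for z
    unfolding d_def using bdd that by (rule cINF_lower)
  have "\<exists>y\<in>L. (norm (x - y))\<^sup>2 < d + 1 / real (Suc n)" for n
    using cINF_less_iff[OF ne bdd, of "d + 1 / real (Suc n)"] by (simp add: d_def)
  then have "\<forall>n. \<exists>y. y \<in> L \<and> (norm (x - y))\<^sup>2 < d + 1 / real (Suc n)" by blast
  from choice[OF this] obtain y
    where yL: "\<And>n. y n \<in> L" and yd: "\<And>n. (norm (x - y n))\<^sup>2 < d + 1 / real (Suc n)"
    by blast
  have close: "(norm (y m - y n))\<^sup>2 \<le> 2 / real (Suc m) + 2 / real (Suc n)" for m n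
  proof -
    have "scaleC (1/2) (y m + y n) \<in> L" using yL csubspaceD(2,3)[OF L] by simp
    moreover have "scaleC (1/2) (y m + y n) = (1/2) *\<^sub>R (y m + y n)"
      using scaleC_of_real[of "1/2"] by simp
    ultimately have "d \<le> (norm (x - (1/2) *\<^sub>R (y m + y n)))\<^sup>2" using dle by metis
    moreover have "(norm (y m - y n))\<^sup>2 = 2 * (norm (x - y m))\<^sup>2 + 2 * (norm (x - y n))\<^sup>2
        - 4 * (norm (x - (1/2) *\<^sub>R (y m + y n)))\<^sup>2"
      by (simp add: power2_norm_eq_inner inner_diff inner_add inner_commute algebra_simps)
    ultimately show ?thesis using yd[of m] yd[of n] by simp
  qed
  have "Cauchy y"
  proof (rule metric_CauchyI)
    fix e :: real assume e: "0 < e"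
    obtain N where N: "4 / real (Suc N) < e\<^sup>2"
    proof -
      obtain N where "1 / real (Suc N) < e\<^sup>2 / 4"
        using nat_approx_posE[of "e\<^sup>2 / 4"] e by auto
      then show ?thesis using that[of N] by (simp add: field_simps)
    qed
    have "dist (y m) (y n) < e" if "m \<ge> N" "n \<ge> N" for m n
    proof -
      have "2 / real (Suc m) \<le> 2 / real (Suc N)" "2 / real (Suc n) \<le> 2 / real (Suc N)"
        using that by (auto intro!: divide_left_mono)
      then have "(norm (y m - y n))\<^sup>2 < e\<^sup>2" using close[of m n] N by linarith
      then show ?thesis using e by (simp add: dist_norm power2_less_imp_less)
    qed
    then show "\<exists>M. \<forall>m\<ge>M. \<forall>n\<ge>M. dist (y m) (y n) < e" by blast
  qed
  then obtain l where l: "y \<longlonglongrightarrow> l" using Cauchy_convergent_iff convergent_def by blast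
  have "l \<in> L" using cl yL l closed_sequentially by blast
  moreover have "norm (x - l) \<le> norm (x - z)" if "z \<in> L" for z
  proof -
    have "(\<lambda>n. (norm (x - y n))\<^sup>2) \<longlonglongrightarrow> (norm (x - l))\<^sup>2" using l by (intro tendsto_intros)
    moreover have "(\<lambda>n. d + 1 / real (Suc n)) \<longlonglongrightarrow> d + 0"
      by (intro tendsto_intros LIMSEQ_Suc[OF lim_1_over_n])
    ultimately have "(norm (x - l))\<^sup>2 \<le> d + 0" using yd by (intro LIMSEQ_le) (auto intro: less_imp_le)
    also have "\<dots> \<le> (norm (x - z))\<^sup>2" using dle that by simp
    finally show ?thesis by simp
  qed
  ultimately show ?thesis by blast
qed

lemma closed_subspace_decomp:
  fixes x :: "'a::complex_hilbert"
  assumes L: "csubspace L" and cl: "closed L"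
  shows "\<exists>y\<in>L. \<forall>z\<in>L. cinner (x - y) z = 0"
proof -
  obtain y where y: "y \<in> L" and min: "\<And>z. z \<in> L \<Longrightarrow> norm (x - y) \<le> norm (x - z)"
    using closed_subspace_nearest[OF assms] by blast
  have "inner (x - y) z = 0" if z: "z \<in> L" for z
  proof -
    define t where "t = inner (x - y) z"
    \<comment> \<open>The optimal step along z with \<open>inner z z\<close> replaced by
      \<open>1 + inner z z\<close>: no case distinction for z = 0, and the distance still drops
      strictly unless t = 0.\<close>
    define s where "s = 1 / (1 + inner z z)"
    have s: "s > 0" "s * inner z z < 1" by (auto simp: s_def add_pos_nonneg divide_simps)
    have "y + (s * t) *\<^sub>R z \<in> L"
      using csubspaceD(2)[OF L y csubspaceD(3)[OF L z, of "of_real (s * t)"]] by (simp only: scaleC_of_real)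
    then have "(norm (x - y))\<^sup>2 \<le> (norm (x - (y + (s * t) *\<^sub>R z)))\<^sup>2" using min by (simp add: power_mono)
    also have "\<dots> = (norm (x - y))\<^sup>2 - s * t\<^sup>2 * (2 - s * inner z z)"
      unfolding t_def
      by (simp only: power2_norm_eq_inner) (simp add: power2_eq_square inner_diff inner_add inner_commute algebra_simps)
    finally have "s * t\<^sup>2 * (2 - s * inner z z) \<le> 0" by simp
    then have "t\<^sup>2 \<le> 0" using s by (simp add: mult_le_0_iff)
    then show ?thesis by (simp add: t_def)
  qed
  \<comment> \<open>The imaginary part of the product is the real product with
    \<open>scaleC \<i> z\<close>, which also lies in L.\<close>
  then have "cinner (x - y) z = 0" if "z \<in> L" for z
    using that csubspaceD(3)[OF L] by (simp add: cinner_conv_inner)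
  then show ?thesis using y by blast
qed

section \<open>Orthogonal projections onto closed subspaces\<close>

definition proj_on :: "'h::complex_hilbert set \<Rightarrow> ('h \<Rightarrow>\<^sub>L 'h)" where
  "proj_on L = Blinfun (\<lambda>x. SOME y. y \<in> L \<and> (\<forall>z\<in>L. cinner (x - y) z = 0))"

lemma BH_apply: "T \<in> BH \<Longrightarrow> blinfun_apply T (scaleC c x) = scaleC c (blinfun_apply T x)"
  by (simp add: BH_def)

context
  fixes L :: "'h::complex_hilbert set"
  assumes L: "csubspace L" and cl: "closed L"
begin

lemma proj_on_aux:
  defines "f \<equiv> \<lambda>x::'h. SOME y. y \<in> L \<and> (\<forall>z\<in>L. cinner (x - y) z = 0)"
  shows "f x \<in> L" "z \<in> L \<Longrightarrow> cinner (x - f x) z = 0"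
    "y \<in> L \<Longrightarrow> (\<And>z. z \<in> L \<Longrightarrow> cinner (x - y) z = 0) \<Longrightarrow> f x = y"
proof -
  have *: "f x \<in> L \<and> (\<forall>z\<in>L. cinner (x - f x) z = 0)" for x
    unfolding f_def by (rule someI_ex) (use closed_subspace_decomp[OF L cl, of x] in blast)
  then show "f x \<in> L" "z \<in> L \<Longrightarrow> cinner (x - f x) z = 0" by auto
  assume y: "y \<in> L" "\<And>z. z \<in> L \<Longrightarrow> cinner (x - y) z = 0"
  have "f x - y \<in> L" using * y csubspaceD(5)[OF L] by simp
  then have "cinner (x - y) (f x - y) = 0" "cinner (x - f x) (f x - y) = 0" using * y by blast+
  then have "cinner ((x - y) - (x - f x)) (f x - y) = 0" unfolding cinner.diff_left[of "x - y"] by simp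
  then show "f x = y" by (simp add: cinner_self_zero)
qed

lemma bounded_linear_proj_on_aux:
  "bounded_linear (\<lambda>x::'h. SOME y. y \<in> L \<and> (\<forall>z\<in>L. cinner (x - y) z = 0))" (is "bounded_linear ?f")
proof (rule bounded_linear_intro[where K = 1])
  note f = proj_on_aux
  show "?f (x + y) = ?f x + ?f y" for x y
  proof (rule f(3))
    show "?f x + ?f y \<in> L" by (intro csubspaceD[OF L] f(1))
    have "x + y - (?f x + ?f y) = (x - ?f x) + (y - ?f y)" by simp
    then show "cinner (x + y - (?f x + ?f y)) z = 0" if "z \<in> L" for z
      using f(2)[OF that, of x] f(2)[OF that, of y] by (simp only: cinner_add_left[of "x - _"]) simp
  qed
  show "?f (r *\<^sub>R x) = r *\<^sub>R ?f x" for r x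
  proof (rule f(3))
    show "r *\<^sub>R ?f x \<in> L" using csubspaceD(3)[OF L f(1), of "of_real r"] by (simp add: scaleC_of_real)
    show "cinner (r *\<^sub>R x - r *\<^sub>R ?f x) z = 0" if "z \<in> L" for z
      using f(2)[OF that, of x] by (simp add: scaleR_diff_right[symmetric] cinner.scaleR_left)
  qed
  show "norm (?f x) \<le> norm x * 1" for x
  proof -
    have "cinner (x - ?f x) (?f x) = 0" using f(1,2) by blast
    then have "(norm x)\<^sup>2 = (norm (x - ?f x))\<^sup>2 + (norm (?f x))\<^sup>2"
      using norm_add_orthogonal[of "x - ?f x" "?f x"] by simp
    then have "(norm (?f x))\<^sup>2 \<le> (norm x)\<^sup>2" using zero_le_power2[of "norm (x - ?f x)"] by linarith
    then show ?thesis using power2_le_imp_le[OF _ norm_ge_zero] by simp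
  qed
qed

lemma proj_on_in: "proj_on L x \<in> L"
  unfolding proj_on_def bounded_linear_Blinfun_apply[OF bounded_linear_proj_on_aux]
  by (rule proj_on_aux(1))

lemma proj_on_orth: "z \<in> L \<Longrightarrow> cinner (x - proj_on L x) z = 0"
  unfolding proj_on_def bounded_linear_Blinfun_apply[OF bounded_linear_proj_on_aux]
  by (rule proj_on_aux(2))

lemma proj_on_unique: "y \<in> L \<Longrightarrow> (\<And>z. z \<in> L \<Longrightarrow> cinner (x - y) z = 0) \<Longrightarrow> proj_on L x = y"
  unfolding proj_on_def bounded_linear_Blinfun_apply[OF bounded_linear_proj_on_aux]
  by (rule proj_on_aux(3))

lemma proj_on_id: "x \<in> L \<Longrightarrow> proj_on L x = x"
  by (rule proj_on_unique) simp_all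

lemma proj_on_BH: "proj_on L \<in> BH"
  unfolding BH_def
proof (intro CollectI allI)
  fix c x
  show "proj_on L (scaleC c x) = scaleC c (proj_on L x)"
  proof (rule proj_on_unique)
    show "scaleC c (proj_on L x) \<in> L" by (intro csubspaceD[OF L] proj_on_in)
    show "cinner (scaleC c x - scaleC c (proj_on L x)) z = 0" if "z \<in> L" for z
      using proj_on_orth[OF that, of x] by (simp add: scaleC.diff_right[symmetric] cinner_scaleC_left)
  qed
qed

lemma proj_on_sym: "cinner (proj_on L x) y = cinner x (proj_on L y)"
proof -
  have "cinner (proj_on L x) (y - proj_on L y) = 0"
    using proj_on_orth[OF proj_on_in, of y x] by (simp add: cinner_eq_zero_commute)
  moreover have "cinner (x - proj_on L x) (proj_on L y) = 0"
    by (rule proj_on_orth[OF proj_on_in])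
  ultimately show ?thesis by (simp add: cinner.diff_left cinner.diff_right)
qed

end

section \<open>Riesz representation, adjoints and the algebra of bounded operators\<close>

lemma riesz_real:
  fixes f :: "'h::complex_hilbert \<Rightarrow> real"
  assumes f: "bounded_linear f"
  shows "\<exists>z. \<forall>x. f x = inner x z"
proof -
  interpret f: bounded_linear f by (rule f)
  \<comment> \<open>The complex-linear functional with real part f. Its kernel is a complex
    subspace, as the projections above require; the kernel of f in general is only a real
    one.\<close>
  define g where "g x = complex_of_real (f x) - \<i> * complex_of_real (f (scaleC \<i> x))" for x
  have gs: "g (scaleC c x) = c * g x" for c x
  proof -
    have e: "scaleC c x = Re c *\<^sub>R x + Im c *\<^sub>R scaleC \<i> x"
      by (subst complex_eq[of c]) (simp add: scaleC_add_left scaleC_of_real[symmetric] scaleC_scaleC mult.commute)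
    have e2: "scaleC \<i> (scaleC c x) = Re c *\<^sub>R scaleC \<i> x - Im c *\<^sub>R x"
      by (subst complex_eq[of c])
        (simp add: scaleC_add_left scaleC_add_right scaleC_scaleC scaleC_of_real[symmetric] scaleC.minus_left[symmetric]
          mult.assoc[symmetric] mult.commute)
    show ?thesis unfolding g_def e2 unfolding e
      by (simp add: f.add f.diff f.scaleR complex_eq_iff)
  qed
  have ga: "g (x + y) = g x + g y" for x y
    by (simp add: g_def scaleC_add_right f.add algebra_simps)
  have gc: "continuous_on UNIV g"
    unfolding g_def by (intro continuous_intros linear_continuous_on f
        bounded_linear.continuous_on[OF f] bounded_linear.continuous_on[OF bounded_linear_scaleC])
  define L where "L = {x. g x = 0}"
  have L: "csubspace L" unfolding csubspace_def L_def
    using gs[of 0 0] by (auto simp: gs ga)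
  have cl: "closed L" unfolding L_def
    using continuous_closed_vimage[of "{0}" g] gc by (simp add: vimage_def continuous_on_eq_continuous_at)
  show ?thesis
  proof (cases "L = UNIV")
    case True
    then have "\<And>x. f x = 0" unfolding L_def g_def by (auto simp: complex_eq_iff set_eq_iff)
    then show ?thesis by (intro exI[of _ 0]) simp
  next
    case False
    then obtain v where v: "v \<notin> L" by auto
    define w where "w = v - proj_on L v"
    have wL: "\<And>z. z \<in> L \<Longrightarrow> cinner w z = 0" unfolding w_def by (rule proj_on_orth[OF L cl])
    have w0: "w \<noteq> 0" using v proj_on_in[OF L cl, of v] by (auto simp: w_def)
    have gw: "g w \<noteq> 0" using w0 wL[of w] by (auto simp: L_def cinner_self_zero)
    \<comment> \<open>Scaled so that \<open>cinner w z = g w\<close>. Every x differs from a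
      multiple of w by an element of the kernel, which is orthogonal to w.\<close>
    define z where "z = scaleC (cnj (g w) / cinner w w) w"
    have "cinner x z = g x" for x
    proof -
      have "x + scaleC (- (g x / g w)) w \<in> L" using gw by (simp add: L_def ga gs)
      then have "cinner (x + scaleC (- (g x / g w)) w) w = 0"
        using wL cinner_eq_zero_commute by blast
      then have "cinner x w = (g x / g w) * cinner w w"
        by (simp add: cinner_add_left cinner_scaleC_left)
      moreover have "cnj (cinner w w) = cinner w w" by (simp add: cinner_self)
      ultimately show ?thesis using w0 gw
        by (simp add: z_def cinner_scaleC_right cinner_self_zero)
    qed
    then have "inner x z = f x" for x
      by (simp add: inner_eq_Re_cinner g_def)
    then show ?thesis by (intro exI[of _ z]) simp
  qed
qed

lemma complex_linear_from_real:
  assumes T: "(T :: 'h::complex_hilbert \<Rightarrow>\<^sub>L 'h) \<in> BH" and S: "\<And>x y. inner (T x) y = inner x (S y)"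
  shows "cinner (T x) y = cinner x (S y)"
proof -
  have i: "inner z (scaleC \<i> w) = - inner (scaleC \<i> z) w" for z w :: 'h
    by (simp add: inner_eq_Re_cinner cinner_scaleC_left cinner_scaleC_right)
  show ?thesis unfolding cinner_conv_inner i BH_apply[OF T, symmetric] S ..
qed

text \<open>Riesz is applied to the real part of \<open>cinner (T x) y\<close> as a function of x;
  complex linearity of T upgrades the resulting identity.\<close>

lemma adjoint_exists:
  assumes T: "(T :: 'h::complex_hilbert \<Rightarrow>\<^sub>L 'h) \<in> BH"
  shows "\<exists>S\<in>BH. \<forall>x y. cinner (T x) y = cinner x (blinfun_apply S y)"
proof -
  have "\<exists>z. \<forall>x. inner (T x) y = inner x z" for y
    by (rule riesz_real) (intro bounded_linear_intros)
  then obtain S where S: "\<And>x y. inner (T x) y = inner x (S y)" by metis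
  have c: "cinner (T x) y = cinner x (S y)" for x y
    by (rule complex_linear_from_real[OF T S])
  have sc: "S (scaleC c y) = scaleC c (S y)" for c y
    by (rule cinner_eqI2) (simp add: c[symmetric] cinner_scaleC_right)
  have "bounded_linear S"
  proof (rule bounded_linear_intro[where K = "norm T"])
    show "S (x + y) = S x + S y" for x y
      by (rule cinner_eqI2) (simp add: c[symmetric] cinner_add_right)
    show "S (r *\<^sub>R y) = r *\<^sub>R S y" for r y
      using sc[of "of_real r" y] by (simp add: scaleC_of_real)
    show "norm (S y) \<le> norm y * norm T" for y
    proof -
      have "(norm (S y))\<^sup>2 = inner (T (S y)) y" by (simp add: S power2_norm_eq_inner)
      also have "\<dots> \<le> norm (T (S y)) * norm y" by (rule norm_cauchy_schwarz)
      also have "\<dots> \<le> norm T * norm (S y) * norm y" by (intro mult_right_mono norm_blinfun) simp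
      finally show ?thesis by (cases "S y = 0") (simp_all add: power2_eq_square mult.commute)
    qed
  qed
  then have "blinfun_apply (Blinfun S) = S" by (rule bounded_linear_Blinfun_apply)
  then show ?thesis using c sc by (intro bexI[of _ "Blinfun S"]) (simp_all add: BH_def)
qed

lemma adj_eqI:
  assumes "\<And>x y. cinner (blinfun_apply T x) y = cinner x (blinfun_apply S y)"
  shows "adj T = S"
  unfolding adj_def
proof (rule the_equality)
  fix S' assume "\<forall>x y. cinner (blinfun_apply T x) y = cinner x (blinfun_apply S' y)"
  then have "cinner x (blinfun_apply S' y) = cinner x (blinfun_apply S y)" for x y
    using assms by metis
  then show "S' = S" by (intro blinfun_eqI cinner_eqI2)
qed (use assms in blast)

lemma
  assumes T: "(T :: 'h::complex_hilbert \<Rightarrow>\<^sub>L 'h) \<in> BH"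
  shows adj_BH: "adj T \<in> BH"
    and adj_right: "cinner (T x) y = cinner x (adj T y)"
    and adj_left: "cinner (adj T x) y = cinner x (T y)"
proof -
  obtain S where S: "S \<in> BH" "\<And>x y. cinner (T x) y = cinner x (blinfun_apply S y)"
    using adjoint_exists[OF T] by blast
  have e: "adj T = S" using S(2) by (rule adj_eqI)
  show "adj T \<in> BH" and "cinner (T x) y = cinner x (adj T y)" using S e by simp_all
  show "cinner (adj T x) y = cinner x (T y)"
    unfolding e by (metis S(2) cinner_commute)
qed

lemma adj_adj: "T \<in> BH \<Longrightarrow> adj (adj T) = T"
  by (rule adj_eqI) (rule adj_left)

lemma blinfun_compose_assoc: "(A o\<^sub>L B) o\<^sub>L C = A o\<^sub>L (B o\<^sub>L C)"
  by (rule blinfun_eqI) simp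

lemma BH_compose: "A \<in> BH \<Longrightarrow> B \<in> BH \<Longrightarrow> A o\<^sub>L B \<in> BH"
  by (simp add: BH_def)

lemma BH_add: "A \<in> BH \<Longrightarrow> B \<in> BH \<Longrightarrow> A + B \<in> BH"
  by (simp add: BH_def blinfun.add_left scaleC_add_right)

lemma BH_diff: "A \<in> BH \<Longrightarrow> B \<in> BH \<Longrightarrow> A - B \<in> BH"
  by (simp add: BH_def blinfun.diff_left scaleC.diff_right)

lemma BH_uminus: "A \<in> BH \<Longrightarrow> - A \<in> BH"
  by (simp add: BH_def blinfun.minus_left scaleC.minus_right)

lemma BH_scaleR: "A \<in> BH \<Longrightarrow> r *\<^sub>R A \<in> BH"
  by (simp add: BH_def blinfun.scaleR_left scaleC_of_real[symmetric] scaleC_scaleC mult.commute)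

lemma BH_zero: "0 \<in> BH"
  by (simp add: BH_def)

lemma BH_id: "id_blinfun \<in> BH"
  by (simp add: BH_def)

lemma BH_scalar_op: "scalar_op c \<in> BH"
  by (simp add: BH_def scalar_op_apply scaleC_scaleC mult.commute)

lemma BH_sum: "(\<And>i. i \<in> I \<Longrightarrow> f i \<in> BH) \<Longrightarrow> sum f I \<in> BH"
  by (induction I rule: infinite_finite_induct) (auto intro: BH_add BH_zero)

lemmas BH_intros = adj_BH BH_compose BH_add BH_diff BH_uminus BH_scaleR BH_zero BH_id BH_scalar_op BH_sum

lemma adj_compose:
  assumes "A \<in> BH" "B \<in> BH"
  shows "adj (A o\<^sub>L B) = adj B o\<^sub>L adj A"
  by (rule adj_eqI) (simp add: adj_right assms)

lemma adj_add: "A \<in> BH \<Longrightarrow> B \<in> BH \<Longrightarrow> adj (A + B) = adj A + adj B"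
  by (rule adj_eqI) (simp add: blinfun.add_left cinner_add_left cinner_add_right adj_right)

lemma adj_diff: "A \<in> BH \<Longrightarrow> B \<in> BH \<Longrightarrow> adj (A - B) = adj A - adj B"
  by (rule adj_eqI) (simp add: blinfun.diff_left cinner.diff_left cinner.diff_right adj_right)

lemma adj_scalar: "adj (scalar_op c) = scalar_op (cnj c)"
  by (rule adj_eqI) (simp add: scalar_op_apply cinner_scaleC_left cinner_scaleC_right)

lemma adj_scaleR: "A \<in> BH \<Longrightarrow> adj (r *\<^sub>R A) = r *\<^sub>R adj A"
  by (rule adj_eqI) (simp add: blinfun.scaleR_left cinner.scaleR_left cinner.scaleR_right adj_right)

lemma adj_zero: "adj 0 = 0" and adj_id: "adj id_blinfun = id_blinfun"
  by (rule adj_eqI; simp)+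

lemma is_projection_proj_on: "csubspace L \<Longrightarrow> closed L \<Longrightarrow> is_projection (proj_on L)"
  unfolding is_projection_def
  by (intro conjI proj_on_BH blinfun_eqI[of "proj_on L o\<^sub>L proj_on L"] adj_eqI)
    (simp_all add: proj_on_sym proj_on_id proj_on_in)

lemma is_projectionD:
  assumes "is_projection p"
  shows "p \<in> BH" "p o\<^sub>L p = p" "adj p = p" "p (p x) = p x" "cinner (p x) y = cinner x (p y)"
    "norm (p x) \<le> norm x" "cinner (p x) x = of_real ((norm (p x))\<^sup>2)"
proof -
  show p: "p \<in> BH" "p o\<^sub>L p = p" "adj p = p" using assms by (auto simp: is_projection_def)
  show pp: "p (p x) = p x" for x using p(2) by (metis blinfun_apply_blinfun_compose)
  show c: "cinner (p x) y = cinner x (p y)" for x y using adj_right[OF p(1)] p(3) by metis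
  show i: "cinner (p x) x = of_real ((norm (p x))\<^sup>2)" for x
    using c[of "p x" x] cinner_self[of "p x"] pp[of x] by metis
  have "(norm (p x))\<^sup>2 = Re (cinner (p x) x)" by (simp add: i)
  also have "\<dots> \<le> norm (p x) * norm x" by (rule order_trans[OF complex_Re_le_cmod norm_cinner_le])
  finally show "norm (p x) \<le> norm x"
    by (cases "p x = 0") (simp_all add: power2_eq_square)
qed

lemma is_projection_compl: "is_projection p \<Longrightarrow> is_projection (id_blinfun - p)"
  unfolding is_projection_def
  by (auto intro!: BH_intros blinfun_eqI simp: adj_diff BH_id adj_id blinfun.diff_left blinfun.diff_right)
    (metis blinfun_apply_blinfun_compose)

lemma adj_selfadjoint_sandwich:
  assumes p: "is_projection p" and A: "A \<in> BH" "adj A = A"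
  shows "adj (p o\<^sub>L A o\<^sub>L p) = p o\<^sub>L A o\<^sub>L p"
  using is_projectionD[OF p] A by (simp add: adj_compose BH_intros blinfun_compose_assoc)

text \<open>Serves to read off a density operator from the values of a bounded functional on
  rank-one operators.\<close>

lemma sesquilinear_operator:
  fixes b :: "'h::complex_hilbert \<Rightarrow> 'h \<Rightarrow> complex"
  assumes add1: "\<And>x x' y. b (x + x') y = b x y + b x' y"
    and add2: "\<And>x y y'. b x (y + y') = b x y + b x y'"
    and sc1: "\<And>c x y. b (scaleC c x) y = c * b x y"
    and sc2: "\<And>c x y. b x (scaleC c y) = cnj c * b x y"
    and bd: "\<And>x y. cmod (b x y) \<le> K * norm x * norm y"
  shows "\<exists>T\<in>BH. \<forall>x y. cinner (blinfun_apply T x) y = b x y"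
proof -
  have "\<exists>z. \<forall>y. Re (b x y) = inner y z" for x
  proof (rule riesz_real, rule bounded_linear_intro[where K = "K * norm x"])
    show "Re (b x (y + y')) = Re (b x y) + Re (b x y')" for y y' by (simp add: add2)
    show "Re (b x (r *\<^sub>R y)) = r *\<^sub>R Re (b x y)" for r y
      using sc2[of x "of_real r" y] by (simp add: scaleC_of_real)
    show "norm (Re (b x y)) \<le> norm y * (K * norm x)" for y
      using bd[of x y] abs_Re_le_cmod[of "b x y"] by (simp add: mult_ac)
  qed
  then obtain T where T0: "\<And>x y. Re (b x y) = inner y (T x)" by metis
  have T: "cinner (T x) y = b x y" for x y
  proof (rule complex_eqI)
    show "Re (cinner (T x) y) = Re (b x y)" by (simp add: T0 inner_eq_Re_cinner[symmetric] inner_commute)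
    have "Re (cinner (T x) (scaleC \<i> y)) = Re (b x (scaleC \<i> y))"
      by (simp add: T0 inner_eq_Re_cinner[symmetric] inner_commute)
    then show "Im (cinner (T x) y) = Im (b x y)" by (simp add: sc2 cinner_scaleC_right)
  qed
  have sc: "T (scaleC c x) = scaleC c (T x)" for c x
    by (rule cinner_eqI) (simp add: T sc1 cinner_scaleC_left)
  have "bounded_linear T"
  proof (rule bounded_linear_intro[where K = K])
    show "T (x + y) = T x + T y" for x y by (rule cinner_eqI) (simp add: T add1 cinner_add_left)
    show "T (r *\<^sub>R x) = r *\<^sub>R T x" for r x using sc[of "of_real r" x] by (simp add: scaleC_of_real)
    show "norm (T x) \<le> norm x * K" for x
    proof -
      have "(norm (T x))\<^sup>2 = Re (b x (T x))" by (simp add: T[symmetric] Re_cinner_self)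
      also have "\<dots> \<le> K * norm x * norm (T x)" using bd[of x "T x"] complex_Re_le_cmod order_trans by blast
      finally have "norm (T x) * norm (T x) \<le> (norm x * K) * norm (T x)" by (simp add: power2_eq_square mult_ac)
      \<comment> \<open>The sign of K is not assumed; it follows from the bound at a nonzero
        x.\<close>
      moreover have "0 \<le> norm x * K" if "T x = 0"
      proof (cases "x = 0")
        case False
        have "0 \<le> K * norm x * norm x" using bd[of x x] norm_ge_zero order_trans by blast
        then show ?thesis using False by (simp add: zero_le_mult_iff)
      qed simp
      ultimately show ?thesis by (cases "T x = 0") simp_all
    qed
  qed
  then have "blinfun_apply (Blinfun T) = T" by (rule bounded_linear_Blinfun_apply)
  then show ?thesis using T sc by (intro bexI[of _ "Blinfun T"]) (simp_all add: BH_def)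
qed

section \<open>Commutants\<close>

lemma commutantD:
  assumes "T \<in> commutant S"
  shows "T \<in> BH" "A \<in> S \<Longrightarrow> T o\<^sub>L A = A o\<^sub>L T" "A \<in> S \<Longrightarrow> T (A x) = A (T x)"
  using assms unfolding commutant_def by (auto, metis blinfun_apply_blinfun_compose)

lemma commutantI:
  assumes "T \<in> BH" "\<And>A x. A \<in> S \<Longrightarrow> blinfun_apply T (blinfun_apply A x) = A (T x)"
  shows "T \<in> commutant S"
  unfolding commutant_def using assms by (auto intro!: blinfun_eqI)

lemma commutant_anti_mono: "S \<subseteq> S' \<Longrightarrow> commutant S' \<subseteq> commutant S"
  unfolding commutant_def by auto

lemma commutant_subset_BH: "commutant S \<subseteq> BH"
  unfolding commutant_def by auto

lemma subset_bicommutant: "S \<subseteq> BH \<Longrightarrow> S \<subseteq> commutant (commutant S)"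
  unfolding commutant_def by auto

lemma tricommutant: "S \<subseteq> BH \<Longrightarrow> commutant (commutant (commutant S)) = commutant S"
  using subset_bicommutant[of S] subset_bicommutant[of "commutant S"] commutant_anti_mono commutant_subset_BH
  by blast

lemma adj_commutant:
  assumes S: "S \<subseteq> BH" "\<And>A. A \<in> S \<Longrightarrow> adj A \<in> S" and T: "T \<in> commutant S"
  shows "adj T \<in> commutant S"
proof (rule commutantI)
  note b = commutantD(1)[OF T]
  show "adj T \<in> BH" by (rule adj_BH[OF b])
  fix A x assume A: "A \<in> S"
  have Ab: "A \<in> BH" using A S by auto
  show "adj T (A x) = A (adj T x)"
  proof (rule cinner_eqI)
    fix z
    have "cinner (adj T (A x)) z = cinner x (adj A (T z))" by (simp add: adj_left b adj_right[OF Ab])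
    also have "\<dots> = cinner x (T (adj A z))" using commutantD(3)[OF T] S(2)[OF A] by simp
    also have "\<dots> = cinner (A (adj T x)) z" by (simp add: adj_left[OF b, symmetric] adj_right[OF Ab])
    finally show "cinner (adj T (A x)) z = cinner (A (adj T x)) z" .
  qed
qed

lemma star_subalgebra_commutant:
  assumes S: "S \<subseteq> BH" "\<And>A. A \<in> S \<Longrightarrow> adj A \<in> S"
  shows "star_subalgebra (commutant S)"
  unfolding star_subalgebra_def
proof (intro conjI ballI allI)
  show "commutant S \<subseteq> BH" by (rule commutant_subset_BH)
  show "0 \<in> commutant S" by (rule commutantI) (auto simp: BH_zero)
  fix A assume A: "A \<in> commutant S"
  show "scalar_op c o\<^sub>L A \<in> commutant S" for c
    using commutantD[OF A] S by (intro commutantI) (auto simp: BH_intros scalar_op_apply BH_apply subset_iff)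
  show "adj A \<in> commutant S" by (rule adj_commutant[OF S A])
  fix B assume B: "B \<in> commutant S"
  show "A + B \<in> commutant S"
    using commutantD[OF A] commutantD[OF B] by (intro commutantI) (auto simp: BH_intros blinfun.add_left blinfun.add_right)
  show "A o\<^sub>L B \<in> commutant S"
    using commutantD[OF A] commutantD[OF B] by (intro commutantI) (auto simp: BH_intros)
qed

text \<open>Invariance under A puts \<open>A (proj_on L x)\<close> in L; invariance under the
  adjoint makes the remainder orthogonal to L.\<close>

lemma proj_on_commute:
  assumes L: "csubspace L" "closed L" and A: "A \<in> BH"
    and inv: "\<And>x. x \<in> L \<Longrightarrow> blinfun_apply A x \<in> L" "\<And>x. x \<in> L \<Longrightarrow> blinfun_apply (adj A) x \<in> L"
  shows "proj_on L (A x) = A (proj_on L x)"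
proof (rule proj_on_unique[OF L])
  show "A (proj_on L x) \<in> L" by (rule inv(1)[OF proj_on_in[OF L]])
  fix z assume z: "z \<in> L"
  have "cinner (x - proj_on L x) (adj A z) = 0" by (rule proj_on_orth[OF L inv(2)[OF z]])
  then show "cinner (A x - A (proj_on L x)) z = 0"
    by (simp add: blinfun.diff_right[symmetric] adj_right[OF A])
qed

locale vN =
  fixes M :: "('h::complex_hilbert \<Rightarrow>\<^sub>L 'h) set"
  assumes vn: "von_neumann_algebra M"
begin

lemma BH: "A \<in> M \<Longrightarrow> A \<in> BH" and adj: "A \<in> M \<Longrightarrow> adj A \<in> M"
  and add: "A \<in> M \<Longrightarrow> B \<in> M \<Longrightarrow> A + B \<in> M" and comp: "A \<in> M \<Longrightarrow> B \<in> M \<Longrightarrow> A o\<^sub>L B \<in> M"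
  and zero: "0 \<in> M" and scal: "A \<in> M \<Longrightarrow> scalar_op c o\<^sub>L A \<in> M"
  and bicommutant: "commutant (commutant M) = M"
  using vn unfolding von_neumann_algebra_def star_subalgebra_def by auto

lemma subset_BH: "M \<subseteq> BH" using BH by auto

lemma memI: "A \<in> BH \<Longrightarrow> (\<And>B x. B \<in> commutant M \<Longrightarrow> blinfun_apply A (blinfun_apply B x) = B (A x)) \<Longrightarrow> A \<in> M"
  using bicommutant commutantI by metis

lemma id: "id_blinfun \<in> M"
  by (rule memI) (auto simp: BH_id)

lemma scalar: "scalar_op c \<in> M"
proof -
  have "scalar_op c o\<^sub>L id_blinfun = (scalar_op c :: 'h \<Rightarrow>\<^sub>L 'h)" by (rule blinfun_eqI) simp
  then show ?thesis using scal[OF id, of c] by simp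
qed

lemma commutes: "A \<in> M \<Longrightarrow> B \<in> commutant M \<Longrightarrow> A (B x) = B (A x)"
  using commutantD(3)[of B M A x] by simp

lemma scaleR: "A \<in> M \<Longrightarrow> r *\<^sub>R A \<in> M"
  by (rule memI) (auto simp: BH_intros BH blinfun.scaleR_left blinfun.scaleR_right commutes)

lemma diff: "A \<in> M \<Longrightarrow> B \<in> M \<Longrightarrow> A - B \<in> M"
  by (rule memI) (auto simp: BH_intros BH blinfun.diff_left blinfun.diff_right commutes)

lemma sum: "(\<And>i. i \<in> I \<Longrightarrow> f i \<in> M) \<Longrightarrow> sum f I \<in> M"
  by (induction I rule: infinite_finite_induct) (auto intro: zero add)

lemma vN_commutant: "vN (commutant M)"
  unfolding vN_def von_neumann_algebra_def
  using star_subalgebra_commutant[OF subset_BH adj] tricommutant[OF subset_BH] by simp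

text \<open>By the bicommutant property it is enough to commute with the commutant, and since that
  is closed under adjoints, plain invariance of L suffices.\<close>

lemma proj_on_mem:
  assumes L: "csubspace L" "closed L" and inv: "\<And>B x. B \<in> commutant M \<Longrightarrow> x \<in> L \<Longrightarrow> blinfun_apply B x \<in> L"
  shows "proj_on L \<in> M"
proof (rule memI[OF proj_on_BH[OF L]])
  fix B x assume B: "B \<in> commutant M"
  interpret N: vN "commutant M" by (rule vN_commutant)
  show "proj_on L (B x) = B (proj_on L x)"
    by (rule proj_on_commute[OF L N.BH[OF B] inv[OF B] inv[OF N.adj[OF B]]])
qed

end

section \<open>Factors\<close>

lemma scalar_op_compose_left: "scalar_op c o\<^sub>L scalar_op d = scalar_op (c * d)"
  by (rule blinfun_eqI) (simp add: scalar_op_apply scaleC_scaleC)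

lemma scaleC_cancel: "scaleC c x = 0 \<longleftrightarrow> c = 0 \<or> (x::'a::complex_inner) = 0"
  by (metis mult_eq_0_iff norm_eq_zero norm_scaleC)

lemma is_projection_scalar:
  assumes "is_projection (scalar_op c :: 'h::complex_hilbert \<Rightarrow>\<^sub>L 'h)"
  shows "(scalar_op c :: 'h \<Rightarrow>\<^sub>L 'h) = 0 \<or> (scalar_op c :: 'h \<Rightarrow>\<^sub>L 'h) = id_blinfun"
proof (cases "\<exists>x::'h. x \<noteq> 0")
  case True
  then obtain x :: 'h where x: "x \<noteq> 0" by blast
  have "scaleC (c * c - c) x = 0"
    using is_projectionD(4)[OF assms, of x] by (simp add: scalar_op_apply scaleC_scaleC scaleC.diff_left)
  then have "c * (c - 1) = 0" using x by (simp add: scaleC_cancel algebra_simps)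
  then consider "c = 0" | "c = 1" by auto
  then show ?thesis
    by cases (auto intro!: blinfun_eqI simp: scalar_op_apply)
next
  \<comment> \<open>On the zero space all operators coincide.\<close>
  case False
  then show ?thesis by (auto intro!: blinfun_eqI)
qed

locale vN_factor = vN M for M :: "('h::complex_hilbert \<Rightarrow>\<^sub>L 'h) set" +
  assumes center: "center M = range scalar_op"
begin

lemma factor_commutant: "vN_factor (commutant M)"
  unfolding vN_factor_def vN_factor_axioms_def
  using vN_commutant center bicommutant unfolding center_def by auto

text \<open>Invariance under both algebras puts the projection onto L into M and into its commutant,
  hence among the scalars.\<close>

lemma invariant_subspace_trivial:
  assumes L: "csubspace L" "closed L" and inv1: "\<And>B x. B \<in> commutant M \<Longrightarrow> x \<in> L \<Longrightarrow> blinfun_apply B x \<in> L"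
    and inv2: "\<And>B x. B \<in> M \<Longrightarrow> x \<in> L \<Longrightarrow> blinfun_apply B x \<in> L"
  shows "L = {0} \<or> L = UNIV"
proof -
  interpret N: vN_factor "commutant M" by (rule factor_commutant)
  have "proj_on L \<in> M" by (rule proj_on_mem[OF L inv1])
  moreover have "proj_on L \<in> commutant M"
    by (rule N.proj_on_mem[OF L]) (simp add: bicommutant inv2)
  ultimately have "proj_on L \<in> range scalar_op" using center unfolding center_def by blast
  then obtain c where c: "proj_on L = scalar_op c" by blast
  then have "proj_on L = 0 \<or> proj_on L = id_blinfun"
    using is_projection_proj_on[OF L] is_projection_scalar[of c] by simp
  then show ?thesis
  proof
    assume p: "proj_on L = 0"
    have "x = 0" if "x \<in> L" for x using proj_on_id[OF L that] p by simp
    then show ?thesis using csubspaceD(1)[OF L(1)] by auto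
  next
    assume "proj_on L = id_blinfun"
    then show ?thesis using proj_on_in[OF L] by (metis UNIV_eq_I blinfun_apply_id_blinfun)
  qed
qed

text \<open>The joint kernel of all \<open>A o\<^sub>L C\<close> is invariant under M and its
  commutant, hence trivial, and it contains the range of B. This takes the place of a comparison
  theory of projections.\<close>

lemma product_zero:
  assumes A: "A \<in> M" and B: "B \<in> M" and z: "\<And>C. C \<in> M \<Longrightarrow> A o\<^sub>L C o\<^sub>L B = 0"
  shows "A = 0 \<or> B = 0"
proof -
  define L where "L = {x. \<forall>C\<in>M. A (C x) = 0}"
  have L: "csubspace L" unfolding csubspace_def L_def
    by (auto simp: blinfun.add_right BH_apply[OF BH] A)
  have "L = (\<Inter>C\<in>M. {x. A (blinfun_apply C x) = 0})" by (auto simp: L_def)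
  moreover have "closed {x. A (C x) = 0}" for C :: "'h \<Rightarrow>\<^sub>L 'h"
    by (intro closed_Collect_eq continuous_intros)
  ultimately have cl: "closed L" by auto
  have "L = {0} \<or> L = UNIV"
  proof (rule invariant_subspace_trivial[OF L cl])
    show "B x \<in> L" if B: "B \<in> commutant M" and x: "x \<in> L" for B x
    proof -
      have "A (C (B x)) = 0" if C: "C \<in> M" for C
        using x C by (simp add: L_def commutes[OF C B] commutes[OF A B])
      then show ?thesis by (simp add: L_def)
    qed
    show "B x \<in> L" if B: "B \<in> M" and x: "x \<in> L" for B x
    proof -
      have "A (C (B x)) = 0" if C: "C \<in> M" for C
        using x comp[OF C B] by (auto simp: L_def)
      then show ?thesis by (simp add: L_def)
    qed
  qed
  moreover have "B x \<in> L" for x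
  proof -
    have "A (C (B x)) = 0" if "C \<in> M" for C
      using arg_cong[OF z[OF that], of "\<lambda>T. blinfun_apply T x"] by simp
    then show ?thesis by (simp add: L_def)
  qed
  moreover have "A x = 0" if "L = UNIV" for x
    using that id unfolding L_def by force
  ultimately show ?thesis by (metis blinfun_eqI singletonD zero_blinfun.rep_eq)
qed

end

section \<open>Square roots and spectral projections\<close>

text \<open>
  The iteration \<open>Y \<leadsto> (B + Y\<^sup>2) / 2\<close> converges to \<open>1 - sqrt (1 - B)\<close>. Its increments are dominated by
  those of the scalar iteration for \<open>B = 1\<close>, which increases to \<open>1\<close>.
\<close>

primrec sqrt_scalar :: "nat \<Rightarrow> real" where
  "sqrt_scalar 0 = 0"
| "sqrt_scalar (Suc n) = (1 + (sqrt_scalar n)\<^sup>2) / 2"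

primrec sqrt_iter :: "('h::complex_hilbert \<Rightarrow>\<^sub>L 'h) \<Rightarrow> nat \<Rightarrow> ('h \<Rightarrow>\<^sub>L 'h)" where
  "sqrt_iter B 0 = 0"
| "sqrt_iter B (Suc n) = (1/2) *\<^sub>R (B + (sqrt_iter B n o\<^sub>L sqrt_iter B n))"

lemma sqrt_scalar_bounds: "0 \<le> sqrt_scalar n \<and> sqrt_scalar n \<le> 1"
  by (induction n) (auto simp: power_le_one)

lemma sqrt_scalar_Suc: "sqrt_scalar n \<le> sqrt_scalar (Suc n)"
proof -
  have "0 \<le> (1 - sqrt_scalar n)\<^sup>2" by simp
  then show ?thesis by (simp add: power2_eq_square algebra_simps)
qed

lemma convergent_sqrt_scalar: "convergent sqrt_scalar"
  using sqrt_scalar_bounds by (intro Bseq_monoseq_convergent BseqI'[where K = 1])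
    (auto simp: monoseq_Suc simp del: sqrt_scalar.simps intro!: sqrt_scalar_Suc)

context
  fixes B :: "'h::complex_hilbert \<Rightarrow>\<^sub>L 'h"
  assumes B1: "norm B \<le> 1"
begin

lemma norm_sqrt_iter: "norm (sqrt_iter B n) \<le> sqrt_scalar n"
proof (induction n)
  case (Suc n)
  have "norm (sqrt_iter B n o\<^sub>L sqrt_iter B n) \<le> (sqrt_scalar n)\<^sup>2"
    unfolding power2_eq_square
    by (rule order_trans[OF norm_blinfun_compose]) (intro mult_mono Suc; simp add: sqrt_scalar_bounds)
  then have "norm (B + (sqrt_iter B n o\<^sub>L sqrt_iter B n)) \<le> 1 + (sqrt_scalar n)\<^sup>2"
    using B1 by (intro order_trans[OF norm_triangle_ineq]) linarith
  then show ?case by simp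
qed simp

text \<open>The formula X X - Y Y = (X - Y) X + Y (X - Y) needs no commutation, and its scalar
  version is exactly the increment of \<open>sqrt_scalar\<close>, so the induction hypothesis
  reproduces itself.\<close>

lemma norm_sqrt_iter_diff: "norm (sqrt_iter B (n + k) - sqrt_iter B n) \<le> sqrt_scalar (n + k) - sqrt_scalar n"
proof (induction n)
  case 0
  then show ?case using norm_sqrt_iter[of k] by simp
next
  case (Suc n)
  let ?X = "sqrt_iter B (n + k)" and ?Y = "sqrt_iter B n"
  let ?x = "sqrt_scalar (n + k)" and ?y = "sqrt_scalar n"
  have "sqrt_iter B (Suc n + k) - sqrt_iter B (Suc n) = (1/2) *\<^sub>R (((?X - ?Y) o\<^sub>L ?X) + (?Y o\<^sub>L (?X - ?Y)))"
    by (rule blinfun_eqI) (simp add: blinfun.bilinear_simps algebra_simps)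
  also have "norm \<dots> \<le> (1/2) * ((?x - ?y) * ?x + ?y * (?x - ?y))"
  proof -
    have nn: "0 \<le> ?x - ?y" using Suc norm_ge_zero order_trans by blast
    have "norm ((?X - ?Y) o\<^sub>L ?X) \<le> (?x - ?y) * ?x"
      by (rule order_trans[OF norm_blinfun_compose]) (intro mult_mono Suc norm_sqrt_iter nn norm_ge_zero)
    moreover have "norm (?Y o\<^sub>L (?X - ?Y)) \<le> ?y * (?x - ?y)"
      by (rule order_trans[OF norm_blinfun_compose]) (intro mult_mono Suc norm_sqrt_iter norm_ge_zero;
          simp add: sqrt_scalar_bounds)
    ultimately show ?thesis using norm_triangle_ineq[of "(?X - ?Y) o\<^sub>L ?X" "?Y o\<^sub>L (?X - ?Y)"] by simp
  qed
  also have "\<dots> = sqrt_scalar (Suc n + k) - sqrt_scalar (Suc n)"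
    by (simp add: power2_eq_square algebra_simps)
  finally show ?case .
qed

lemma sqrt_iter_limit: "\<exists>Y. sqrt_iter B \<longlonglongrightarrow> Y \<and> Y = (1/2) *\<^sub>R (B + (Y o\<^sub>L Y)) \<and> norm Y \<le> 1"
proof -
  have "Cauchy (sqrt_iter B)"
  proof (rule metric_CauchyI)
    fix e :: real assume "0 < e"
    moreover have "Cauchy sqrt_scalar" using convergent_sqrt_scalar by (simp add: Cauchy_convergent_iff)
    ultimately obtain N where N: "\<And>m n. m \<ge> N \<Longrightarrow> n \<ge> N \<Longrightarrow> dist (sqrt_scalar m) (sqrt_scalar n) < e"
      unfolding Cauchy_def by blast
    have *: "dist (sqrt_iter B m) (sqrt_iter B n) < e" if "m \<ge> n" "n \<ge> N" for m n
      using norm_sqrt_iter_diff[of n "m - n"] N[of m n] that by (auto simp: dist_norm)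
    have "dist (sqrt_iter B m) (sqrt_iter B n) < e" if "m \<ge> N" "n \<ge> N" for m n
      using *[of n m] *[of m n] that by (cases "m \<ge> n") (auto simp: dist_commute)
    then show "\<exists>M. \<forall>m\<ge>M. \<forall>n\<ge>M. dist (sqrt_iter B m) (sqrt_iter B n) < e" by blast
  qed
  then obtain Y where Y: "sqrt_iter B \<longlonglongrightarrow> Y"
    unfolding Cauchy_convergent_iff convergent_def by blast
  have "(\<lambda>n. sqrt_iter B (Suc n)) \<longlonglongrightarrow> (1/2) *\<^sub>R (B + (Y o\<^sub>L Y))"
    unfolding sqrt_iter.simps
    by (intro tendsto_scaleR tendsto_const tendsto_add bounded_bilinear.tendsto[OF bounded_bilinear_blinfun_compose] Y)
  then have "Y = (1/2) *\<^sub>R (B + (Y o\<^sub>L Y))" by (rule LIMSEQ_unique[OF LIMSEQ_Suc[OF Y]])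
  moreover have "norm Y \<le> 1"
    using LIMSEQ_le_const2[OF tendsto_norm[OF Y], of 1]
      order_trans[OF norm_sqrt_iter conjunct2[OF sqrt_scalar_bounds]] by blast
  ultimately show ?thesis using Y by blast
qed

end

lemma closed_commuting: "closed {Y :: 'h::complex_hilbert \<Rightarrow>\<^sub>L 'h. A o\<^sub>L Y = Y o\<^sub>L A}"
  by (intro closed_Collect_eq continuous_intros
      bounded_bilinear.continuous_on[OF bounded_bilinear_blinfun_compose])

definition positive_op :: "('h::complex_hilbert \<Rightarrow>\<^sub>L 'h) \<Rightarrow> bool" where
  "positive_op T \<longleftrightarrow> T \<in> BH \<and> adj T = T \<and> (\<forall>x. 0 \<le> inner (T x) x)"

text \<open>The limit Y of the iteration satisfies Y = (B + Y Y) / 2, which says that 1 - Y squares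
  to 1 - B. Self-adjointness and commutation hold along the iteration and are closed conditions;
  positivity of 1 - Y follows from the norm of Y being at most 1.\<close>

lemma contraction_sqrt:
  fixes B :: "'h::complex_hilbert \<Rightarrow>\<^sub>L 'h"
  assumes B: "B \<in> BH" "adj B = B" "norm B \<le> 1"
  shows "\<exists>R. positive_op R \<and> R o\<^sub>L R = id_blinfun - B \<and> (\<forall>A. A o\<^sub>L B = B o\<^sub>L A \<longrightarrow> A o\<^sub>L R = R o\<^sub>L A)"
proof -
  obtain Y where Y: "sqrt_iter B \<longlonglongrightarrow> Y" "Y = (1/2) *\<^sub>R (B + (Y o\<^sub>L Y))" "norm Y \<le> 1"
    using sqrt_iter_limit[OF B(3)] by blast
  have sym: "\<forall>x y c. sqrt_iter B n (scaleC c x) = scaleC c (sqrt_iter B n x) \<and>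
      cinner (sqrt_iter B n x) y = cinner x (sqrt_iter B n y)" for n
  proof (induction n)
    case (Suc n)
    have "cinner (B x) y = cinner x (B y)" for x y using adj_right[OF B(1)] B(2) by metis
    then show ?case using Suc BH_apply[OF B(1)]
      by (simp add: blinfun.bilinear_simps cinner_add_left cinner_add_right cinner.scaleR_left cinner.scaleR_right
          cinner_scaleC_left cinner_scaleC_right scaleC_add_right scaleC_of_real[symmetric] scaleC_scaleC mult.commute)
  qed simp
  have lim: "(\<lambda>n. sqrt_iter B n x) \<longlonglongrightarrow> Y x" for x
    by (intro tendsto_intros Y(1))
  have "Y (scaleC c x) = scaleC c (Y x)" for c x
  proof (rule LIMSEQ_unique[OF lim])
    show "(\<lambda>n. sqrt_iter B n (scaleC c x)) \<longlonglongrightarrow> scaleC c (Y x)"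
      using sym by (simp add: scaleC.tendsto[OF tendsto_const lim])
  qed
  then have YB: "Y \<in> BH" by (simp add: BH_def)
  have Ysym: "cinner (Y x) y = cinner x (Y y)" for x y
  proof (rule LIMSEQ_unique[OF cinner.tendsto[OF lim tendsto_const]])
    show "(\<lambda>n. cinner (sqrt_iter B n x) y) \<longlonglongrightarrow> cinner x (Y y)"
      using sym by (simp add: cinner.tendsto[OF tendsto_const lim])
  qed
  have Yadj: "adj Y = Y" by (rule adj_eqI) (rule Ysym)
  have "inner (Y x) x \<le> inner x x" for x
  proof -
    have "inner (Y x) x \<le> norm (Y x) * norm x" by (rule norm_cauchy_schwarz)
    also have "\<dots> \<le> (norm Y * norm x) * norm x" by (intro mult_right_mono norm_blinfun) simp
    also have "\<dots> \<le> (1 * norm x) * norm x" by (intro mult_right_mono Y) simp_all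
    finally show ?thesis by (simp add: power2_norm_eq_inner[symmetric] power2_eq_square)
  qed
  then have 1: "positive_op (id_blinfun - Y)" unfolding positive_op_def
    using YB Yadj by (auto simp: BH_intros adj_diff adj_id blinfun.diff_left inner_diff_left)
  have "(2::real) *\<^sub>R Y = 2 *\<^sub>R ((1/2) *\<^sub>R (B + (Y o\<^sub>L Y)))" using Y(2) by simp
  then have "2 *\<^sub>R Y = B + (Y o\<^sub>L Y)" by simp
  then have Yx: "Y (Y x) = 2 *\<^sub>R Y x - B x" for x
    by (metis add_diff_cancel_left' blinfun.add_left blinfun.scaleR_left blinfun_apply_blinfun_compose)
  have 2: "(id_blinfun - Y) o\<^sub>L (id_blinfun - Y) = id_blinfun - B"
    by (rule blinfun_eqI) (simp add: blinfun.bilinear_simps Yx scaleR_2)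
  have "A o\<^sub>L (id_blinfun - Y) = (id_blinfun - Y) o\<^sub>L A" if A: "A o\<^sub>L B = B o\<^sub>L A" for A
  proof -
    have "A o\<^sub>L sqrt_iter B n = sqrt_iter B n o\<^sub>L A" for n
    proof (induction n)
      case (Suc n)
      have "A (B x) = B (A x)" "A (sqrt_iter B n x) = sqrt_iter B n (A x)" for x
        using A Suc by (metis blinfun_apply_blinfun_compose)+
      then show ?case by (intro blinfun_eqI) (simp add: blinfun.bilinear_simps)
    qed (auto intro: blinfun_eqI)
    then have "A o\<^sub>L Y = Y o\<^sub>L A"
      using closed_sequentially[OF closed_commuting[of A] _ Y(1)] by simp
    then have "A (Y x) = Y (A x)" for x by (metis blinfun_apply_blinfun_compose)
    then show ?thesis by (intro blinfun_eqI) (simp add: blinfun.bilinear_simps)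
  qed
  then show ?thesis using 1 2 by blast
qed

text \<open>After scaling, E lies between 0 and 1 as a form, so 1 - E is a contraction and
  \<open>contraction_sqrt\<close> gives the root of 1 - (1 - E).\<close>

lemma positive_sqrt:
  fixes D :: "'h::complex_hilbert \<Rightarrow>\<^sub>L 'h"
  assumes D: "positive_op D"
  shows "\<exists>G. positive_op G \<and> G o\<^sub>L G = D"
proof -
  \<comment> \<open>Adding 1 keeps c positive when D = 0.\<close>
  define c where "c = norm D + 1"
  have c: "c > 0" by (simp add: c_def add_nonneg_pos)
  define E where "E = (1/c) *\<^sub>R D"
  have DB: "D \<in> BH" "adj D = D" "\<And>x. 0 \<le> inner (D x) x" using D by (auto simp: positive_op_def)
  have EB: "E \<in> BH" "adj E = E" by (auto simp: E_def BH_intros adj_scaleR DB)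
  have nE: "norm E \<le> 1" using c by (simp add: E_def c_def)
  have "norm (id_blinfun - E) \<le> 1"
  proof (rule norm_blinfun_bound)
    fix x
    have Epos: "0 \<le> inner (E y) y" for y using DB(3)[of y] c by (simp add: E_def blinfun.scaleR_left)
    have sym: "inner (E y) z = inner y (E z)" for y z
      using adj_right[OF EB(1), of y z] EB(2) by (simp add: inner_eq_Re_cinner)
    have "inner (E (E x)) (E x) \<le> norm (E (E x)) * norm (E x)" by (rule norm_cauchy_schwarz)
    also have "\<dots> \<le> (1 * norm (E x)) * norm (E x)"
      by (intro mult_right_mono order_trans[OF norm_blinfun] nE) simp_all
    finally have "inner (E (E x)) (E x) \<le> inner (E x) (E x)"
      by (simp add: power2_norm_eq_inner[symmetric] power2_eq_square)
    \<comment> \<open>Together with the contraction bound this shows that E E is at most E as a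
      form, which in turn bounds the norm of x - E x.\<close>
    moreover have "0 \<le> inner (E (x - E x)) (x - E x)" by (rule Epos)
    moreover have "inner (E (x - E x)) (x - E x) = inner (E x) x - 2 * inner (E x) (E x) + inner (E (E x)) (E x)"
      using sym[of "E x" x] by (simp add: blinfun.diff_right inner_diff)
    ultimately have "inner (E x) (E x) \<le> inner (E x) x" by linarith
    then have "(norm (x - E x))\<^sup>2 \<le> (norm x)\<^sup>2"
      using Epos[of x] by (simp only: power2_norm_eq_inner inner_diff) (simp add: inner_commute[of x "E x"])
    then show "norm ((id_blinfun - E) x) \<le> 1 * norm x"
      using power2_le_imp_le[OF _ norm_ge_zero] by (simp add: blinfun.diff_left)
  qed simp
  then obtain R where R: "positive_op R" "R o\<^sub>L R = id_blinfun - (id_blinfun - E)"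
    using contraction_sqrt[of "id_blinfun - E"] EB BH_diff[OF BH_id EB(1)] by (metis BH_id adj_diff adj_id)
  define G where "G = sqrt c *\<^sub>R R"
  have "R o\<^sub>L R = E" using R(2) by simp
  then have RR: "R (R x) = E x" for x by (metis blinfun_apply_blinfun_compose)
  have "G o\<^sub>L G = D"
    by (rule blinfun_eqI) (use c in \<open>simp add: G_def blinfun.bilinear_simps RR E_def\<close>)
  moreover have "positive_op G" using R(1) c by (auto simp: positive_op_def G_def BH_intros adj_scaleR blinfun.scaleR_left)
  ultimately show ?thesis by blast
qed

lemma closed_kernel: "closed {x. blinfun_apply T x = 0}"
  by (intro closed_Collect_eq continuous_intros)

lemma csubspace_kernel: "T \<in> BH \<Longrightarrow> csubspace {x. blinfun_apply T x = 0}"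
  by (simp add: csubspace_def blinfun.add_right BH_apply)

text \<open>With R the modulus of the normalized operator E, q projects onto the kernel of R - E,
  where E = R is nonnegative. Since (R - E)(R + E) = 0, the range of R + E lies in this kernel;
  hence R + E vanishes on the orthogonal complement, where E = -R.\<close>

lemma spectral_projection:
  fixes D :: "'h::complex_hilbert \<Rightarrow>\<^sub>L 'h"
  assumes D: "D \<in> BH" "adj D = D"
  shows "\<exists>q. is_projection q \<and> (\<forall>A\<in>BH. A o\<^sub>L D = D o\<^sub>L A \<longrightarrow> A o\<^sub>L q = q o\<^sub>L A) \<and>
    (\<forall>x. 0 \<le> inner (D (q x)) (q x)) \<and> (\<forall>x. inner (D (x - q x)) (x - q x) \<le> 0)"
proof -
  define c where "c = norm D + 1"
  have c: "c > 0" by (simp add: c_def add_nonneg_pos)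
  define E where "E = (1/c) *\<^sub>R D"
  have E: "E \<in> BH" "adj E = E" by (auto simp: E_def BH_intros adj_scaleR D)
  have nE: "norm E \<le> 1" using c by (simp add: E_def c_def)
  have Esym: "inner (E y) z = inner y (E z)" for y z
    using adj_right[OF E(1), of y z] E(2) by (simp add: inner_eq_Re_cinner)
  \<comment> \<open>Chosen so that the square root of 1 - B is that of E E, the modulus of
    E.\<close>
  define B where "B = id_blinfun - (E o\<^sub>L E)"
  have B: "B \<in> BH" "adj B = B" by (auto simp: B_def BH_intros E adj_diff adj_id adj_compose)
  have "norm B \<le> 1"
  proof (rule norm_blinfun_bound)
    fix x
    have "norm (E (E x)) \<le> norm E * norm (E x)" by (rule norm_blinfun)
    also have "\<dots> \<le> 1 * norm (E x)" by (intro mult_right_mono nE) simp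
    finally have "(norm (E (E x)))\<^sup>2 \<le> (norm (E x))\<^sup>2" by (simp add: power_mono)
    then have "(norm (x - E (E x)))\<^sup>2 \<le> (norm x)\<^sup>2"
      using inner_ge_zero[of "E x"] Esym[of "E x" x] Esym[of x "E x"]
      by (simp add: power2_norm_eq_inner inner_diff)
    then have "norm (x - E (E x)) \<le> norm x" by (rule power2_le_imp_le) simp
    then show "norm (B x) \<le> 1 * norm x" by (simp add: B_def blinfun.diff_left)
  qed simp
  from contraction_sqrt[OF B this] obtain R where R: "positive_op R" "R o\<^sub>L R = id_blinfun - B"
    and Rc: "\<And>A. A o\<^sub>L B = B o\<^sub>L A \<Longrightarrow> A o\<^sub>L R = R o\<^sub>L A" by blast
  have RR: "R (R x) = E (E x)" for x
    using arg_cong[OF R(2), of "\<lambda>T. blinfun_apply T x"] by (simp add: B_def blinfun.diff_left)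
  have RB: "R \<in> BH" "adj R = R" "\<And>x. 0 \<le> inner (R x) x" using R(1) by (auto simp: positive_op_def)
  have comm: "A (E x) = E (A x)" "A (R x) = R (A x)" if "A o\<^sub>L D = D o\<^sub>L A" for A x
  proof -
    have "A (D x) = D (A x)" for x using that by (metis blinfun_apply_blinfun_compose)
    then have AE: "A (E x) = E (A x)" for x by (simp add: E_def blinfun.bilinear_simps)
    then show "A (E x) = E (A x)" .
    have "A o\<^sub>L B = B o\<^sub>L A" by (rule blinfun_eqI) (simp add: B_def blinfun.bilinear_simps AE)
    from Rc[OF this] show "A (R x) = R (A x)" by (metis blinfun_apply_blinfun_compose)
  qed
  have ER: "E (R x) = R (E x)" for x
  proof -
    have "D (R x) = R (D x)" using comm(2)[of D] by simp
    then show ?thesis by (simp add: E_def blinfun.bilinear_simps)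
  qed
  define Q where "Q = R - E"
  have Q: "Q \<in> BH" "adj Q = Q" by (auto simp: Q_def BH_intros RB E adj_diff)
  define L where "L = {x. Q x = 0}"
  have L: "csubspace L" "closed L" unfolding L_def by (rule csubspace_kernel[OF Q(1)], rule closed_kernel)
  define q where "q = proj_on L"
  have "A o\<^sub>L q = q o\<^sub>L A" if A: "A \<in> BH" "A o\<^sub>L D = D o\<^sub>L A" for A
  proof (rule blinfun_eqI)
    fix x
    have A': "adj A o\<^sub>L D = D o\<^sub>L adj A"
      using arg_cong[OF A(2), of adj] by (simp add: adj_compose A(1) D)
    have "q (A x) = A (q x)" unfolding q_def
      by (rule proj_on_commute[OF L A(1)])
        (auto simp: L_def Q_def blinfun.diff_left comm[OF A(2), symmetric] comm[OF A', symmetric])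
    then show "(A o\<^sub>L q) x = (q o\<^sub>L A) x" by simp
  qed
  moreover have "0 \<le> inner (D (q x)) (q x)" for x
  proof -
    have "R (q x) = E (q x)" using proj_on_in[OF L, of x] by (simp add: q_def L_def Q_def blinfun.diff_left)
    then have "0 \<le> inner (E (q x)) (q x)" using RB(3)[of "q x"] by simp
    then show ?thesis using c by (simp add: E_def blinfun.scaleR_left zero_le_divide_iff)
  qed
  moreover have "inner (D (x - q x)) (x - q x) \<le> 0" for x
  proof -
    let ?y = "x - q x"
    have "R ?y + E ?y = 0"
    proof (rule cinner_eqI)
      fix z
      have "R z + E z \<in> L" by (simp add: L_def Q_def blinfun.bilinear_simps RR ER)
      then have "cinner ?y (R z + E z) = 0" unfolding q_def by (rule proj_on_orth[OF L])
      then show "cinner (R ?y + E ?y) z = cinner 0 z"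
        using adj_right[OF E(1), of ?y z] adj_right[OF RB(1), of ?y z] E(2) RB(2)
        by (simp add: cinner_add_left cinner_add_right)
    qed
    then have "E ?y = - R ?y" by (metis add.commute eq_neg_iff_add_eq_0)
    then have "inner (E ?y) ?y \<le> 0" using RB(3)[of ?y] by simp
    then show ?thesis using c by (simp add: E_def blinfun.scaleR_left divide_le_0_iff mult_le_0_iff)
  qed
  moreover have "is_projection q" unfolding q_def by (rule is_projection_proj_on[OF L])
  ultimately show ?thesis by blast
qed

lemma (in vN) spectral_projection_mem:
  assumes D: "D \<in> M" "adj D = D"
  shows "\<exists>q\<in>M. is_projection q \<and> (\<forall>A\<in>BH. A o\<^sub>L D = D o\<^sub>L A \<longrightarrow> A o\<^sub>L q = q o\<^sub>L A) \<and>
    (\<forall>x. 0 \<le> inner (D (q x)) (q x)) \<and> (\<forall>x. inner (D (x - q x)) (x - q x) \<le> 0)"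
proof -
  obtain q where q: "is_projection q" "\<And>A. A\<in>BH \<Longrightarrow> A o\<^sub>L D = D o\<^sub>L A \<Longrightarrow> A o\<^sub>L q = q o\<^sub>L A"
    "\<And>x. 0 \<le> inner (D (q x)) (q x)" "\<And>x. inner (D (x - q x)) (x - q x) \<le> 0"
    using spectral_projection[OF BH[OF D(1)] D(2)] by blast
  have "q \<in> M"
  proof (rule memI)
    fix B x assume B: "B \<in> commutant M"
    have "B o\<^sub>L q = q o\<^sub>L B" by (rule q(2)[OF commutantD(1)[OF B] commutantD(2)[OF B D(1)]])
    then show "q (B x) = B (q x)" by (metis blinfun_apply_blinfun_compose)
  qed (use q is_projectionD in blast)
  then show ?thesis using q by blast
qed

section \<open>Minimal projections\<close>

text \<open>The scalar corner is the form that calculations use. That it follows from the absence of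
  proper subprojections is \<open>unsplittable_imp_minimal\<close>.\<close>

definition minimal_in :: "('h::complex_hilbert \<Rightarrow>\<^sub>L 'h) set \<Rightarrow> ('h \<Rightarrow>\<^sub>L 'h) \<Rightarrow> bool" where
  "minimal_in M p \<longleftrightarrow> is_projection p \<and> p \<in> M \<and> p \<noteq> 0 \<and> (\<forall>A\<in>M. \<exists>c. p o\<^sub>L A o\<^sub>L p = scalar_op c o\<^sub>L p)"

lemma minimal_imp_abelian: "minimal_in M p \<Longrightarrow> abelian_projection M p"
  unfolding abelian_projection_def
proof (intro conjI ballI)
  fix A B assume p: "minimal_in M p" and "A \<in> M" "B \<in> M"
  then obtain a b where ab: "p o\<^sub>L A o\<^sub>L p = scalar_op a o\<^sub>L p" "p o\<^sub>L B o\<^sub>L p = scalar_op b o\<^sub>L p"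
    unfolding minimal_in_def by blast
  have pp: "p \<in> BH" using p by (auto simp: minimal_in_def is_projection_def)
  show "(p o\<^sub>L A o\<^sub>L p) o\<^sub>L (p o\<^sub>L B o\<^sub>L p) = (p o\<^sub>L B o\<^sub>L p) o\<^sub>L (p o\<^sub>L A o\<^sub>L p)"
    unfolding ab by (rule blinfun_eqI) (simp add: scalar_op_apply BH_apply[OF pp] scaleC_scaleC mult.commute)
qed (auto simp: minimal_in_def)

text \<open>A single evaluation replaces polarization: since the form vanishes at x and at Z x, its
  value at x + Z x is twice the squared norm of Z x.\<close>

lemma selfadjoint_form_zero:
  assumes Z: "Z \<in> BH" "adj Z = Z" "\<And>x. inner (blinfun_apply Z x) x = 0"
  shows "Z = 0"
proof (rule blinfun_eqI)
  fix x
  have "inner (Z (Z x)) x = inner (Z x) (Z x)"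
    using adj_right[OF Z(1), of "Z x" x] Z(2) by (simp add: inner_eq_Re_cinner)
  then have "inner (Z (x + Z x)) (x + Z x) = 2 * inner (Z x) (Z x)"
    using Z(3)[of x] Z(3)[of "Z x"] by (simp add: blinfun.add_right inner_add)
  then show "Z x = blinfun_apply 0 x" using Z(3)[of "x + Z x"] by simp
qed

context vN
begin

text \<open>If two unit vectors in the range of \<open>p\<close> have different values of the form of \<open>A\<close>, then the
  spectral projection of \<open>p (A - \<mu>) p\<close> for \<open>\<mu>\<close> in between splits \<open>p\<close>.\<close>

lemma unsplittable_sandwich_selfadjoint:
  assumes p: "p \<in> M" "is_projection p"
    and min: "\<And>r. r \<in> M \<Longrightarrow> is_projection r \<Longrightarrow> r o\<^sub>L p = r \<Longrightarrow> r = 0 \<or> r = p"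
    and A: "A \<in> M" "adj A = A"
  shows "\<exists>c::real. p o\<^sub>L A o\<^sub>L p = c *\<^sub>R p"
proof -
  have same: "\<not> inner (A x) x < inner (A y) y" if x: "p x = x" "norm x = 1" and y: "p y = y" "norm y = 1" for x y
  proof
    assume less: "inner (A x) x < inner (A y) y"
    define \<mu> where "\<mu> = (inner (A x) x + inner (A y) y) / 2"
    define D where "D = p o\<^sub>L (A - \<mu> *\<^sub>R id_blinfun) o\<^sub>L p"
    have AM: "A - \<mu> *\<^sub>R id_blinfun \<in> M" by (intro diff A scaleR id)
    have D: "D \<in> M" unfolding D_def by (intro comp p AM)
    have Dadj: "adj D = D" unfolding D_def
      by (rule adj_selfadjoint_sandwich[OF p(2)]) (auto simp: BH[OF AM] adj_diff adj_scaleR adj_id BH_intros BH A)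
    obtain q where q: "q \<in> M" "is_projection q" "\<And>A. A\<in>BH \<Longrightarrow> A o\<^sub>L D = D o\<^sub>L A \<Longrightarrow> A o\<^sub>L q = q o\<^sub>L A"
      "\<And>x. 0 \<le> inner (D (q x)) (q x)" "\<And>x. inner (D (x - q x)) (x - q x) \<le> 0"
      using spectral_projection_mem[OF D Dadj] by blast
    note pD = is_projectionD[OF p(2)] and qD = is_projectionD[OF q(2)]
    have "p o\<^sub>L D = D o\<^sub>L p" unfolding D_def by (rule blinfun_eqI) (simp add: pD)
    then have pq: "p o\<^sub>L q = q o\<^sub>L p" by (rule q(3)[OF pD(1)])
    have pq': "p (q z) = q (p z)" for z using pq by (metis blinfun_apply_blinfun_compose)
    have "is_projection (q o\<^sub>L p)" unfolding is_projection_def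
      by (auto intro!: BH_intros blinfun_eqI simp: pD qD adj_compose pq pq')
    moreover have "(q o\<^sub>L p) o\<^sub>L p = q o\<^sub>L p" by (rule blinfun_eqI) (simp add: pD)
    ultimately consider "q o\<^sub>L p = 0" | "q o\<^sub>L p = p" using min[OF comp[OF q(1) p(1)]] by blast
    then show False
    proof cases
      case 1
      \<comment> \<open>So y lies where the form of D is at most 0, although the value of that form
        at y is \<open>inner (A y) y - \<mu>\<close>, which is positive.\<close>
      have "q y = 0" using arg_cong[OF 1, of "\<lambda>T. blinfun_apply T y"] y by simp
      then have "inner (D y) y \<le> 0" using q(5)[of y] by simp
      then show False using y less is_projectionD(5)[OF p(2), of _ y]
        by (simp add: D_def \<mu>_def blinfun.bilinear_simps inner_eq_Re_cinner cinner.diff_left pD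
            cinner.scaleR_left Re_cinner_self)
    next
      case 2
      have "q x = x" using arg_cong[OF 2, of "\<lambda>T. blinfun_apply T x"] x by simp
      then have "0 \<le> inner (D x) x" using q(4)[of x] by simp
      then show False using x less is_projectionD(5)[OF p(2), of _ x]
        by (simp add: D_def \<mu>_def blinfun.bilinear_simps inner_eq_Re_cinner cinner.diff_left pD
            cinner.scaleR_left Re_cinner_self)
    qed
  qed
  note pD = is_projectionD[OF p(2)]
  have "\<exists>c. \<forall>x. p x = x \<longrightarrow> norm x = 1 \<longrightarrow> inner (A x) x = c"
  proof (cases "\<exists>x. p x = x \<and> norm x = 1")
    case True
    then obtain x where "p x = x" "norm x = 1" by blast
    then have "inner (A y) y = inner (A x) x" if "p y = y" "norm y = 1" for y
      using same[of x y] same[of y x] that by linarith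
    then show ?thesis by blast
  qed auto
  then obtain c where c: "\<And>x. p x = x \<Longrightarrow> norm x = 1 \<Longrightarrow> inner (A x) x = c" by blast
  have c': "inner (A x) x = c * (norm x)\<^sup>2" if "p x = x" for x
  proof (cases "x = 0")
    case False
    have "inner (A (x /\<^sub>R norm x)) (x /\<^sub>R norm x) = c"
      using that False by (intro c) (simp_all add: blinfun.scaleR_right)
    then show ?thesis using False by (simp add: blinfun.scaleR_right field_simps power2_eq_square)
  qed simp
  define Z where "Z = p o\<^sub>L (A - c *\<^sub>R id_blinfun) o\<^sub>L p"
  have AM: "A - c *\<^sub>R id_blinfun \<in> M" by (intro diff A scaleR id)
  have "Z = 0"
  proof (rule selfadjoint_form_zero)
    show "Z \<in> BH" unfolding Z_def by (intro BH comp p AM)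
    show "adj Z = Z" unfolding Z_def
      by (rule adj_selfadjoint_sandwich[OF p(2)]) (auto simp: BH[OF AM] adj_diff adj_scaleR adj_id BH_intros BH A)
    fix x
    have "inner (Z x) x = inner ((A - c *\<^sub>R id_blinfun) (p x)) (p x)"
      by (simp add: Z_def inner_eq_Re_cinner pD)
    also have "\<dots> = 0"
      using c'[of "p x"] by (simp add: pD blinfun.bilinear_simps inner_diff_left power2_norm_eq_inner)
    finally show "inner (Z x) x = 0" .
  qed
  then have "Z x = 0" for x by simp
  then have "p (A (p x)) = c *\<^sub>R p x" for x
    using \<open>\<And>x. Z x = 0\<close>[of x] by (simp add: Z_def blinfun.bilinear_simps pD)
  then show ?thesis by (intro exI[of _ c] blinfun_eqI) (simp add: blinfun.scaleR_left)
qed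

lemma unsplittable_imp_minimal:
  assumes p: "p \<in> M" "is_projection p" "p \<noteq> 0"
    and min: "\<And>r. r \<in> M \<Longrightarrow> is_projection r \<Longrightarrow> r o\<^sub>L p = r \<Longrightarrow> r = 0 \<or> r = p"
  shows "minimal_in M p"
  unfolding minimal_in_def
proof (intro conjI ballI p)
  fix A assume A: "A \<in> M"
  note pB = is_projectionD(1)[OF p(2)]
  \<comment> \<open>\<open>A1\<close> and \<open>A2\<close> are twice the real and imaginary parts,
    so that A is half of A1 + \<i> A2.\<close>
  define A1 where "A1 = A + adj A"
  define A2 where "A2 = scalar_op \<i> o\<^sub>L (adj A - A)"
  have 1: "A1 \<in> M" "A2 \<in> M" unfolding A1_def A2_def by (intro add diff scal A adj)+
  have "scalar_op (cnj \<i>) o\<^sub>L (A - adj A) = scalar_op \<i> o\<^sub>L (adj A - A)"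
    by (rule blinfun_eqI) (simp add: scalar_op_apply blinfun.diff_left scaleC.diff_right scaleC.minus_left)
  moreover have "(A - adj A) o\<^sub>L scalar_op (cnj \<i>) = scalar_op (cnj \<i>) o\<^sub>L (A - adj A)"
    by (rule blinfun_eqI)
      (simp only: blinfun_apply_blinfun_compose scalar_op_apply BH_apply[OF BH_diff[OF BH[OF A] BH[OF adj[OF A]]]])
  ultimately have 2: "adj A1 = A1" "adj A2 = A2"
    using BH[OF A] BH[OF adj[OF A]]
    by (simp_all add: A1_def A2_def adj_add adj_compose adj_diff adj_adj adj_scalar BH_intros)
  obtain c d :: real where cd: "p o\<^sub>L A1 o\<^sub>L p = c *\<^sub>R p" "p o\<^sub>L A2 o\<^sub>L p = d *\<^sub>R p"
    using unsplittable_sandwich_selfadjoint[OF p(1,2) min] 1 2 by metis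
  have "p o\<^sub>L A o\<^sub>L p = scalar_op ((of_real c + \<i> * of_real d) / 2) o\<^sub>L p"
  proof (rule blinfun_eqI)
    fix x
    have e1: "p (A (p x)) + p (adj A (p x)) = scaleC (of_real c) (p x)"
      using arg_cong[OF cd(1), of "\<lambda>T. blinfun_apply T x"]
      by (simp add: A1_def blinfun.bilinear_simps scaleC_of_real)
    have e2: "scaleC \<i> (p (adj A (p x)) - p (A (p x))) = scaleC (of_real d) (p x)"
      using arg_cong[OF cd(2), of "\<lambda>T. blinfun_apply T x"]
      by (simp add: A2_def blinfun.bilinear_simps scaleC_of_real scalar_op_apply BH_apply[OF pB] scaleC.diff_right)
    have "scaleC \<i> (scaleC \<i> (p (adj A (p x)) - p (A (p x)))) = scaleC (\<i> * of_real d) (p x)"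
      unfolding e2 by (simp add: scaleC_scaleC)
    then have e3: "p (A (p x)) - p (adj A (p x)) = scaleC (\<i> * of_real d) (p x)"
      by (simp add: scaleC_scaleC scaleC.minus_left)
    have "scaleC 2 (p (A (p x))) = (p (A (p x)) + p (adj A (p x))) + (p (A (p x)) - p (adj A (p x)))"
      by (simp add: scaleC_add_left[of 1 1, simplified])
    also have "\<dots> = scaleC (of_real c + \<i> * of_real d) (p x)" unfolding e1 e3 by (simp add: scaleC_add_left)
    finally have "scaleC (1/2) (scaleC 2 (p (A (p x)))) = scaleC (1/2) (scaleC (of_real c + \<i> * of_real d) (p x))" by simp
    then show "(p o\<^sub>L A o\<^sub>L p) x = (scalar_op ((of_real c + \<i> * of_real d) / 2) o\<^sub>L p) x"
      by (simp add: scaleC_scaleC scalar_op_apply)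
  qed
  then show "\<exists>c. p o\<^sub>L A o\<^sub>L p = scalar_op c o\<^sub>L p" by blast
qed

lemma csubspace_orbit: "csubspace ((\<lambda>B. blinfun_apply B \<zeta>) ` M)"
  unfolding csubspace_def
proof (intro conjI ballI allI)
  show "0 \<in> (\<lambda>B. blinfun_apply B \<zeta>) ` M" using zero by force
  fix x c assume "x \<in> (\<lambda>B. blinfun_apply B \<zeta>) ` M"
  then obtain B where B: "B \<in> M" "x = B \<zeta>" by blast
  show "scaleC c x \<in> (\<lambda>B. blinfun_apply B \<zeta>) ` M"
    using scal[OF B(1), of c] B(2) by (force simp: scalar_op_apply)
  fix y assume "y \<in> (\<lambda>B. blinfun_apply B \<zeta>) ` M"
  then obtain C where C: "C \<in> M" "y = C \<zeta>" by blast
  show "x + y \<in> (\<lambda>B. blinfun_apply B \<zeta>) ` M"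
    using add[OF B(1) C(1)] B(2) C(2) by (force simp: blinfun.add_left)
qed

text \<open>For \<zeta> in the range of e, p projects onto the closure of M \<zeta>, which M leaves
  invariant. As an A of the commutant commutes with e and with M, its form on M \<zeta> reduces to
  the vectors \<open>e (adj C (B \<zeta>))\<close>, which are multiples of \<zeta>. Thus it is a
  fixed multiple of the inner product, and the corner of p is scalar.\<close>

lemma minimal_commutant:
  assumes e: "minimal_in M e"
  shows "\<exists>p. minimal_in (commutant M) p"
proof -
  have e': "is_projection e" "e \<in> M" "e \<noteq> 0" "\<And>A. A \<in> M \<Longrightarrow> \<exists>c. e o\<^sub>L A o\<^sub>L e = scalar_op c o\<^sub>L e"
    using e by (auto simp: minimal_in_def)
  note eD = is_projectionD[OF e'(1)]
  obtain x where "e x \<noteq> 0" using e'(3) by (metis blinfun_eqI zero_blinfun.rep_eq)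
  then obtain \<zeta> where \<zeta>: "e \<zeta> = \<zeta>" "\<zeta> \<noteq> 0" using eD(4) by metis
  define L0 where "L0 = (\<lambda>B. blinfun_apply B \<zeta>) ` M"
  have L0: "csubspace L0" unfolding L0_def by (rule csubspace_orbit)
  define L where "L = closure L0"
  have L: "csubspace L" "closed L" unfolding L_def by (rule csubspace_closure[OF L0]) simp
  define p where "p = proj_on L"
  have p: "is_projection p" unfolding p_def by (rule is_projection_proj_on[OF L])
  note pD = is_projectionD[OF p]
  have pL: "p x \<in> L" for x unfolding p_def by (rule proj_on_in[OF L])
  interpret N: vN "commutant M" by (rule vN_commutant)
  have "p \<in> commutant M" unfolding p_def
  proof (rule N.proj_on_mem[OF L])
    fix B x assume B: "B \<in> commutant (commutant M)" and x: "x \<in> L"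
    have "L0 \<subseteq> {x. B x \<in> L}"
    proof
      fix y assume "y \<in> L0"
      then obtain C where "C \<in> M" "y = C \<zeta>" unfolding L0_def by blast
      then have "B y \<in> L0" unfolding L0_def using comp[of B C] B bicommutant by force
      then show "y \<in> {x. B x \<in> L}" using closure_subset L_def by blast
    qed
    moreover have "closed {x. B x \<in> L}"
      using continuous_closed_preimage[of UNIV "blinfun_apply B" L] L(2)
      by (simp add: vimage_def linear_continuous_on blinfun.bounded_linear_right)
    ultimately have "L \<subseteq> {x. B x \<in> L}" unfolding L_def by (rule closure_minimal)
    then show "B x \<in> L" using x by blast
  qed
  moreover have "p \<noteq> 0"
  proof
    assume "p = 0"
    have "\<zeta> \<in> L0" unfolding L0_def using id by force
    then have "\<zeta> \<in> L" unfolding L_def using closure_subset by blast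
    then have "p \<zeta> = \<zeta>" unfolding p_def by (rule proj_on_id[OF L])
    then show False using \<zeta> \<open>p = 0\<close> by simp
  qed
  moreover have "\<exists>c. p o\<^sub>L A o\<^sub>L p = scalar_op c o\<^sub>L p" if A: "A \<in> commutant M" for A
  proof -
    note AB = N.BH[OF A]
    define c where "c = cinner (A \<zeta>) \<zeta> / cinner \<zeta> \<zeta>"
    have 0: "cinner (A x) y = c * cinner x y" if x: "x \<in> L0" and y: "y \<in> L0" for x y
    proof -
      obtain B C where BC: "B \<in> M" "C \<in> M" "x = B \<zeta>" "y = C \<zeta>" using x y unfolding L0_def by blast
      \<comment> \<open>The scalar l depends on B and C, but both \<open>cinner x y\<close> and
        \<open>cinner (A x) y\<close> are proportional to it, so it drops out of the ratio
        c.\<close>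
      obtain l where l: "e o\<^sub>L (adj C o\<^sub>L B) o\<^sub>L e = scalar_op l o\<^sub>L e"
        using e'(4)[OF comp[OF adj[OF BC(2)] BC(1)]] by blast
      have l': "e (adj C (B \<zeta>)) = scaleC l \<zeta>"
        using arg_cong[OF l, of "\<lambda>T. blinfun_apply T \<zeta>"] \<zeta> by (simp add: scalar_op_apply)
      have C: "cinner z (C w) = cinner (adj C z) w" for z w
        by (simp add: adj_left BH[OF BC(2)])
      have "cinner x y = cinner (adj C (B \<zeta>)) (e \<zeta>)" by (simp add: BC \<zeta> C)
      also have "\<dots> = l * cinner \<zeta> \<zeta>" by (simp add: eD(5)[symmetric] l' cinner_scaleC_left)
      finally have 1: "cinner x y = l * cinner \<zeta> \<zeta>" .
      have "cinner (A x) y = cinner (A (adj C (B \<zeta>))) (e \<zeta>)"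
        using commutes[OF adj[OF BC(2)] A] by (simp add: BC \<zeta> C)
      also have "\<dots> = cinner (A (e (adj C (B \<zeta>)))) \<zeta>"
        using commutes[OF e'(2) A] by (simp add: eD(5)[symmetric])
      also have "\<dots> = l * cinner (A \<zeta>) \<zeta>" by (simp add: l' BH_apply[OF AB] cinner_scaleC_left)
      finally show ?thesis using 1 \<zeta>(2) by (simp add: c_def cinner_self_zero)
    qed
    have 1: "cinner (A x) y = c * cinner x y" if x: "x \<in> L" and y: "y \<in> L0" for x y
    proof -
      have "closed {x. cinner (A x) y = c * cinner x y}"
        by (intro closed_Collect_eq continuous_intros cinner.continuous_on)
      then have "L \<subseteq> {x. cinner (A x) y = c * cinner x y}" unfolding L_def
        using 0 y by (intro closure_minimal) auto
      then show ?thesis using x by blast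
    qed
    have 2: "cinner (A x) y = c * cinner x y" if x: "x \<in> L" and y: "y \<in> L" for x y
    proof -
      have "closed {y. cinner (A x) y = c * cinner x y}"
        by (intro closed_Collect_eq continuous_intros cinner.continuous_on)
      then have "L \<subseteq> {y. cinner (A x) y = c * cinner x y}" unfolding L_def
        using 1 x L_def by (intro closure_minimal) auto
      then show ?thesis using y by blast
    qed
    have "p (A (p x)) = scaleC c (p x)" for x
    proof (rule cinner_eqI)
      fix y
      have "cinner (p (A (p x))) y = c * cinner (p x) (p y)" using 2[OF pL pL] by (simp add: pD)
      also have "\<dots> = cinner (scaleC c (p x)) y" by (simp add: cinner_scaleC_left pD(4) pD(5)[symmetric])
      finally show "cinner (p (A (p x))) y = cinner (scaleC c (p x)) y" .
    qed
    then show ?thesis by (intro exI[of _ c] blinfun_eqI) (simp add: scalar_op_apply)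
  qed
  ultimately show ?thesis using p unfolding minimal_in_def by blast
qed

end

text \<open>For a subprojection r of p, the elements p C p and p - r of the abelian corner commute,
  whence r C (p - r) = 0 for all C in M. In a factor this leaves only r = 0 and r = p.\<close>

lemma (in vN_factor) abelian_imp_minimal:
  assumes p: "abelian_projection M p" "p \<noteq> 0"
  shows "minimal_in M p"
proof (rule unsplittable_imp_minimal)
  show pM: "p \<in> M" and pp: "is_projection p" "p \<noteq> 0" using p by (auto simp: abelian_projection_def)
  note pD = is_projectionD[OF pp(1)]
  fix r assume r: "r \<in> M" "is_projection r" "r o\<^sub>L p = r"
  note rD = is_projectionD[OF r(2)]
  have rp: "r (p x) = r x" for x using r(3) by (metis blinfun_apply_blinfun_compose)
  have "p o\<^sub>L r = r" using arg_cong[OF r(3), of adj] by (simp add: adj_compose pD rD)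
  then have pr: "p (r x) = r x" for x by (metis blinfun_apply_blinfun_compose)
  have "r o\<^sub>L C o\<^sub>L (p - r) = 0" if C: "C \<in> M" for C
  proof (rule blinfun_eqI)
    fix x
    have "(p o\<^sub>L C o\<^sub>L p) o\<^sub>L (p o\<^sub>L (p - r) o\<^sub>L p) = (p o\<^sub>L (p - r) o\<^sub>L p) o\<^sub>L (p o\<^sub>L C o\<^sub>L p)"
      using p(1) C diff[OF pM r(1)] unfolding abelian_projection_def by blast
    from arg_cong[OF this, of "\<lambda>T. r (blinfun_apply T x)"]
    have "r (p (C (p (p (p (p x) - r (p x)))))) = r (p (p (p (p (C (p x)))) - r (p (p (C (p x))))))"
      by (simp add: blinfun.diff_left)
    then have "r (C (p x - r x)) = r (C (p x)) - r (r (C (p x)))"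
      by (simp add: pD rp pr blinfun.diff_right)
    then show "(r o\<^sub>L C o\<^sub>L (p - r)) x = blinfun_apply 0 x" by (simp add: blinfun.diff_left rD)
  qed
  then have "r = 0 \<or> p - r = 0" by (intro product_zero r diff pM)
  then show "r = 0 \<or> r = p" by auto
qed

section \<open>Orthonormal sequences\<close>

text \<open>Vectors in the span of their predecessors give zeros, as \<open>sgn 0 = 0\<close>.\<close>

fun gram_schmidt :: "(nat \<Rightarrow> 'a::complex_inner) \<Rightarrow> nat \<Rightarrow> 'a" where
  "gram_schmidt d n = sgn (d n - (\<Sum>g\<leftarrow>map (gram_schmidt d) [0..<n]. scaleC (cinner (d n) g) g))"

declare gram_schmidt.simps [simp del]

lemma gram_schmidt_eq:
  "gram_schmidt d n = sgn (d n - (\<Sum>k<n. scaleC (cinner (d n) (gram_schmidt d k)) (gram_schmidt d k)))"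
  by (subst gram_schmidt.simps) (simp add: interv_sum_list_conv_sum_set_nat atLeast0LessThan o_def)

lemma norm_gram_schmidt: "gram_schmidt d n = 0 \<or> norm (gram_schmidt d n) = 1"
  by (subst (1 2) gram_schmidt_eq) (auto simp: norm_sgn sgn_zero_iff)

lemma gram_schmidt_orthogonal_less: "m < n \<Longrightarrow> cinner (gram_schmidt d n) (gram_schmidt d m) = 0"
proof (induction n arbitrary: m rule: less_induct)
  case (less n)
  let ?g = "gram_schmidt d"
  have orth: "cinner (?g k) (?g m) = (if k = m then cinner (?g m) (?g m) else 0)" if "k < n" for k
  proof (cases k m rule: linorder_cases)
    case less then show ?thesis using less.IH[of m k] \<open>m < n\<close> cinner_eq_zero_commute by auto
  next
    case greater then show ?thesis using less.IH[of k m] that by auto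
  qed simp
  \<comment> \<open>True for a unit vector and for the zero vector alike, so degenerate steps need
    no separate treatment.\<close>
  have gg: "cinner v (?g m) * cinner (?g m) (?g m) = cinner v (?g m)" for v
    using norm_gram_schmidt[of d m] by (elim disjE) (simp_all add: cinner_self)
  have "cinner (\<Sum>k<n. scaleC (cinner (d n) (?g k)) (?g k)) (?g m)
      = (\<Sum>k<n. cinner (d n) (?g k) * cinner (?g k) (?g m))"
    by (simp add: cinner.sum_left cinner_scaleC_left)
  also have "\<dots> = (\<Sum>k<n. if k = m then cinner (d n) (?g m) else 0)"
    by (rule sum.cong[OF refl]) (simp only: orth lessThan_iff gg mult_zero_right split: if_split, simp add: gg)
  also have "\<dots> = cinner (d n) (?g m)" using less.prems by (simp only: sum.delta finite_lessThan lessThan_iff if_True)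
  finally have "cinner (d n - (\<Sum>k<n. scaleC (cinner (d n) (?g k)) (?g k))) (?g m) = 0"
    by (simp add: cinner.diff_left)
  then show ?case
    by (subst gram_schmidt_eq) (simp add: sgn_div_norm cinner.scaleR_left)
qed

lemma gram_schmidt_orthogonal: "m \<noteq> n \<Longrightarrow> cinner (gram_schmidt d m) (gram_schmidt d n) = 0"
  using gram_schmidt_orthogonal_less[of m n d] gram_schmidt_orthogonal_less[of n m d]
  by (cases m n rule: linorder_cases) (auto simp: cinner_eq_zero_commute[of "gram_schmidt d m"])

lemma gram_schmidt_mem:
  assumes L: "csubspace L" "\<And>n. d n \<in> L"
  shows "gram_schmidt d n \<in> L"
proof (induction n rule: less_induct)
  case (less n)
  have "d n - (\<Sum>k<n. scaleC (cinner (d n) (gram_schmidt d k)) (gram_schmidt d k)) \<in> L" (is "?v \<in> L")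
    using less by (intro csubspaceD(5)[OF L(1)] L(2) csubspace_sum[OF L(1)] csubspaceD(3)[OF L(1)]) auto
  then have "scaleC (of_real (inverse (norm ?v))) ?v \<in> L" by (rule csubspaceD(3)[OF L(1)])
  then show ?case unfolding gram_schmidt_eq[of d n] by (simp only: sgn_div_norm scaleC_of_real)
qed

text \<open>\<open>d n\<close> is a multiple of \<open>gram_schmidt d n\<close> plus a combination
  of earlier vectors. When the new vector is zero, so is the remainder that it normalizes.\<close>

lemma gram_schmidt_span:
  assumes x: "\<And>k. cinner (gram_schmidt d k) x = 0"
  shows "cinner (d n) x = 0"
proof -
  let ?v = "d n - (\<Sum>k<n. scaleC (cinner (d n) (gram_schmidt d k)) (gram_schmidt d k))"
  have "v = norm v *\<^sub>R sgn v" for v :: 'a by (cases "v = 0") (simp_all add: sgn_div_norm)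
  from this[of ?v] have "?v = norm ?v *\<^sub>R gram_schmidt d n" unfolding gram_schmidt_eq[of d n] .
  then have "cinner ?v x = norm ?v *\<^sub>R cinner (gram_schmidt d n) x" by (metis cinner.scaleR_left)
  then have "cinner ?v x = 0" using x by simp
  then show ?thesis by (simp add: cinner.diff_left cinner.sum_left cinner_scaleC_left x)
qed

text \<open>A dense sequence of the whole space need not meet L. Hence for each of its points and
  each radius 1/(k+1), a point of L within that radius is picked whenever there is one.\<close>

lemma separable_subset_sequence:
  fixes L :: "'a::complex_inner set"
  assumes sep: "separable_space (euclidean :: 'a topology)" and L: "L \<noteq> {}"
  shows "\<exists>d::nat \<Rightarrow> 'a. (\<forall>n. d n \<in> L) \<and> L \<subseteq> closure (range d)"
proof -
  obtain C :: "'a set" where C: "countable C" "closure C = UNIV"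
    using sep unfolding separable_space_def by auto
  then have "C \<noteq> {}" by auto
  then obtain c :: "nat \<Rightarrow> 'a" where c: "range c = C" using C(1) by (metis range_from_nat_into)
  define d' where "d' n k = (SOME y. y \<in> L \<and> ((\<exists>z\<in>L. dist z (c n) < 1 / real (Suc k)) \<longrightarrow> dist y (c n) < 1 / real (Suc k)))"
    for n k
  have d': "d' n k \<in> L \<and> ((\<exists>z\<in>L. dist z (c n) < 1 / real (Suc k)) \<longrightarrow> dist (d' n k) (c n) < 1 / real (Suc k))" for n k
    unfolding d'_def by (rule someI_ex) (use L in blast)
  define d where "d m = (case prod_decode m of (n, k) \<Rightarrow> d' n k)" for m
  have "L \<subseteq> closure (range d)"
  proof
    fix x assume x: "x \<in> L"
    show "x \<in> closure (range d)" unfolding closure_approachable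
    proof (intro allI impI)
      fix e :: real assume e: "0 < e"
      then obtain k where k: "1 / real (Suc k) < e / 2" using nat_approx_posE[of "e/2"] by auto
      have "x \<in> closure C" using C(2) by simp
      then obtain n where n: "dist (c n) x < 1 / real (Suc k)"
        unfolding closure_approachable using c by (metis rangeE of_nat_0_less_iff zero_less_Suc zero_less_divide_1_iff)
      then have "dist (d' n k) (c n) < 1 / real (Suc k)" using d' x by (metis dist_commute)
      then have "dist (d' n k) x < e" using n k dist_triangle[of "d' n k" x "c n"] by linarith
      moreover have "d' n k = d (prod_encode (n, k))" by (simp add: d_def)
      ultimately show "\<exists>y\<in>range d. dist y x < e" by force
    qed
  qed
  moreover have "\<forall>n. d n \<in> L" unfolding d_def using d' by (auto split: prod.split)
  ultimately show ?thesis by blast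
qed

lemma orthonormal_sequence:
  fixes L :: "'a::complex_inner set"
  assumes sep: "separable_space (euclidean :: 'a topology)" and L: "csubspace L"
  shows "\<exists>e::nat \<Rightarrow> 'a. (\<forall>n. e n \<in> L) \<and> (\<forall>n. e n = 0 \<or> norm (e n) = 1) \<and>
    (\<forall>m n. m \<noteq> n \<longrightarrow> cinner (e m) (e n) = 0) \<and>
    (\<forall>x. (\<forall>n. cinner (e n) x = 0) \<longrightarrow> (\<forall>y\<in>L. cinner y x = 0))"
proof -
  have "L \<noteq> {}" using csubspaceD(1)[OF L] by auto
  obtain d :: "nat \<Rightarrow> 'a" where "(\<forall>n. d n \<in> L) \<and> L \<subseteq> closure (range d)"
    using separable_subset_sequence[OF sep \<open>L \<noteq> {}\<close>] ..
  then have d: "\<And>n. d n \<in> L" "L \<subseteq> closure (range d)" by simp_all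
  have "cinner y x = 0" if x: "\<And>n. cinner (gram_schmidt d n) x = 0" and y: "y \<in> L" for x y
  proof -
    have "closed {y. cinner y x = 0}" by (intro closed_Collect_eq continuous_intros cinner.continuous_on)
    moreover have "range d \<subseteq> {y. cinner y x = 0}" using gram_schmidt_span[OF x] by auto
    ultimately have "closure (range d) \<subseteq> {y. cinner y x = 0}" by (rule closure_minimal[rotated])
    then show ?thesis using d y by blast
  qed
  then show ?thesis
    using norm_gram_schmidt gram_schmidt_orthogonal gram_schmidt_mem[OF L d(1)]
    by (intro exI[of _ "gram_schmidt d"] conjI allI impI) simp_all
qed

section \<open>Strong limits\<close>

text \<open>A three-epsilon argument: the uniform norm bound carries convergence from nearby vectors
  to x.\<close>

lemma convergent_of_dense:
  fixes T :: "nat \<Rightarrow> ('h::complex_hilbert \<Rightarrow>\<^sub>L 'h)"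
  assumes bd: "\<And>n. norm (T n) \<le> C"
    and dense: "\<And>e. e > 0 \<Longrightarrow> \<exists>w. norm (x - w) < e \<and> convergent (\<lambda>n. T n w)"
  shows "convergent (\<lambda>n. T n x)"
proof -
  have "Cauchy (\<lambda>n. T n x)"
  proof (rule metric_CauchyI)
    fix e :: real assume e: "0 < e"
    have C: "C \<ge> 0" by (rule order_trans[OF norm_ge_zero bd[of 0]])
    define d where "d = e / 3 / (C + 1)"
    have d: "d > 0" using e C by (simp add: d_def)
    obtain w where w: "norm (x - w) < d" "convergent (\<lambda>n. T n w)" using dense[OF d] by blast
    have small: "norm (T n x - T n w) < e / 3" for n
    proof -
      have "norm (T n x - T n w) \<le> norm (T n) * norm (x - w)"
        by (simp add: blinfun.diff_right[symmetric] norm_blinfun)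
      also have "\<dots> \<le> C * d" using bd w(1) C by (intro mult_mono) auto
      also have "\<dots> < (C + 1) * d" using d by (simp add: algebra_simps)
      also have "\<dots> = e / 3"
      proof -
        have "C + 1 \<noteq> 0" using C by linarith
        then show ?thesis unfolding d_def by (metis nonzero_mult_div_cancel_left times_divide_eq_right)
      qed
      finally show ?thesis .
    qed
    have "Cauchy (\<lambda>n. T n w)" by (rule convergent_Cauchy[OF w(2)])
    then have "\<exists>N. \<forall>m\<ge>N. \<forall>n\<ge>N. norm (T m w - T n w) < e / 3"
      by (rule CauchyD) (use e in simp)
    then obtain N where N: "\<And>m n. m \<ge> N \<Longrightarrow> n \<ge> N \<Longrightarrow> norm (T m w - T n w) < e / 3" by blast
    have "dist (T m x) (T n x) < e" if "m \<ge> N" "n \<ge> N" for m n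
    proof -
      have "dist (T m x) (T n x) \<le> dist (T m x) (T m w) + dist (T m w) (T n w) + dist (T n w) (T n x)"
        using dist_triangle[of "T m x" "T n x" "T m w"] dist_triangle[of "T m w" "T n x" "T n w"] by linarith
      then show ?thesis using small[of m] small[of n] N[OF that] by (simp add: dist_norm norm_minus_commute)
    qed
    then show "\<exists>M. \<forall>m\<ge>M. \<forall>n\<ge>M. dist (T m x) (T n x) < e" by blast
  qed
  then show ?thesis by (rule Cauchy_convergent)
qed

lemma strong_limit_BH:
  fixes T :: "nat \<Rightarrow> ('h::complex_hilbert \<Rightarrow>\<^sub>L 'h)"
  assumes BH: "\<And>n. T n \<in> BH" and bd: "\<And>n. norm (T n) \<le> C" and conv: "\<And>x. convergent (\<lambda>n. T n x)"
  shows "\<exists>S\<in>BH. norm S \<le> C \<and> (\<forall>x. (\<lambda>n. T n x) \<longlonglongrightarrow> blinfun_apply S x)"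
proof -
  define f where "f x = lim (\<lambda>n. T n x)" for x
  have f: "(\<lambda>n. T n x) \<longlonglongrightarrow> f x" for x
    using conv unfolding f_def by (simp add: convergent_LIMSEQ_iff)
  have C: "C \<ge> 0" by (rule order_trans[OF norm_ge_zero bd[of 0]])
  have sc: "f (scaleC c x) = scaleC c (f x)" for c x
  proof (rule LIMSEQ_unique[OF f])
    show "(\<lambda>n. T n (scaleC c x)) \<longlonglongrightarrow> scaleC c (f x)"
      unfolding BH_apply[OF BH] by (rule scaleC.tendsto[OF tendsto_const f])
  qed
  have nf: "norm (f x) \<le> norm x * C" for x
  proof (rule LIMSEQ_le_const2[OF tendsto_norm[OF f]], intro exI allI impI)
    fix n show "norm (T n x) \<le> norm x * C"
      using norm_blinfun[of "T n" x] mult_right_mono[OF bd[of n], of "norm x"] by (simp add: mult.commute)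
  qed
  have "bounded_linear f"
  proof (rule bounded_linear_intro[OF _ _ nf])
    show "f (x + y) = f x + f y" for x y
    proof (rule LIMSEQ_unique[OF f])
      show "(\<lambda>n. T n (x + y)) \<longlonglongrightarrow> f x + f y"
        unfolding blinfun.add_right by (rule tendsto_add[OF f f])
    qed
    show "f (r *\<^sub>R x) = r *\<^sub>R f x" for r x using sc[of "of_real r" x] by (simp add: scaleC_of_real)
  qed
  then have b: "blinfun_apply (Blinfun f) = f" by (rule bounded_linear_Blinfun_apply)
  have "norm (Blinfun f) \<le> C" using C nf by (intro norm_blinfun_bound) (simp_all add: b mult.commute)
  then show ?thesis using f sc by (intro bexI[of _ "Blinfun f"]) (simp_all add: BH_def b)
qed

text \<open>The squared norms increase and are bounded; the Pythagorean identity turns their Cauchy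
  property into that of z.\<close>

lemma convergent_of_orthogonal_increments:
  fixes z :: "nat \<Rightarrow> 'h::complex_hilbert"
  assumes inc: "\<And>m n. m \<le> n \<Longrightarrow> (norm (z n))\<^sup>2 = (norm (z n - z m))\<^sup>2 + (norm (z m))\<^sup>2"
    and bd: "\<And>n. norm (z n) \<le> C"
  shows "convergent z"
proof -
  have mono: "(norm (z m))\<^sup>2 \<le> (norm (z n))\<^sup>2" if "m \<le> n" for m n using inc[OF that] by simp
  have "convergent (\<lambda>n. (norm (z n))\<^sup>2)"
  proof (rule Bseq_monoseq_convergent)
    show "Bseq (\<lambda>n. (norm (z n))\<^sup>2)"
      by (rule BseqI'[where K = "C\<^sup>2"]) (simp add: power_mono[OF bd])
    show "monoseq (\<lambda>n. (norm (z n))\<^sup>2)" using mono by (simp add: monoseq_def)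
  qed
  then have c: "Cauchy (\<lambda>n. (norm (z n))\<^sup>2)" by (rule convergent_Cauchy)
  have "Cauchy z"
  proof (rule metric_CauchyI)
    fix e :: real assume e: "0 < e"
    have "\<exists>N. \<forall>m\<ge>N. \<forall>n\<ge>N. dist ((norm (z m))\<^sup>2) ((norm (z n))\<^sup>2) < e\<^sup>2"
      by (rule metric_CauchyD[OF c]) (use e in simp)
    then obtain N where N: "\<And>m n. m \<ge> N \<Longrightarrow> n \<ge> N \<Longrightarrow> dist ((norm (z m))\<^sup>2) ((norm (z n))\<^sup>2) < e\<^sup>2"
      by blast
    have *: "dist (z n) (z m) < e" if "m \<ge> N" "m \<le> n" for m n
    proof -
      have "(norm (z n - z m))\<^sup>2 < e\<^sup>2"
        using N[of n m] that inc[of m n] by (auto simp: dist_real_def abs_if split: if_splits)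
      then show ?thesis using e by (simp add: dist_norm power2_less_imp_less)
    qed
    have "dist (z m) (z n) < e" if "m \<ge> N" "n \<ge> N" for m n
      using *[of n m] *[of m n] that by (cases "m \<le> n") (auto simp: dist_commute)
    then show "\<exists>M. \<forall>m\<ge>M. \<forall>n\<ge>M. dist (z m) (z n) < e" by blast
  qed
  then show ?thesis by (rule Cauchy_convergent)
qed

lemma norm_decomp_projection:
  assumes "is_projection q"
  shows "(norm x)\<^sup>2 = (norm (x - blinfun_apply q x))\<^sup>2 + (norm (blinfun_apply q x))\<^sup>2"
proof -
  have "cinner (x - q x) (q x) = 0"
    using is_projectionD[OF assms] by (simp add: is_projectionD(5)[OF assms, symmetric] blinfun.diff_right)
  from norm_add_orthogonal[OF this] show ?thesis by simp
qed

text \<open>Increasing projections tending strongly to the identity, in the role of a filtration for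
  a martingale.\<close>

locale proj_filtration =
  fixes Q :: "nat \<Rightarrow> ('h::complex_hilbert \<Rightarrow>\<^sub>L 'h)"
  assumes proj: "is_projection (Q n)"
    and nested: "m \<le> n \<Longrightarrow> Q m (Q n x) = Q m x"
    and lim: "(\<lambda>n. Q n x) \<longlonglongrightarrow> x"
begin

lemma nested': "m \<le> n \<Longrightarrow> Q n (Q m x) = Q m x"
  by (rule cinner_eqI2) (metis is_projectionD(5)[OF proj] nested)

lemma BH: "Q n \<in> BH" by (rule is_projectionD(1)[OF proj])

text \<open>Martingale convergence for operators: \<open>T m\<close> is the compression of every
  later \<open>T n\<close>, so on a vector in the range of some \<open>Q k\<close> the increments
  are eventually orthogonal, with bounded norms. Such vectors are dense.\<close>

lemma compression_limit:
  assumes BH: "\<And>n. T n \<in> BH" and bd: "\<And>n. norm (T n) \<le> C"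
    and compat: "\<And>m n x. m \<le> n \<Longrightarrow> Q m (T n (Q m x)) = blinfun_apply (T m) x"
  shows "\<exists>S\<in>BH. norm S \<le> C \<and> (\<forall>x. (\<lambda>n. T n x) \<longlonglongrightarrow> blinfun_apply S x)"
proof (rule strong_limit_BH[OF BH bd])
  fix x
  show "convergent (\<lambda>n. T n x)"
  proof (rule convergent_of_dense[OF bd])
    fix e :: real assume "e > 0"
    then obtain k where k: "dist (Q k x) x < e"
      using lim[of x] unfolding lim_sequentially by blast
    define w where "w = Q k x"
    have "convergent (\<lambda>n. T (n + k) w)"
    proof (rule convergent_of_orthogonal_increments)
      fix m n :: nat assume mn: "m \<le> n"
      have "Q (m + k) w = w" unfolding w_def by (rule nested') simp
      then have "Q (m + k) (T (n + k) w) = T (m + k) w" using compat[of "m + k" "n + k" w] mn by simp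
      then show "(norm (T (n + k) w))\<^sup>2 = (norm (T (n + k) w - T (m + k) w))\<^sup>2 + (norm (T (m + k) w))\<^sup>2"
        using norm_decomp_projection[OF proj, of "T (n + k) w" "m + k"] by simp
    next
      fix n show "norm (T (n + k) w) \<le> C * norm w"
        by (rule order_trans[OF norm_blinfun]) (intro mult_right_mono bd norm_ge_zero)
    qed
    then have "convergent (\<lambda>n. T n w)" by (rule iffD1[OF convergent_ignore_initial_segment])
    then show "\<exists>w. norm (x - w) < e \<and> convergent (\<lambda>n. T n w)"
      using k by (intro exI[of _ w]) (simp add: w_def dist_norm norm_minus_commute)
  qed
qed

end

text \<open>The partial sums converge by Pythagoras. The difference between x and the limit is
  annihilated by every \<open>p k\<close>, so totality identifies the limit.\<close>

lemma orthogonal_projections_filtration: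
  fixes p :: "nat \<Rightarrow> ('h::complex_hilbert \<Rightarrow>\<^sub>L 'h)"
  assumes p: "\<And>n. is_projection (p n)" and orth: "\<And>m n x. m \<noteq> n \<Longrightarrow> p m (p n x) = 0"
    and total: "\<And>x. (\<And>n. p n x = 0) \<Longrightarrow> x = 0"
  defines "Q \<equiv> \<lambda>N. \<Sum>n<N. p n"
  shows "proj_filtration Q" "(norm (Q N x))\<^sup>2 = (\<Sum>n<N. (norm (p n x))\<^sup>2)"
proof -
  note pD = is_projectionD[OF p]
  have Qx: "Q N x = (\<Sum>n<N. p n x)" for N x by (simp add: Q_def blinfun.sum_left)
  have pQ: "p k (Q N x) = (if k < N then p k x else 0)" for k N x
  proof -
    have "p k (Q N x) = (\<Sum>n<N. p k (p n x))" by (simp add: Q_def blinfun.sum_left blinfun.sum_right)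
    also have "\<dots> = (\<Sum>n<N. if n = k then p k x else 0)"
      by (rule sum.cong) (auto simp: orth pD)
    finally show ?thesis by simp
  qed
  have nest: "Q m (Q n x) = Q m x" if "m \<le> n" for m n x
    using that by (simp add: Qx[of m] pQ)
  have QB: "Q n \<in> BH" for n unfolding Q_def by (intro BH_sum pD)
  have "adj (Q n) = Q n" for n
    by (rule adj_eqI) (simp add: Q_def blinfun.sum_left cinner.sum_left cinner.sum_right pD)
  then have Q: "is_projection (Q n)" for n
    using QB nest by (auto simp: is_projection_def intro: blinfun_eqI)
  have "(\<lambda>n. Q n x) \<longlonglongrightarrow> x" for x
  proof -
    have "convergent (\<lambda>n. Q n x)"
    proof (rule convergent_of_orthogonal_increments)
      show "norm (Q n x) \<le> norm x" for n by (rule is_projectionD(6)[OF Q])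
      show "(norm (Q n x))\<^sup>2 = (norm (Q n x - Q m x))\<^sup>2 + (norm (Q m x))\<^sup>2" if "m \<le> n" for m n
        using norm_decomp_projection[OF Q[of m], of "Q n x"] nest[OF that] by simp
    qed
    then obtain y where y: "(\<lambda>n. Q n x) \<longlonglongrightarrow> y" unfolding convergent_def by blast
    have "p k (x - y) = 0" for k
    proof -
      have "(\<lambda>n. p k (Q n x)) \<longlonglongrightarrow> p k y" by (rule blinfun.tendsto[OF tendsto_const y])
      moreover have "(\<lambda>n. p k (Q n x)) \<longlonglongrightarrow> p k x"
        by (rule tendsto_eventually) (auto simp: pQ eventually_sequentially intro!: exI[of _ "Suc k"])
      ultimately have "p k y = p k x" by (rule LIMSEQ_unique)
      then show ?thesis by (simp add: blinfun.diff_right)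
    qed
    then show ?thesis using total[of "x - y"] y by simp
  qed
  then show "proj_filtration Q" using Q nest by unfold_locales
  have "of_real ((norm (Q N x))\<^sup>2) = cinner (Q N x) x" by (rule is_projectionD(7)[OF Q, symmetric])
  also have "\<dots> = of_real (\<Sum>n<N. (norm (p n x))\<^sup>2)"
    by (simp add: Q_def blinfun.sum_left cinner.sum_left pD(7))
  finally show "(norm (Q N x))\<^sup>2 = (\<Sum>n<N. (norm (p n x))\<^sup>2)" by (simp only: of_real_eq_iff)
qed

section \<open>The sigma-weak topology\<close>

lemma square_summable_blinfun:
  assumes "square_summable x"
  shows "square_summable (\<lambda>n. blinfun_apply A (x n))"
  unfolding square_summable_def
proof (rule summable_comparison_test')
  show "summable (\<lambda>n. (norm A)\<^sup>2 * (norm (x n))\<^sup>2)"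
    using assms by (simp add: square_summable_def summable_mult)
  show "norm ((norm (A (x n)))\<^sup>2) \<le> (norm A)\<^sup>2 * (norm (x n))\<^sup>2" if "n \<ge> 0" for n
    using power_mono[OF norm_blinfun[of A "x n"] norm_ge_zero, of 2] by (simp add: power_mult_distrib)
qed

text \<open>The weight t is free, so that the contribution of one fixed factor can be made
  small.\<close>

lemma norm_mult_le_squares: "t > 0 \<Longrightarrow> norm x * norm y \<le> t * (norm x)\<^sup>2 + (norm y)\<^sup>2 / t"
proof -
  assume t: "t > 0"
  have "0 \<le> (t * norm x - norm y)\<^sup>2 / t" using t by simp
  also have "\<dots> = t * (norm x)\<^sup>2 + (norm y)\<^sup>2 / t - 2 * (norm x * norm y)"
    using t by (simp add: power2_eq_square field_simps)
  finally have "2 * (norm x * norm y) \<le> t * (norm x)\<^sup>2 + (norm y)\<^sup>2 / t" by linarith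
  moreover have "0 \<le> norm x * norm y" by simp
  ultimately show ?thesis by linarith
qed

lemma square_summable_cinner:
  assumes "square_summable x" "square_summable y"
  shows "summable (\<lambda>n. norm (cinner (x n) (y n)))"
proof (rule summable_comparison_test')
  show "summable (\<lambda>n. (norm (x n))\<^sup>2 + (norm (y n))\<^sup>2)"
    using assms by (simp add: square_summable_def summable_add)
  show "norm (norm (cinner (x n) (y n))) \<le> (norm (x n))\<^sup>2 + (norm (y n))\<^sup>2" if "n \<ge> 0" for n
    using norm_cinner_le[of "x n" "y n"] norm_mult_le_squares[of 1 "x n" "y n"] by simp
qed

lemmas swf_summable_norm = square_summable_cinner[OF square_summable_blinfun]
lemmas swf_summable = summable_norm_cancel[OF swf_summable_norm]

lemma swf_add:
  assumes "square_summable x" "square_summable y"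
  shows "sigma_weak_functional x y (A + B) = sigma_weak_functional x y A + sigma_weak_functional x y B"
  unfolding sigma_weak_functional_def
  by (simp add: blinfun.add_left cinner_add_left suminf_add[OF swf_summable[OF assms] swf_summable[OF assms]])

lemma swf_diff:
  assumes "square_summable x" "square_summable y"
  shows "sigma_weak_functional x y (A - B) = sigma_weak_functional x y A - sigma_weak_functional x y B"
  unfolding sigma_weak_functional_def
  by (simp add: blinfun.diff_left cinner.diff_left suminf_diff[OF swf_summable[OF assms] swf_summable[OF assms]])

lemma swf_scalar:
  assumes "square_summable x" "square_summable y"
  shows "sigma_weak_functional x y (scalar_op c o\<^sub>L A) = c * sigma_weak_functional x y A"
  unfolding sigma_weak_functional_def
  by (simp add: scalar_op_apply cinner_scaleC_left suminf_mult[OF swf_summable[OF assms]])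

lemma square_summable_single: "square_summable (\<lambda>n. if n = 0 then x else 0)"
  unfolding square_summable_def by (rule summable_finite[of "{0}"]) auto

lemma swf_single:
  "sigma_weak_functional (\<lambda>n. if n = 0 then x else 0) (\<lambda>n. if n = 0 then y else 0) A = cinner (blinfun_apply A x) y"
  unfolding sigma_weak_functional_def by (subst suminf_finite[of "{0}"]) auto

lemma continuous_swf:
  assumes "square_summable x" "square_summable y"
  shows "continuous_map sigma_weak euclidean (sigma_weak_functional x y)"
  unfolding continuous_map_def topspace_sigma_weak
proof (intro conjI allI impI)
  fix U :: "complex set" assume "openin euclidean U"
  then have "{A \<in> BH. sigma_weak_functional x y A \<in> U} \<in> {{A \<in> BH. sigma_weak_functional x y A \<in> U} | x y U.
        square_summable x \<and> square_summable y \<and> open U}" using assms by auto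
  then show "openin sigma_weak {A \<in> BH. sigma_weak_functional x y A \<in> U}"
    unfolding sigma_weak_def by (rule topology_generated_by_Basis)
qed simp

lemma continuous_vector_functional: "continuous_map sigma_weak euclidean (\<lambda>A. cinner (blinfun_apply A x) y)"
  using continuous_swf[OF square_summable_single square_summable_single, of x y] unfolding swf_single .

text \<open>Continuity into a generated topology need only be tested on the generating sets, that
  is, one functional at a time.\<close>

lemma normal_mapI:
  fixes S :: "('h::complex_hilbert \<Rightarrow>\<^sub>L 'h) set"
  assumes S: "S \<subseteq> BH" and im: "\<And>A. A \<in> S \<Longrightarrow> \<phi> A \<in> S"
    and c: "\<And>x y. square_summable x \<Longrightarrow> square_summable y \<Longrightarrow>
      continuous_map (subtopology sigma_weak S) euclidean (\<lambda>A. sigma_weak_functional x y (\<phi> A))"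
  shows "normal_map S \<phi>"
proof -
  let ?X = "subtopology sigma_weak S"
  have tX: "topspace ?X = S" using S by (auto simp: topspace_sigma_weak)
  have "continuous_map ?X sigma_weak \<phi>"
    unfolding sigma_weak_def[where 'h = 'h]
  proof (rule continuous_on_generated_topo, fold sigma_weak_def)
    show "\<phi> ` topspace ?X \<subseteq> \<Union> {{A \<in> (BH :: ('h \<Rightarrow>\<^sub>L 'h) set). sigma_weak_functional x y A \<in> U} | x y U.
        square_summable x \<and> square_summable y \<and> open U}"
      using im S topspace_sigma_weak[where 'h = 'h] unfolding tX sigma_weak_def topology_generated_by_topspace by auto
    fix U assume "U \<in> {{A \<in> (BH :: ('h \<Rightarrow>\<^sub>L 'h) set). sigma_weak_functional x y A \<in> U} | x y U.
        square_summable x \<and> square_summable y \<and> open U}"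
    then obtain x y V where *: "U = {A \<in> BH. sigma_weak_functional x y A \<in> V}"
      "square_summable x" "square_summable y" "open V" by blast
    have "openin ?X {A \<in> topspace ?X. sigma_weak_functional x y (\<phi> A) \<in> V}"
      using openin_continuous_map_preimage[OF c[OF *(2,3)]] *(4) by simp
    also have "{A \<in> topspace ?X. sigma_weak_functional x y (\<phi> A) \<in> V} = \<phi> -` U \<inter> topspace ?X"
      using im S unfolding tX *(1) by auto
    finally show "openin ?X (\<phi> -` U \<inter> topspace ?X)" .
  qed
  then show ?thesis unfolding normal_map_def using im tX
    by (simp add: continuous_map_in_subtopology image_subset_iff Pi_iff)
qed

lemma normal_map_continuous:
  assumes "normal_map S \<phi>"
  shows "continuous_map (subtopology sigma_weak S) sigma_weak \<phi>"
  using assms unfolding normal_map_def by (simp add: continuous_map_in_subtopology)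

text \<open>Every sigma-weak neighbourhood contains a sigma-strong one given by a single sequence of
  vectors. Density and convergence are thereby reduced to norm estimates.\<close>

lemma sigma_strong_neighbourhood:
  fixes A :: "'h::complex_hilbert \<Rightarrow>\<^sub>L 'h"
  assumes "openin sigma_weak U" "A \<in> U"
  shows "\<exists>x e. square_summable x \<and> e > 0 \<and>
    (\<forall>B\<in>BH. (\<Sum>n. (norm (blinfun_apply (B - A) (x n)))\<^sup>2) < e \<longrightarrow> B \<in> U)"
proof -
  have "generate_topology_on {{A \<in> BH. sigma_weak_functional x y A \<in> U} | x y U.
        square_summable x \<and> square_summable y \<and> open U} U"
    using assms(1) unfolding sigma_weak_def by (rule openin_topology_generated_by)
  then show ?thesis using assms(2)
  proof (induction U)
    case Empty
    then show ?case by simp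
  next
    case (UN K)
    then obtain k where k: "k \<in> K" "A \<in> k" by blast
    then show ?case using UN.IH[OF k] by (meson UnionI)
  next
    case (Int a b)
    obtain x d where x: "square_summable x" "d > 0"
      "\<And>B. B\<in>BH \<Longrightarrow> (\<Sum>n. (norm (blinfun_apply (B - A) (x n)))\<^sup>2) < d \<Longrightarrow> B \<in> a" using Int by blast
    obtain y e where y: "square_summable y" "e > 0"
      "\<And>B. B\<in>BH \<Longrightarrow> (\<Sum>n. (norm (blinfun_apply (B - A) (y n)))\<^sup>2) < e \<Longrightarrow> B \<in> b" using Int by blast
    \<comment> \<open>Interleaving merges the sequences of two neighbourhoods, so that an
      intersection again needs only one.\<close>
    define z where "z n = (if even n then x (n div 2) else y ((n - 1) div 2))" for n
    have sq: "(\<lambda>n. (norm (blinfun_apply T (z n)))\<^sup>2) =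
      (\<lambda>n. if even n then (norm (T (x (n div 2))))\<^sup>2 else (norm (T (y ((n - 1) div 2))))\<^sup>2)" for T :: "'h \<Rightarrow>\<^sub>L 'h"
      by (auto simp: z_def)
    have s: "summable (\<lambda>n. (norm (T (x n)))\<^sup>2)" "summable (\<lambda>n. (norm (T (y n)))\<^sup>2)" for T :: "'h \<Rightarrow>\<^sub>L 'h"
      using square_summable_blinfun[OF x(1)] square_summable_blinfun[OF y(1)] by (auto simp: square_summable_def)
    have z: "(\<lambda>n. (norm (blinfun_apply T (z n)))\<^sup>2) sums
      ((\<Sum>n. (norm (T (y n)))\<^sup>2) + (\<Sum>n. (norm (T (x n)))\<^sup>2))" for T :: "'h \<Rightarrow>\<^sub>L 'h"
      unfolding sq by (intro sums_if summable_sums s)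
    have "square_summable z"
      using sums_summable[OF z[of id_blinfun]] by (simp add: square_summable_def)
    moreover have "B \<in> a \<inter> b" if B: "B \<in> BH" "(\<Sum>n. (norm (blinfun_apply (B - A) (z n)))\<^sup>2) < min d e" for B
    proof -
      have "(\<Sum>n. (norm (blinfun_apply (B - A) (z n)))\<^sup>2) =
        (\<Sum>n. (norm (blinfun_apply (B - A) (y n)))\<^sup>2) + (\<Sum>n. (norm (blinfun_apply (B - A) (x n)))\<^sup>2)"
        using z[of "B - A"] by (simp add: sums_iff)
      moreover have "0 \<le> (\<Sum>n. (norm (blinfun_apply (B - A) (y n)))\<^sup>2)" "0 \<le> (\<Sum>n. (norm (blinfun_apply (B - A) (x n)))\<^sup>2)"
        by (intro suminf_nonneg s; simp)+
      ultimately show ?thesis using x(3)[OF B(1)] y(3)[OF B(1)] B(2) by simp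
    qed
    ultimately show ?case using x(2) y(2) by (intro exI[of _ z] exI[of _ "min d e"]) simp
  next
    case (Basis s)
    then obtain x y V where *: "s = {A \<in> BH. sigma_weak_functional x y A \<in> V}"
      "square_summable x" "square_summable y" "open V" by blast
    then have "sigma_weak_functional x y A \<in> V" using Basis by simp
    then obtain d where d: "d > 0" "\<And>w. dist w (sigma_weak_functional x y A) < d \<Longrightarrow> w \<in> V"
      using *(4) unfolding open_dist by blast
    define Y where "Y = (\<Sum>n. (norm (y n))\<^sup>2)"
    have Y: "Y \<ge> 0" unfolding Y_def using *(3) by (intro suminf_nonneg) (auto simp: square_summable_def)
    \<comment> \<open>Makes the part \<open>Y / t\<close> at most d/2 and leaves the other half of d
      to t times the sum over x. The summand 1 keeps t positive when Y = 0.\<close>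
    define t where "t = 2 * (Y + 1) / d"
    have t: "t > 0" using d Y by (simp add: t_def)
    have "B \<in> s" if B: "B \<in> BH" "(\<Sum>n. (norm (blinfun_apply (B - A) (x n)))\<^sup>2) < d / (2 * t)" for B
    proof -
      let ?f = "\<lambda>n. (norm (blinfun_apply (B - A) (x n)))\<^sup>2"
      have sf: "summable ?f" using square_summable_blinfun[OF *(2)] by (simp add: square_summable_def)
      have sy: "summable (\<lambda>n. (norm (y n))\<^sup>2)" using *(3) by (simp add: square_summable_def)
      have "sigma_weak_functional x y B - sigma_weak_functional x y A = sigma_weak_functional x y (B - A)"
        by (simp add: swf_diff[OF *(2,3)])
      also have "norm \<dots> \<le> (\<Sum>n. norm (cinner (blinfun_apply (B - A) (x n)) (y n)))"
        unfolding sigma_weak_functional_def by (rule summable_norm[OF swf_summable_norm[OF *(2,3)]])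
      also have "\<dots> \<le> (\<Sum>n. t * ?f n + (norm (y n))\<^sup>2 / t)"
        using order_trans[OF norm_cinner_le norm_mult_le_squares[OF t]]
        by (intro suminf_le swf_summable_norm[OF *(2,3)] summable_add summable_mult summable_divide sf sy)
      also have "\<dots> = t * (\<Sum>n. ?f n) + Y / t"
        unfolding Y_def by (simp add: suminf_add[OF summable_mult[OF sf] summable_divide[OF sy], symmetric]
            suminf_mult[OF sf] suminf_divide[OF sy])
      also have "\<dots> < t * (d / (2 * t)) + d / 2"
      proof (rule add_less_le_mono)
        show "t * (\<Sum>n. ?f n) < t * (d / (2 * t))" by (rule mult_strict_left_mono[OF B(2) t])
        show "Y / t \<le> d / 2" using d Y by (simp add: t_def field_simps)
      qed
      also have "\<dots> = d" using t by simp
      finally show ?thesis unfolding *(1) using B(1) d(2) by (simp add: dist_norm)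
    qed
    then show ?case using *(2) d t by (intro exI[of _ x] exI[of _ "d / (2 * t)"]) simp
  qed
qed

text \<open>Dominated convergence for series: the uniform norm bound supplies a summable majorant,
  and each term tends to 0.\<close>

lemma limitin_sigma_weak:
  fixes T :: "nat \<Rightarrow> ('h::complex_hilbert \<Rightarrow>\<^sub>L 'h)"
  assumes BH: "\<And>k. T k \<in> BH" "S \<in> BH" and bd: "\<And>k. norm (T k) \<le> C"
    and lim: "\<And>x. (\<lambda>k. T k x) \<longlonglongrightarrow> S x"
  shows "limitin sigma_weak T S sequentially"
  unfolding limitin_def topspace_sigma_weak
proof (intro conjI allI impI BH)
  fix U :: "('h \<Rightarrow>\<^sub>L 'h) set" assume U: "openin sigma_weak U \<and> S \<in> U"
  obtain x e where x: "square_summable x" and e: "e > 0"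
    and nb: "\<And>B. B\<in>BH \<Longrightarrow> (\<Sum>n. (norm (blinfun_apply (B - S) (x n)))\<^sup>2) < e \<Longrightarrow> B \<in> U"
    using sigma_strong_neighbourhood[OF conjunct1[OF U] conjunct2[OF U]] by (elim exE conjE) simp
  have "(\<lambda>k. \<Sum>n. (norm ((T k - S) (x n)))\<^sup>2) \<longlonglongrightarrow> (\<Sum>n. 0)"
  proof (rule conjunct2[OF conjunct2[OF tannerys_theorem]])
    show "summable (\<lambda>n. (C + norm S)\<^sup>2 * (norm (x n))\<^sup>2)"
      using x by (simp add: square_summable_def summable_mult)
    have "(\<lambda>k. (T k - S) (x n)) \<longlonglongrightarrow> S (x n) - S (x n)" for n
      unfolding blinfun.diff_left by (rule tendsto_diff[OF lim tendsto_const])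
    then show "(\<lambda>k. (norm ((T k - S) (x n)))\<^sup>2) \<longlonglongrightarrow> 0" for n
      using tendsto_power[OF tendsto_norm, of _ "0 :: 'h" sequentially 2] by simp
    have "norm ((norm ((T k - S) (x n)))\<^sup>2) \<le> (C + norm S)\<^sup>2 * (norm (x n))\<^sup>2" for k n
    proof -
      have "norm ((T k - S) (x n)) \<le> norm (T k - S) * norm (x n)" by (rule norm_blinfun)
      also have "\<dots> \<le> (C + norm S) * norm (x n)"
        using norm_triangle_ineq4[of "T k" S] bd[of k] by (intro mult_right_mono) auto
      finally show ?thesis by (simp add: power_mult_distrib[symmetric] power_mono)
    qed
    then show "\<forall>\<^sub>F (n, k) in sequentially \<times>\<^sub>F sequentially.
      norm ((norm ((T k - S) (x n)))\<^sup>2) \<le> (C + norm S)\<^sup>2 * (norm (x n))\<^sup>2"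
      by (intro always_eventually) auto
  qed simp
  then have "\<forall>\<^sub>F k in sequentially. (\<Sum>n. (norm ((T k - S) (x n)))\<^sup>2) < e"
    using e by (intro order_tendstoD(2)) auto
  then show "\<forall>\<^sub>F k in sequentially. T k \<in> U" by eventually_elim (rule nb[OF BH(1)])
qed

lemma continuous_map_sigma_weak_tendsto:
  assumes f: "continuous_map sigma_weak euclidean f"
    and "\<And>k. T k \<in> BH" "S \<in> BH" "\<And>k. norm (T k) \<le> C" "\<And>x. (\<lambda>k. T k x) \<longlonglongrightarrow> blinfun_apply S x"
  shows "(\<lambda>k. f (T k)) \<longlonglongrightarrow> f S"
  using continuous_map_limit[OF f limitin_sigma_weak[OF assms(2-)]] by (simp add: o_def)

section \<open>Square-summable sequences of vectors\<close>

lemma square_summable_add: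
  assumes "square_summable x" "square_summable y"
  shows "square_summable (\<lambda>n. x n + y n)"
  unfolding square_summable_def
proof (rule summable_comparison_test')
  show "summable (\<lambda>n. 2 * (norm (x n))\<^sup>2 + 2 * (norm (y n))\<^sup>2)"
    using assms by (simp add: square_summable_def summable_add summable_mult)
  show "norm ((norm (x n + y n))\<^sup>2) \<le> 2 * (norm (x n))\<^sup>2 + 2 * (norm (y n))\<^sup>2" if "n \<ge> 0" for n
  proof -
    have "(norm (x n + y n))\<^sup>2 + (norm (x n - y n))\<^sup>2 = 2 * (norm (x n))\<^sup>2 + 2 * (norm (y n))\<^sup>2"
      by (simp add: power2_norm_eq_inner inner_add inner_diff)
    moreover have "0 \<le> (norm (x n - y n))\<^sup>2" by simp
    ultimately show ?thesis unfolding real_norm_def abs_power2 by linarith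
  qed
qed

lemma square_summable_scaleR: "square_summable x \<Longrightarrow> square_summable (\<lambda>n. r *\<^sub>R x n)"
  by (simp add: square_summable_def power_mult_distrib summable_mult)

lemma square_summable_scaleC: "square_summable x \<Longrightarrow> square_summable (\<lambda>n. scaleC c (x n))"
  by (simp add: square_summable_def norm_scaleC power_mult_distrib summable_mult)

lemma square_summable_zero: "square_summable (\<lambda>n. 0)"
  by (simp add: square_summable_def)

lemma summable_inner_square_summable:
  assumes "square_summable x" "square_summable y"
  shows "summable (\<lambda>n. inner (x n) (y n))"
  unfolding inner_eq_Re_cinner by (rule summable_Re[OF summable_norm_cancel[OF square_summable_cinner[OF assms]]])

text \<open>The Hilbert sum of countably many copies of H. As an instance of
  \<open>complex_hilbert\<close> it admits \<open>proj_on\<close>, and approximation along a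
  sequence of vectors becomes approximation of one vector.\<close>

typedef (overloaded) 'h ell2 = "{x :: nat \<Rightarrow> 'h::complex_hilbert. square_summable x}"
  morphisms coord Abs_ell2
  using square_summable_zero by blast

setup_lifting type_definition_ell2

lemma square_summable_coord: "square_summable (coord x)"
  using coord by simp

instantiation ell2 :: (complex_hilbert) complex_inner
begin

lift_definition zero_ell2 :: "'a ell2" is "\<lambda>n. 0" by (rule square_summable_zero)
lift_definition plus_ell2 :: "'a ell2 \<Rightarrow> 'a ell2 \<Rightarrow> 'a ell2" is "\<lambda>x y n. x n + y n" by (rule square_summable_add)
lift_definition uminus_ell2 :: "'a ell2 \<Rightarrow> 'a ell2" is "\<lambda>x n. - x n" by (simp add: square_summable_def)
lift_definition minus_ell2 :: "'a ell2 \<Rightarrow> 'a ell2 \<Rightarrow> 'a ell2" is "\<lambda>x y n. x n - y n"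
proof -
  fix x y :: "nat \<Rightarrow> 'a" assume "square_summable x" "square_summable y"
  then show "square_summable (\<lambda>n. x n - y n)"
    using square_summable_add[of x "\<lambda>n. - y n"] by (simp add: square_summable_def)
qed
lift_definition scaleR_ell2 :: "real \<Rightarrow> 'a ell2 \<Rightarrow> 'a ell2" is "\<lambda>r x n. r *\<^sub>R x n" by (rule square_summable_scaleR)
lift_definition scaleC_ell2 :: "complex \<Rightarrow> 'a ell2 \<Rightarrow> 'a ell2" is "\<lambda>r x n. scaleC r (x n)" by (rule square_summable_scaleC)
definition cinner_ell2 :: "'a ell2 \<Rightarrow> 'a ell2 \<Rightarrow> complex" where
  "cinner_ell2 x y = (\<Sum>n. cinner (coord x n) (coord y n))"
definition inner_ell2 :: "'a ell2 \<Rightarrow> 'a ell2 \<Rightarrow> real" where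
  "inner_ell2 x y = (\<Sum>n. inner (coord x n) (coord y n))"
definition norm_ell2 :: "'a ell2 \<Rightarrow> real" where "norm_ell2 x = sqrt (inner x x)"
definition dist_ell2 :: "'a ell2 \<Rightarrow> 'a ell2 \<Rightarrow> real" where "dist_ell2 x y = norm (x - y)"
definition sgn_ell2 :: "'a ell2 \<Rightarrow> 'a ell2" where "sgn_ell2 x = scaleR (inverse (norm x)) x"
definition uniformity_ell2 :: "('a ell2 \<times> 'a ell2) filter" where
  "uniformity_ell2 = (INF e\<in>{0<..}. principal {(x, y). dist x y < e})"
definition open_ell2 :: "'a ell2 set \<Rightarrow> bool" where
  "open_ell2 U = (\<forall>x\<in>U. eventually (\<lambda>(x', y). x' = x \<longrightarrow> y \<in> U) uniformity)"

lemma summable_cinner_coord: "summable (\<lambda>n. cinner (coord x n) (coord (y::'a ell2) n))"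
  by (rule summable_norm_cancel[OF square_summable_cinner[OF square_summable_coord square_summable_coord]])

lemma summable_inner_coord: "summable (\<lambda>n. inner (coord x n) (coord (y::'a ell2) n))"
  by (rule summable_inner_square_summable[OF square_summable_coord square_summable_coord])

instance
proof
  fix x y z :: "'a ell2" and c d :: complex and r s :: real
  show "dist x y = norm (x - y)" by (rule dist_ell2_def)
  show "sgn x = scaleR (inverse (norm x)) x" by (rule sgn_ell2_def)
  show "(uniformity :: ('a ell2 \<times> 'a ell2) filter) = (INF e\<in>{0<..}. principal {(x, y). dist x y < e})"
    by (rule uniformity_ell2_def)
  show "open U = (\<forall>x\<in>U. eventually (\<lambda>(x', y). x' = x \<longrightarrow> y \<in> U) uniformity)" for U :: "'a ell2 set"
    by (rule open_ell2_def)
  show "norm x = sqrt (inner x x)" by (rule norm_ell2_def)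
  show "x + y + z = x + (y + z)" "x + y = y + x" "0 + x = x" "- x + x = 0" "x - y = x + - y"
    "r *\<^sub>R (x + y) = r *\<^sub>R x + r *\<^sub>R y" "(r + s) *\<^sub>R x = r *\<^sub>R x + s *\<^sub>R x" "r *\<^sub>R s *\<^sub>R x = (r * s) *\<^sub>R x" "1 *\<^sub>R x = x"
    by (transfer; simp add: algebra_simps fun_eq_iff)+
  show "scaleC c (x + y) = scaleC c x + scaleC c y" "scaleC (c + d) x = scaleC c x + scaleC d x"
    "scaleC c (scaleC d x) = scaleC (c * d) x" "scaleC (complex_of_real r) x = r *\<^sub>R x"
    by (transfer; simp add: scaleC_add_left scaleC_add_right scaleC_scaleC scaleC_of_real)+
  show "inner x y = inner y x" by (simp add: inner_ell2_def inner_commute)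
  show "inner (x + y) z = inner x z + inner y z"
    unfolding inner_ell2_def suminf_add[OF summable_inner_coord summable_inner_coord]
    by (simp add: plus_ell2.rep_eq inner_add_left)
  show "inner (r *\<^sub>R x) y = r * inner x y"
    unfolding inner_ell2_def suminf_mult[OF summable_inner_coord, symmetric]
    by (simp add: scaleR_ell2.rep_eq)
  show "0 \<le> inner x x" unfolding inner_ell2_def by (rule suminf_nonneg[OF summable_inner_coord]) simp
  have "inner x x = 0 \<longleftrightarrow> (\<forall>n. coord x n = 0)"
    unfolding inner_ell2_def by (subst suminf_eq_zero_iff[OF summable_inner_coord]) simp_all
  then show "inner x x = 0 \<longleftrightarrow> x = 0" by (simp add: coord_inject[symmetric] zero_ell2.rep_eq fun_eq_iff)
  show "inner x y = Re (cinner x y)"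
    unfolding inner_ell2_def cinner_ell2_def inner_eq_Re_cinner by (rule Re_suminf[OF summable_cinner_coord, symmetric])
  show "cinner (x + y) z = cinner x z + cinner y z"
    unfolding cinner_ell2_def suminf_add[OF summable_cinner_coord summable_cinner_coord]
    by (simp add: plus_ell2.rep_eq cinner_add_left)
  show "cinner (scaleC c x) y = c * cinner x y"
    unfolding cinner_ell2_def suminf_mult[OF summable_cinner_coord, symmetric]
    by (simp add: scaleC_ell2.rep_eq cinner_scaleC_left)
  have "(\<lambda>n. cnj (cinner (coord y n) (coord x n))) sums cnj (\<Sum>n. cinner (coord y n) (coord x n))"
    by (rule sums_cnj[THEN iffD2]) (rule summable_sums[OF summable_cinner_coord])
  then show "cinner x y = cnj (cinner y x)"
    unfolding cinner_ell2_def using cinner_commute[of "coord x _" "coord y _"] by (simp add: sums_iff)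
qed

end

lemma norm_ell2_sums: "(\<lambda>n. (norm (coord x n))\<^sup>2) sums (norm (x :: 'h::complex_hilbert ell2))\<^sup>2"
proof -
  have "(norm x)\<^sup>2 = (\<Sum>n. (norm (coord x n))\<^sup>2)"
    unfolding power2_norm_eq_inner inner_ell2_def ..
  then show ?thesis using square_summable_coord[of x] by (simp add: square_summable_def sums_iff)
qed

lemma norm_coord_le: "norm (coord x n) \<le> norm (x :: 'h::complex_hilbert ell2)"
proof -
  have "(\<Sum>k\<in>{n}. (norm (coord x k))\<^sup>2) \<le> (\<Sum>k. (norm (coord x k))\<^sup>2)"
    by (rule sum_le_suminf[OF sums_summable[OF norm_ell2_sums]]) auto
  then have "(norm (coord x n))\<^sup>2 \<le> (norm x)\<^sup>2" using norm_ell2_sums[of x] by (simp add: sums_iff)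
  then show ?thesis by (rule power2_le_imp_le) simp
qed

instance ell2 :: (complex_hilbert) complex_hilbert
proof
  fix X :: "nat \<Rightarrow> 'a ell2" assume X: "Cauchy X"
  have "Cauchy (\<lambda>m. coord (X m) k)" for k
  proof (rule CauchyI)
    fix e :: real assume "0 < e"
    from CauchyD[OF X this] obtain N where N: "\<forall>m\<ge>N. \<forall>n\<ge>N. norm (X m - X n) < e" by blast
    have "norm (coord (X m) k - coord (X n) k) < e" if "m \<ge> N" "n \<ge> N" for m n
      using norm_coord_le[of "X m - X n" k] N that by (force simp: minus_ell2.rep_eq)
    then show "\<exists>M. \<forall>m\<ge>M. \<forall>n\<ge>M. norm (coord (X m) k - coord (X n) k) < e" by blast
  qed
  then have "\<forall>k. \<exists>l. (\<lambda>m. coord (X m) k) \<longlonglongrightarrow> l" using Cauchy_convergent unfolding convergent_def by blast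
  from choice[OF this] obtain l where l: "\<And>k. (\<lambda>m. coord (X m) k) \<longlonglongrightarrow> l k" by blast
  \<comment> \<open>In a finite sum the limit in the second index can be taken coordinatewise; the
    bound is independent of K and so passes to the series.\<close>
  have part: "\<exists>N. \<forall>m\<ge>N. \<forall>K. (\<Sum>k<K. (norm (coord (X m) k - l k))\<^sup>2) \<le> e\<^sup>2" if e: "e > 0" for e :: real
  proof -
    from CauchyD[OF X e] obtain N where N: "\<forall>m\<ge>N. \<forall>n\<ge>N. norm (X m - X n) < e" by blast
    have "(\<Sum>k<K. (norm (coord (X m) k - l k))\<^sup>2) \<le> e\<^sup>2" if m: "m \<ge> N" for m K
    proof (rule LIMSEQ_le_const2)
      show "(\<lambda>n. \<Sum>k<K. (norm (coord (X m) k - coord (X n) k))\<^sup>2) \<longlonglongrightarrow> (\<Sum>k<K. (norm (coord (X m) k - l k))\<^sup>2)"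
        by (intro tendsto_sum tendsto_power tendsto_norm tendsto_diff tendsto_const l)
      show "\<exists>N. \<forall>n\<ge>N. (\<Sum>k<K. (norm (coord (X m) k - coord (X n) k))\<^sup>2) \<le> e\<^sup>2"
      proof (intro exI allI impI)
        fix n assume n: "n \<ge> N"
        have "(\<Sum>k<K. (norm (coord (X m) k - coord (X n) k))\<^sup>2) = (\<Sum>k<K. (norm (coord (X m - X n) k))\<^sup>2)"
          by (simp add: minus_ell2.rep_eq)
        also have "\<dots> \<le> (\<Sum>k. (norm (coord (X m - X n) k))\<^sup>2)"
          by (rule sum_le_suminf[OF sums_summable[OF norm_ell2_sums]]) auto
        also have "\<dots> = (norm (X m - X n))\<^sup>2" using norm_ell2_sums[of "X m - X n"] by (simp add: sums_iff)
        also have "\<dots> \<le> e\<^sup>2" using N m n by (intro power_mono) (auto intro: less_imp_le)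
        finally show "(\<Sum>k<K. (norm (coord (X m) k - coord (X n) k))\<^sup>2) \<le> e\<^sup>2" .
      qed
    qed
    then show ?thesis by blast
  qed
  have sq: "square_summable (\<lambda>k. coord (X m) k - l k) \<and> (\<Sum>k. (norm (coord (X m) k - l k))\<^sup>2) \<le> C"
    if "\<And>K. (\<Sum>k<K. (norm (coord (X m) k - l k))\<^sup>2) \<le> C" for m C
    using that unfolding square_summable_def
    by (auto intro!: summableI_nonneg_bounded suminf_le_const)
  obtain N1 where "\<forall>m\<ge>N1. \<forall>K. (\<Sum>k<K. (norm (coord (X m) k - l k))\<^sup>2) \<le> 1\<^sup>2" using part[of 1] by auto
  then have s1: "square_summable (\<lambda>k. coord (X N1) k - l k)" using sq[of N1 "1\<^sup>2"] by simp
  have "square_summable (\<lambda>k. coord (X N1) k + (-1) *\<^sub>R (coord (X N1) k - l k))"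
    by (intro square_summable_add square_summable_coord square_summable_scaleR s1)
  then have "square_summable l" by simp
  then have cl: "coord (Abs_ell2 l) = l" by (simp add: Abs_ell2_inverse)
  have "X \<longlonglongrightarrow> Abs_ell2 l"
  proof (rule LIMSEQ_I)
    fix r :: real assume r: "0 < r"
    then obtain N where N: "\<forall>m\<ge>N. \<forall>K. (\<Sum>k<K. (norm (coord (X m) k - l k))\<^sup>2) \<le> (r/2)\<^sup>2" using part[of "r/2"] by auto
    have "norm (X m - Abs_ell2 l) < r" if "m \<ge> N" for m
    proof -
      have "(norm (X m - Abs_ell2 l))\<^sup>2 = (\<Sum>k. (norm (coord (X m) k - l k))\<^sup>2)"
        using norm_ell2_sums[of "X m - Abs_ell2 l"] by (simp add: sums_iff minus_ell2.rep_eq cl)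
      also have "\<dots> \<le> (r/2)\<^sup>2" using sq[of m "(r/2)\<^sup>2"] N that by blast
      finally have "norm (X m - Abs_ell2 l) \<le> r / 2" by (rule power2_le_imp_le) (use r in simp)
      then show ?thesis using r by simp
    qed
    then show "\<exists>no. \<forall>n\<ge>no. norm (X n - Abs_ell2 l) < r" by blast
  qed
  then show "convergent X" unfolding convergent_def by blast
qed

lift_definition single :: "nat \<Rightarrow> 'h::complex_hilbert \<Rightarrow> 'h ell2" is "\<lambda>j v n. if n = j then v else 0"
proof -
  fix j and v :: 'h
  show "square_summable (\<lambda>n. if n = j then v else 0)"
    unfolding square_summable_def by (rule summable_finite[of "{j}"]) auto
qed

lemma norm_single: "norm (single j v) = norm v"
proof -
  have "(\<lambda>n. (norm (coord (single j v) n))\<^sup>2) = (\<lambda>n. if n = j then (norm v)\<^sup>2 else 0)"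
    by (auto simp: single.rep_eq)
  then have "(\<lambda>n. (norm (coord (single j v) n))\<^sup>2) sums (norm v)\<^sup>2"
    using sums_single[of j "\<lambda>n. (norm v)\<^sup>2"] by simp
  from sums_unique2[OF this norm_ell2_sums] show ?thesis by simp
qed

lemma single_bounded_linear: "bounded_linear (single j)"
proof (rule bounded_linear_intro[where K = 1])
  show "single j (x + y) = single j x + single j y" for x y by transfer (simp add: fun_eq_iff)
  show "single j (r *\<^sub>R x) = r *\<^sub>R single j x" for r x by transfer (simp add: fun_eq_iff)
qed (simp add: norm_single)

lemma single_scaleC: "single j (scaleC c v) = scaleC c (single j v)"
  by transfer (simp add: fun_eq_iff)

lemma coord_bounded_linear: "bounded_linear (\<lambda>x. coord x j)"
  by (rule bounded_linear_intro[where K = 1])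
    (simp_all add: plus_ell2.rep_eq scaleR_ell2.rep_eq norm_coord_le)

lemma ell2_eqI: "(\<And>n. coord x n = coord y n) \<Longrightarrow> x = y"
  by (simp add: coord_inject[symmetric] fun_eq_iff)

text \<open>The amplification A tensor 1 on H tensor l2.\<close>

definition amp :: "('h::complex_hilbert \<Rightarrow>\<^sub>L 'h) \<Rightarrow> ('h ell2 \<Rightarrow>\<^sub>L 'h ell2)" where
  "amp A = Blinfun (\<lambda>x. Abs_ell2 (\<lambda>n. A (coord x n)))"

lemma coord_amp: "coord (amp A x) n = A (coord x n)"
proof -
  let ?f = "\<lambda>x. Abs_ell2 (\<lambda>n. A (coord x n))"
  have "square_summable (\<lambda>n. A (coord x n))" for x
    by (rule square_summable_blinfun[OF square_summable_coord])
  then have c: "coord (?f x) = (\<lambda>n. A (coord x n))" for x by (simp add: Abs_ell2_inverse)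
  have "bounded_linear ?f"
  proof (rule bounded_linear_intro[where K = "norm A"])
    show "?f (x + y) = ?f x + ?f y" for x y
      by (rule ell2_eqI, simp only: c, simp only: plus_ell2.rep_eq c blinfun.add_right)
    show "?f (r *\<^sub>R x) = r *\<^sub>R ?f x" for r x
      by (rule ell2_eqI, simp only: c, simp only: scaleR_ell2.rep_eq c blinfun.scaleR_right)
    show "norm (?f x) \<le> norm x * norm A" for x
    proof (rule power2_le_imp_le)
      have "(norm (?f x))\<^sup>2 = (\<Sum>n. (norm (A (coord x n)))\<^sup>2)"
        using norm_ell2_sums[of "?f x"] by (simp add: sums_iff c)
      also have "\<dots> \<le> (\<Sum>n. (norm A)\<^sup>2 * (norm (coord x n))\<^sup>2)"
      proof (rule suminf_le)
        show "(norm (A (coord x n)))\<^sup>2 \<le> (norm A)\<^sup>2 * (norm (coord x n))\<^sup>2" for n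
          using power_mono[OF norm_blinfun[of A "coord x n"] norm_ge_zero, of 2] by (simp add: power_mult_distrib)
        show "summable (\<lambda>n. (norm (A (coord x n)))\<^sup>2)"
          using square_summable_blinfun[OF square_summable_coord[of x]] by (simp add: square_summable_def)
        show "summable (\<lambda>n. (norm A)\<^sup>2 * (norm (coord x n))\<^sup>2)"
          using square_summable_coord[of x] by (simp add: square_summable_def summable_mult)
      qed
      also have "\<dots> = (norm x * norm A)\<^sup>2"
        using norm_ell2_sums[of x] by (simp add: sums_iff suminf_mult power_mult_distrib mult.commute)
      finally show "(norm (?f x))\<^sup>2 \<le> (norm x * norm A)\<^sup>2" .
    qed simp
  qed
  then show ?thesis by (simp add: amp_def bounded_linear_Blinfun_apply c)
qed

lemma amp_BH: "A \<in> BH \<Longrightarrow> amp A \<in> BH"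
  by (auto simp: BH_def intro!: ell2_eqI simp: coord_amp scaleC_ell2.rep_eq)

lemma adj_amp: "A \<in> BH \<Longrightarrow> adj (amp A) = amp (adj A)"
  by (rule adj_eqI) (simp add: cinner_ell2_def coord_amp adj_right)

lemma amp_single: "amp A (single j v) = single j (A v)"
  by (rule ell2_eqI) (simp add: coord_amp single.rep_eq)

lemma coord_sum: "coord (sum f I) n = (\<Sum>i\<in>I. coord (f i) n)"
  by (induction I rule: infinite_finite_induct) (simp_all add: zero_ell2.rep_eq plus_ell2.rep_eq)

lemma ell2_truncate: "(\<lambda>K. \<Sum>j<K. single j (coord x j)) \<longlonglongrightarrow> x"
proof -
  have "(\<lambda>K. (norm (x - (\<Sum>j<K. single j (coord x j))))\<^sup>2) \<longlonglongrightarrow> 0"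
  proof -
    have eq: "(norm (x - (\<Sum>j<K. single j (coord x j))))\<^sup>2 = (norm x)\<^sup>2 - (\<Sum>j<K. (norm (coord x j))\<^sup>2)" for K
    proof -
      have c: "coord (x - (\<Sum>j<K. single j (coord x j))) n = (if n < K then 0 else coord x n)" for n
        by (simp add: minus_ell2.rep_eq coord_sum single.rep_eq)
      have "(\<lambda>n. (norm (coord x n))\<^sup>2 - (if n \<in> {..<K} then (norm (coord x n))\<^sup>2 else 0)) sums
          ((norm x)\<^sup>2 - (\<Sum>j<K. (norm (coord x j))\<^sup>2))"
        by (intro sums_diff norm_ell2_sums sums_If_finite_set) simp
      also have "(\<lambda>n. (norm (coord x n))\<^sup>2 - (if n \<in> {..<K} then (norm (coord x n))\<^sup>2 else 0)) =
          (\<lambda>n. (norm (coord (x - (\<Sum>j<K. single j (coord x j))) n))\<^sup>2)"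
        unfolding c by (auto simp: fun_eq_iff)
      finally show ?thesis by (rule sums_unique2[OF norm_ell2_sums])
    qed
    have "(\<lambda>K. (norm x)\<^sup>2 - (\<Sum>j<K. (norm (coord x j))\<^sup>2)) \<longlonglongrightarrow> (norm x)\<^sup>2 - (norm x)\<^sup>2"
      using norm_ell2_sums[of x] unfolding sums_def by (intro tendsto_diff tendsto_const)
    then show ?thesis unfolding eq by simp
  qed
  then have "(\<lambda>K. norm (x - (\<Sum>j<K. single j (coord x j)))) \<longlonglongrightarrow> 0"
    using tendsto_real_sqrt[of "\<lambda>K. (norm (x - (\<Sum>j<K. single j (coord x j))))\<^sup>2" 0] by simp
  then have "(\<lambda>K. norm ((\<Sum>j<K. single j (coord x j)) - x)) \<longlonglongrightarrow> 0" by (simp add: norm_minus_commute)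
  then show ?thesis by (simp only: LIM_zero_iff tendsto_norm_zero_iff)
qed

section \<open>Density of the algebra generated by a factor and its commutant\<close>

definition alg_generated :: "('h::complex_hilbert \<Rightarrow>\<^sub>L 'h) set \<Rightarrow> ('h \<Rightarrow>\<^sub>L 'h) set" where
  "alg_generated M = {(\<Sum>i<n. A i o\<^sub>L B i) | (n::nat) A B. \<forall>i<n. A i \<in> commutant M \<and> B i \<in> M}"

lemma alg_generatedI: "(\<And>i. i < (n::nat) \<Longrightarrow> A i \<in> commutant M \<and> B i \<in> M) \<Longrightarrow> (\<Sum>i<n. A i o\<^sub>L B i) \<in> alg_generated M"
  unfolding alg_generated_def by (intro CollectI exI[of _ n] exI[of _ A] exI[of _ B]) simp

lemma alg_generated_add:
  assumes "S \<in> alg_generated M" "T \<in> alg_generated M"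
  shows "S + T \<in> alg_generated M"
proof -
  obtain n :: nat and A B where S: "S = (\<Sum>i<n. A i o\<^sub>L B i)" "\<forall>i<n. A i \<in> commutant M \<and> B i \<in> M"
    using assms(1) unfolding alg_generated_def by blast
  obtain m :: nat and C D where T: "T = (\<Sum>i<m. C i o\<^sub>L D i)" "\<forall>i<m. C i \<in> commutant M \<and> D i \<in> M"
    using assms(2) unfolding alg_generated_def by blast
  let ?A = "\<lambda>i. if i < n then A i else C (i - n)" and ?B = "\<lambda>i. if i < n then B i else D (i - n)"
  have split: "(\<Sum>i<n + m. f i) = (\<Sum>i<n. f i) + (\<Sum>i<m. f (i + n))" for f :: "nat \<Rightarrow> 'a \<Rightarrow>\<^sub>L 'a"
    by (induction m) (simp_all add: add.commute add.left_commute)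
  have "(\<Sum>i<n + m. ?A i o\<^sub>L ?B i) = S + T"
    unfolding split S(1) T(1) by (intro arg_cong2[of _ _ _ _ "(+)"] sum.cong refl) simp_all
  moreover have "(\<Sum>i<n + m. ?A i o\<^sub>L ?B i) \<in> alg_generated M"
    by (rule alg_generatedI) (use S(2) T(2) in auto)
  ultimately show ?thesis by simp
qed

context vN
begin

lemma alg_generated_left_commutant:
  assumes "C \<in> commutant M" "T \<in> alg_generated M"
  shows "C o\<^sub>L T \<in> alg_generated M"
proof -
  interpret N: vN "commutant M" by (rule vN_commutant)
  obtain n :: nat and A B where T: "T = (\<Sum>i<n. A i o\<^sub>L B i)" "\<forall>i<n. A i \<in> commutant M \<and> B i \<in> M"
    using assms(2) unfolding alg_generated_def by blast
  have "C o\<^sub>L T = (\<Sum>i<n. (C o\<^sub>L A i) o\<^sub>L B i)"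
    by (rule blinfun_eqI) (simp add: T blinfun.sum_left blinfun.sum_right)
  also have "\<dots> \<in> alg_generated M" using T(2) N.comp[OF assms(1)] by (intro alg_generatedI) auto
  finally show ?thesis .
qed

lemma alg_generated_left:
  assumes "C \<in> M" "T \<in> alg_generated M"
  shows "C o\<^sub>L T \<in> alg_generated M"
proof -
  obtain n :: nat and A B where T: "T = (\<Sum>i<n. A i o\<^sub>L B i)" "\<forall>i<n. A i \<in> commutant M \<and> B i \<in> M"
    using assms(2) unfolding alg_generated_def by blast
  have "C (A i x) = A i (C x)" if "i < n" for i x using commutes[OF assms(1)] T(2) that by blast
  then have "C o\<^sub>L T = (\<Sum>i<n. A i o\<^sub>L (C o\<^sub>L B i))"
    by (intro blinfun_eqI) (simp add: T blinfun.sum_left blinfun.sum_right)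
  also have "\<dots> \<in> alg_generated M" using T(2) comp[OF assms(1)] by (intro alg_generatedI) auto
  finally show ?thesis .
qed

lemma alg_generated_id: "id_blinfun \<in> alg_generated M"
proof -
  interpret N: vN "commutant M" by (rule vN_commutant)
  have "(\<Sum>i<Suc 0. id_blinfun o\<^sub>L id_blinfun) \<in> alg_generated M"
    by (rule alg_generatedI) (simp add: id N.id)
  moreover have "(\<Sum>i<Suc 0. id_blinfun o\<^sub>L id_blinfun :: 'h \<Rightarrow>\<^sub>L 'h) = id_blinfun" by (intro blinfun_eqI) simp
  ultimately show ?thesis by simp
qed

lemma alg_generated_scalar: "T \<in> alg_generated M \<Longrightarrow> scalar_op c o\<^sub>L T \<in> alg_generated M"
  by (rule alg_generated_left[OF scalar])

lemma alg_generated_subset_BH: "T \<in> alg_generated M \<Longrightarrow> T \<in> BH"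
  unfolding alg_generated_def using BH commutant_subset_BH by (auto intro!: BH_sum BH_compose)

end

text \<open>
  The projection onto the closure of the orbit of \<open>x\<close> under the amplified algebra has scalar matrix
  entries, as they commute with \<open>M\<close> and its commutant. Hence it commutes with every amplified operator.
\<close>

lemma (in vN_factor) alg_generated_dense:
  assumes T: "T \<in> BH" and x: "square_summable x" and e: "e > 0"
  shows "\<exists>S\<in>alg_generated M. (\<Sum>n. (norm (blinfun_apply (S - T) (x n)))\<^sup>2) < e"
proof -
  interpret N: vN "commutant M" by (rule vN_commutant)
  define X where "X = Abs_ell2 x"
  have X: "coord X = x" using x by (simp add: X_def Abs_ell2_inverse)
  define L0 where "L0 = (\<lambda>S. blinfun_apply (amp S) X) ` alg_generated M"
  have mem: "amp S X \<in> L0" if "S \<in> alg_generated M" for S using that by (simp add: L0_def)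
  have L0: "csubspace L0"
    unfolding csubspace_def
  proof (intro conjI ballI allI)
    have "amp (scalar_op 0 o\<^sub>L id_blinfun) X = 0"
      by (rule ell2_eqI) (simp add: coord_amp scalar_op_apply zero_ell2.rep_eq)
    then show "0 \<in> L0" using mem[OF alg_generated_scalar[OF alg_generated_id, of 0]] by simp
    fix u c assume "u \<in> L0"
    then obtain S where S: "S \<in> alg_generated M" "u = amp S X" by (auto simp: L0_def)
    have "amp (scalar_op c o\<^sub>L S) X = scaleC c u" unfolding S(2)
      by (rule ell2_eqI) (simp add: coord_amp scalar_op_apply scaleC_ell2.rep_eq)
    then show "scaleC c u \<in> L0" using mem[OF alg_generated_scalar[OF S(1)], of c] by simp
    fix v assume "v \<in> L0"
    then obtain R where R: "R \<in> alg_generated M" "v = amp R X" by (auto simp: L0_def)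
    have "amp (S + R) X = u + v" unfolding S(2) R(2)
      by (rule ell2_eqI) (simp add: coord_amp plus_ell2.rep_eq blinfun.add_left)
    then show "u + v \<in> L0" using mem[OF alg_generated_add[OF S(1) R(1)]] by simp
  qed
  define L where "L = closure L0"
  have L: "csubspace L" "closed L" unfolding L_def by (rule csubspace_closure[OF L0]) simp
  have inv: "amp C u \<in> L" if C: "C \<in> M \<or> C \<in> commutant M" and u: "u \<in> L" for C u
  proof -
    have "L0 \<subseteq> {u. amp C u \<in> L}"
    proof
      fix v assume "v \<in> L0"
      then obtain S where S: "S \<in> alg_generated M" "v = amp S X" by (auto simp: L0_def)
      have "C o\<^sub>L S \<in> alg_generated M" using C S(1) alg_generated_left alg_generated_left_commutant by blast
      moreover have "amp (C o\<^sub>L S) X = amp C v" unfolding S(2) by (rule ell2_eqI) (simp add: coord_amp)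
      ultimately have "amp C v \<in> L0" using mem by metis
      then show "v \<in> {u. amp C u \<in> L}" unfolding L_def using closure_subset by blast
    qed
    moreover have "closed {u. amp C u \<in> L}"
      using continuous_closed_preimage[of UNIV "blinfun_apply (amp C)" L] L(2)
      by (simp add: vimage_def linear_continuous_on blinfun.bounded_linear_right)
    ultimately have "L \<subseteq> {u. amp C u \<in> L}" unfolding L_def by (rule closure_minimal)
    then show ?thesis using u by blast
  qed
  define P where "P = proj_on L"
  have PB: "P \<in> BH" unfolding P_def by (rule proj_on_BH[OF L])
  have comm: "P (amp C u) = amp C (P u)" if C: "C \<in> M \<or> C \<in> commutant M" for C u
  proof -
    have CB: "C \<in> BH" "adj C \<in> M \<or> adj C \<in> commutant M" using C BH N.BH adj N.adj by blast+
    show ?thesis unfolding P_def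
    proof (rule proj_on_commute[OF L amp_BH[OF CB(1)] inv[OF C]])
      show "adj (amp C) v \<in> L" if "v \<in> L" for v
        unfolding adj_amp[OF CB(1)] by (rule inv[OF CB(2) that])
    qed
  qed
  define p where "p i j = Blinfun (\<lambda>v. coord (P (single j v)) i)" for i j
  have p: "p i j v = coord (P (single j v)) i" for i j v
  proof -
    have "bounded_linear (\<lambda>v. coord (P (single j v)) i)"
      by (rule bounded_linear_compose[OF coord_bounded_linear
            bounded_linear_compose[OF blinfun.bounded_linear_right single_bounded_linear]])
    then show ?thesis by (simp add: p_def bounded_linear_Blinfun_apply)
  qed
  have "p i j \<in> range scalar_op" for i j
  proof -
    have pB: "p i j \<in> BH" unfolding BH_def by (simp add: p single_scaleC BH_apply[OF PB] scaleC_ell2.rep_eq)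
    have pc: "p i j (C v) = C (p i j v)" if "C \<in> M \<or> C \<in> commutant M" for C v
      unfolding p amp_single[symmetric] comm[OF that] coord_amp ..
    have "p i j \<in> M" using pc by (intro memI[OF pB]) blast
    moreover have "p i j \<in> commutant M" using pc by (intro commutantI[OF pB]) blast
    ultimately show ?thesis using center unfolding center_def by blast
  qed
  then have pT: "p i j (T v) = T (p i j v)" for i j v
    using BH_apply[OF T] by (metis (no_types, lifting) imageE scalar_op_apply)
  have PT: "P (amp T u) = amp T (P u)" for u
  proof -
    \<comment> \<open>On vectors with one nonzero coordinate only the entries of P matter, and
      scalars commute with T; truncation and continuity give the rest.\<close>
    have s: "P (amp T (single j v)) = amp T (P (single j v))" for j v
      by (rule ell2_eqI) (simp add: amp_single coord_amp p[symmetric] pT)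
    have l1: "(\<lambda>K. P (amp T (\<Sum>j<K. single j (coord u j)))) \<longlonglongrightarrow> P (amp T u)"
      by (intro blinfun.tendsto tendsto_const ell2_truncate)
    have l2: "(\<lambda>K. amp T (P (\<Sum>j<K. single j (coord u j)))) \<longlonglongrightarrow> amp T (P u)"
      by (intro blinfun.tendsto tendsto_const ell2_truncate)
    have "P (amp T (\<Sum>j<K. single j (coord u j))) = amp T (P (\<Sum>j<K. single j (coord u j)))" for K
      by (simp add: blinfun.sum_right s)
    then show ?thesis using l1 l2 LIMSEQ_unique by simp
  qed
  \<comment> \<open>The algebra contains the identity, so X lies in L and
    \<open>amp T X = amp T (P X) = P (amp T X)\<close> lies in L as well.\<close>
  have "amp id_blinfun X = X" by (rule ell2_eqI) (simp add: coord_amp)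
  then have "X \<in> L" using mem[OF alg_generated_id] closure_subset unfolding L_def by fastforce
  then have "P (amp T X) = amp T X" using PT[of X] proj_on_id[OF L] by (simp add: P_def)
  then have "amp T X \<in> closure L0" using proj_on_in[OF L, of "amp T X"] by (simp add: P_def L_def)
  then obtain u where "u \<in> L0" "dist u (amp T X) < sqrt e"
    using e unfolding closure_approachable by (metis real_sqrt_gt_zero)
  then obtain S where S: "S \<in> alg_generated M" "norm (amp S X - amp T X) < sqrt e"
    by (auto simp: L0_def dist_norm)
  have "(\<Sum>n. (norm (blinfun_apply (S - T) (x n)))\<^sup>2) = (norm (amp S X - amp T X))\<^sup>2"
    using norm_ell2_sums[of "amp S X - amp T X"]
    by (simp add: sums_iff minus_ell2.rep_eq coord_amp X blinfun.diff_left)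
  also have "\<dots> < e" using S(2) e by (metis norm_ge_zero real_sqrt_pow2 less_imp_le power_strict_mono pos2)
  finally show ?thesis using S(1) by blast
qed

text \<open>Different values at T would have disjoint neighbourhoods, whose preimages form a
  neighbourhood of T that meets the dense algebra. With this device algebraic identities for a
  normal extension spread to all of \<open>BH\<close>.\<close>

lemma (in vN_factor) sigma_weak_continuous_eq:
  assumes f: "continuous_map sigma_weak euclidean f" and g: "continuous_map sigma_weak euclidean g"
    and eq: "\<And>S. S \<in> alg_generated M \<Longrightarrow> f S = g S" and T: "T \<in> BH"
  shows "f T = (g T :: complex)"
proof (rule ccontr)
  assume "f T \<noteq> g T"
  obtain U V where UV: "open U" "open V" "f T \<in> U" "g T \<in> V" "U \<inter> V = {}"
    using hausdorff[OF \<open>f T \<noteq> g T\<close>] by blast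
  let ?W = "{A \<in> topspace sigma_weak. f A \<in> U} \<inter> {A \<in> topspace sigma_weak. g A \<in> V}"
  have W: "openin sigma_weak ?W"
    using openin_continuous_map_preimage[OF f, of U] openin_continuous_map_preimage[OF g, of V] UV(1,2)
    by (intro openin_Int) simp_all
  have TW: "T \<in> ?W" using T UV by (simp add: topspace_sigma_weak)
  from sigma_strong_neighbourhood[OF W TW] obtain x e where x: "square_summable x" "e > 0"
    "\<forall>B\<in>BH. (\<Sum>n. (norm (blinfun_apply (B - T) (x n)))\<^sup>2) < e \<longrightarrow> B \<in> ?W"
    by blast
  from alg_generated_dense[OF T x(1,2)] obtain S where S: "S \<in> alg_generated M" "(\<Sum>n. (norm (blinfun_apply (S - T) (x n)))\<^sup>2) < e"
    by blast
  have "S \<in> ?W" using x(3) alg_generated_subset_BH[OF S(1)] S(2) by blast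
  then show False using eq[OF S(1)] UV(5) by auto
qed

section \<open>Rank-one operators and orthonormal bases\<close>

definition rank_one :: "'h::complex_hilbert \<Rightarrow> 'h \<Rightarrow> ('h \<Rightarrow>\<^sub>L 'h)" where
  "rank_one x y = Blinfun (\<lambda>z. scaleC (cinner z y) x)"

lemma rank_one_apply: "rank_one x y z = scaleC (cinner z y) x"
proof -
  have "bounded_linear (\<lambda>z. scaleC (cinner z y) x)"
    by (rule bounded_linear_compose[OF scaleC.bounded_linear_left cinner.bounded_linear_left])
  then show ?thesis by (simp add: rank_one_def bounded_linear_Blinfun_apply)
qed

lemma rank_one_BH: "rank_one x y \<in> BH"
  by (simp add: BH_def rank_one_apply cinner_scaleC_left scaleC_scaleC)

lemma rank_one_compose_right: "A \<in> BH \<Longrightarrow> rank_one x y o\<^sub>L A = rank_one x (adj A y)"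
  by (rule blinfun_eqI) (simp add: rank_one_apply adj_right)

lemma rank_one_scaleR_right: "rank_one x (r *\<^sub>R y) = scalar_op (of_real r) o\<^sub>L rank_one x y"
  by (rule blinfun_eqI) (simp add: rank_one_apply scalar_op_apply cinner.scaleR_right scaleR_conv_of_real scaleC_scaleC)

locale onb =
  fixes e :: "nat \<Rightarrow> 'h::complex_hilbert"
  assumes norm_e: "e n = 0 \<or> norm (e n) = 1"
    and orth: "m \<noteq> n \<Longrightarrow> cinner (e m) (e n) = 0"
    and total: "(\<And>n. cinner (e n) x = 0) \<Longrightarrow> x = 0"
begin

definition P :: "nat \<Rightarrow> ('h \<Rightarrow>\<^sub>L 'h)" where "P N = (\<Sum>n<N. rank_one (e n) (e n))"

lemma e_normalized: "cinner x (e n) * cinner (e n) (e n) = cinner x (e n)"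
  using norm_e[of n] by (elim disjE) (simp_all add: cinner_self)

lemma is_projection_rank_one: "is_projection (rank_one (e n) (e n))"
  unfolding is_projection_def
proof (intro conjI rank_one_BH)
  show "rank_one (e n) (e n) o\<^sub>L rank_one (e n) (e n) = rank_one (e n) (e n)"
    by (rule blinfun_eqI) (simp add: rank_one_apply cinner_scaleC_left e_normalized)
  show "adj (rank_one (e n) (e n)) = rank_one (e n) (e n)"
  proof (rule adj_eqI)
    fix x y
    show "cinner (rank_one (e n) (e n) x) y = cinner x (rank_one (e n) (e n) y)"
      using cinner_commute[of "e n" y] by (simp add: rank_one_apply cinner_scaleC_left cinner_scaleC_right)
  qed
qed

lemma norm_rank_one_apply: "norm (rank_one (e n) (e n) x) = cmod (cinner x (e n))"
  using norm_e[of n] by (elim disjE) (simp_all add: rank_one_apply norm_scaleC)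

lemma filtration: "proj_filtration P" and norm_P: "(norm (P N x))\<^sup>2 = (\<Sum>n<N. (cmod (cinner x (e n)))\<^sup>2)"
proof -
  have o: "rank_one (e m) (e m) (rank_one (e n) (e n) x) = 0" if "m \<noteq> n" for m n x
    using orth[of n m] that by (simp add: rank_one_apply cinner_scaleC_left)
  have t: "x = 0" if "\<And>n. rank_one (e n) (e n) x = 0" for x
  proof (rule total)
    fix n have "cinner x (e n) = 0" using norm_rank_one_apply[of n x] that[of n] by simp
    then show "cinner (e n) x = 0" by (simp add: cinner_eq_zero_commute)
  qed
  note * = orthogonal_projections_filtration[of "\<lambda>n. rank_one (e n) (e n)", OF is_projection_rank_one o t]
  show "proj_filtration P" unfolding P_def using *(1) by blast
  show "(norm (P N x))\<^sup>2 = (\<Sum>n<N. (cmod (cinner x (e n)))\<^sup>2)"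
    unfolding P_def norm_rank_one_apply[symmetric] using *(2) by blast
qed

sublocale P: proj_filtration P by (rule filtration)

lemma norm_P_le: "norm (P N) \<le> 1"
  by (rule norm_blinfun_bound) (simp_all add: is_projectionD(6)[OF P.proj])

lemma parseval: "(\<lambda>n. (cmod (cinner x (e n)))\<^sup>2) sums (norm x)\<^sup>2"
  unfolding sums_def norm_P[symmetric] by (intro tendsto_power tendsto_norm P.lim)

lemma parseval_inner: "(\<lambda>n. cinner x (e n) * cinner (e n) y) sums cinner x y"
proof -
  have "(\<Sum>n<N. cinner x (e n) * cinner (e n) y) = cinner (P N x) y" for N
    by (simp add: P_def blinfun.sum_left cinner.sum_left rank_one_apply cinner_scaleC_left)
  then show ?thesis unfolding sums_def by (simp add: cinner.tendsto[OF P.lim tendsto_const])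
qed

end

lemma onb_exists:
  assumes "separable_space (euclidean :: 'h::complex_hilbert topology)"
  shows "\<exists>e :: nat \<Rightarrow> 'h. onb e"
proof -
  have "csubspace (UNIV :: 'h set)" by (simp add: csubspace_def)
  from orthonormal_sequence[OF assms this] obtain e :: "nat \<Rightarrow> 'h"
    where e: "\<forall>n. e n = 0 \<or> norm (e n) = 1" "\<forall>m n. m \<noteq> n \<longrightarrow> cinner (e m) (e n) = 0"
      "\<forall>x. (\<forall>n. cinner (e n) x = 0) \<longrightarrow> (\<forall>y\<in>UNIV. cinner y x = 0)" by blast
  have "x = 0" if "\<And>n. cinner (e n) x = 0" for x
  proof -
    have "cinner x x = 0" using e(3) that by blast
    then show ?thesis by (simp add: cinner_self_zero)
  qed
  then have "onb e" using e(1,2) by unfold_locales auto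
  then show ?thesis by blast
qed

section \<open>Matrix norms\<close>

lemma L2_set_sq: "(L2_set f I)\<^sup>2 = (\<Sum>i\<in>I. (f i)\<^sup>2)"
  unfolding L2_set_def by (rule real_sqrt_pow2) (simp add: sum_nonneg)

text \<open>A crude bound by the sum of the norms of the entries; it makes the supremum of reals
  meaningful.\<close>

lemma bdd_above_matrix_norm:
  "bdd_above ((\<lambda>x. L2_set (\<lambda>i. norm (\<Sum>j<n. blinfun_apply (A i j) (x j))) {..<n}) `
    {x :: nat \<Rightarrow> 'h::complex_hilbert. L2_set (\<lambda>j. norm (x j)) {..<n} \<le> 1})"
proof (rule bdd_aboveI2)
  fix x :: "nat \<Rightarrow> 'h" assume "x \<in> {x. L2_set (\<lambda>j. norm (x j)) {..<n} \<le> 1}"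
  then have x: "norm (x j) \<le> 1" if "j < n" for j
    using member_le_L2_set[of "{..<n}" j "\<lambda>j. norm (x j)"] that by auto
  have "L2_set (\<lambda>i. norm (\<Sum>j<n. A i j (x j))) {..<n} \<le> (\<Sum>i<n. norm (\<Sum>j<n. A i j (x j)))"
    by (rule L2_set_le_sum) simp
  also have "\<dots> \<le> (\<Sum>i<n. \<Sum>j<n. norm (A i j))"
  proof (intro sum_mono order_trans[OF norm_sum])
    fix i j assume "j \<in> {..<n}"
    then show "norm (A i j (x j)) \<le> norm (A i j)"
      using norm_blinfun[of "A i j" "x j"] mult_left_mono[OF x[of j] norm_ge_zero[of "A i j"]] by simp
  qed
  finally show "L2_set (\<lambda>i. norm (\<Sum>j<n. A i j (x j))) {..<n} \<le> (\<Sum>i<n. \<Sum>j<n. norm (A i j))" .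
qed

lemma matrix_norm_nonneg: "0 \<le> matrix_norm n (A :: nat \<Rightarrow> nat \<Rightarrow> ('h::complex_hilbert \<Rightarrow>\<^sub>L 'h))"
proof -
  have "L2_set (\<lambda>i. norm (\<Sum>j<n. A i j 0)) {..<n} \<le> matrix_norm n A"
    unfolding matrix_norm_def by (rule cSUP_upper[OF _ bdd_above_matrix_norm]) (simp add: L2_set_def)
  then show ?thesis by (simp add: L2_set_def)
qed

text \<open>The homogeneous form of the supremum, with squares so that later estimates are about
  plain sums.\<close>

lemma matrix_norm_apply:
  "(\<Sum>i<n. (norm (\<Sum>j<n. blinfun_apply (A i j) (x j)))\<^sup>2) \<le> (matrix_norm n A)\<^sup>2 * (\<Sum>j<n. (norm (x j :: 'h::complex_hilbert))\<^sup>2)"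
proof -
  define l where "l = L2_set (\<lambda>j. norm (x j)) {..<n}"
  have l2: "l\<^sup>2 = (\<Sum>j<n. (norm (x j))\<^sup>2)" unfolding l_def by (rule L2_set_sq)
  show ?thesis
  proof (cases "l = 0")
    case True
    then have "\<forall>j<n. x j = 0" using l2 by (simp add: sum_nonneg_eq_0_iff)
    then show ?thesis by simp
  next
    case False
    then have l: "l > 0" unfolding l_def using L2_set_nonneg[of "\<lambda>j. norm (x j)" "{..<n}"] by linarith
    define y where "y j = x j /\<^sub>R l" for j
    have "L2_set (\<lambda>j. norm (y j)) {..<n} = 1"
      using L2_set_right_distrib[of "inverse l" "\<lambda>j. norm (x j)" "{..<n}"] l by (simp add: y_def l_def[symmetric])
    then have "L2_set (\<lambda>i. norm (\<Sum>j<n. A i j (y j))) {..<n} \<le> matrix_norm n A"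
      unfolding matrix_norm_def by (intro cSUP_upper[OF _ bdd_above_matrix_norm]) simp
    then have "(L2_set (\<lambda>i. norm (\<Sum>j<n. A i j (y j))) {..<n})\<^sup>2 \<le> (matrix_norm n A)\<^sup>2"
      by (intro power_mono L2_set_nonneg)
    then have "(\<Sum>i<n. (norm (\<Sum>j<n. A i j (y j)))\<^sup>2) \<le> (matrix_norm n A)\<^sup>2" by (simp add: L2_set_sq)
    moreover have "(norm (\<Sum>j<n. A i j (y j)))\<^sup>2 = (norm (\<Sum>j<n. A i j (x j)))\<^sup>2 / l\<^sup>2" for i
      using l by (simp add: y_def blinfun.scaleR_right scaleR_sum_right[symmetric] power_mult_distrib field_simps)
    ultimately have "(\<Sum>i<n. (norm (\<Sum>j<n. A i j (x j)))\<^sup>2) / l\<^sup>2 \<le> (matrix_norm n A)\<^sup>2"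
      by (simp add: sum_divide_distrib)
    then show ?thesis unfolding l2[symmetric] using l by (simp add: pos_divide_le_eq)
  qed
qed

lemma matrix_norm_leI:
  assumes K: "K \<ge> 0" and le: "\<And>x. (\<Sum>i<n. (norm (\<Sum>j<n. blinfun_apply (A i j) (x j)))\<^sup>2)
    \<le> K\<^sup>2 * (\<Sum>j<n. (norm (x j :: 'h::complex_hilbert))\<^sup>2)"
  shows "matrix_norm n A \<le> K"
  unfolding matrix_norm_def
proof (rule cSUP_least)
  show "{x :: nat \<Rightarrow> 'h. L2_set (\<lambda>j. norm (x j)) {..<n} \<le> 1} \<noteq> {}"
    by (rule ex_in_conv[THEN iffD1], rule exI[of _ "\<lambda>_. 0"]) (simp add: L2_set_def)
  fix x :: "nat \<Rightarrow> 'h" assume "x \<in> {x. L2_set (\<lambda>j. norm (x j)) {..<n} \<le> 1}"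
  then have "(L2_set (\<lambda>j. norm (x j)) {..<n})\<^sup>2 \<le> 1" by (intro power_le_one L2_set_nonneg) simp
  then have x: "(\<Sum>j<n. (norm (x j))\<^sup>2) \<le> 1" by (simp add: L2_set_sq)
  have "(L2_set (\<lambda>i. norm (\<Sum>j<n. A i j (x j))) {..<n})\<^sup>2 \<le> K\<^sup>2 * (\<Sum>j<n. (norm (x j))\<^sup>2)"
    unfolding L2_set_sq by (rule le)
  also have "\<dots> \<le> K\<^sup>2 * 1" by (intro mult_left_mono x) simp
  finally have "(L2_set (\<lambda>i. norm (\<Sum>j<n. A i j (x j))) {..<n})\<^sup>2 \<le> K\<^sup>2" by (simp only: mult_1_right)
  then show "L2_set (\<lambda>i. norm (\<Sum>j<n. A i j (x j))) {..<n} \<le> K" by (rule power2_le_imp_le[OF _ K])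
qed

section \<open>A state times the identity is normal and completely bounded\<close>

definition state_map :: "'h::complex_hilbert \<Rightarrow> ('h \<Rightarrow>\<^sub>L 'h) \<Rightarrow> ('h \<Rightarrow>\<^sub>L 'h)" where
  "state_map \<xi> B = scalar_op (cinner (blinfun_apply B \<xi>) \<xi>)"

lemma scalar_op_add: "scalar_op (c + d) = scalar_op c + scalar_op d"
  by (rule blinfun_eqI) (simp add: scalar_op_apply blinfun.add_left scaleC_add_left)

text \<open>The scalar matrix w is a compression of A to the vectors
  \<open>scaleC (c j) \<xi>\<close>, so its norm is at most that of A. For w tensor 1, this bound is
  applied in each coordinate of an orthonormal basis and summed by Parseval.\<close>

lemma state_map_matrix_bound:
  fixes \<xi> :: "'h::complex_hilbert"
  assumes sep: "separable_space (euclidean :: 'h topology)" and u: "norm \<xi> = 1"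
    and A: "\<And>i j. i < n \<Longrightarrow> j < n \<Longrightarrow> A i j \<in> BH"
  shows "matrix_norm n (\<lambda>i j. state_map \<xi> (A i j)) \<le> matrix_norm n A"
proof (rule matrix_norm_leI[OF matrix_norm_nonneg])
  fix x :: "nat \<Rightarrow> 'h"
  let ?K = "matrix_norm n A"
  define w where "w i j = cinner (A i j \<xi>) \<xi>" for i j
  obtain e :: "nat \<Rightarrow> 'h" where "onb e" using onb_exists[OF sep] by blast
  then interpret onb e .
  have scal: "(\<Sum>i<n. (cmod (\<Sum>j<n. w i j * c j))\<^sup>2) \<le> ?K\<^sup>2 * (\<Sum>j<n. (cmod (c j))\<^sup>2)"
    for c
  proof -
    have "(\<Sum>i<n. (cmod (\<Sum>j<n. w i j * c j))\<^sup>2) \<le> (\<Sum>i<n. (norm (\<Sum>j<n. A i j (scaleC (c j) \<xi>)))\<^sup>2)"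
    proof (intro sum_mono power_mono)
      fix i assume "i \<in> {..<n}"
      then have "(\<Sum>j<n. w i j * c j) = cinner (\<Sum>j<n. A i j (scaleC (c j) \<xi>)) \<xi>"
        using A by (simp add: cinner.sum_left BH_apply cinner_scaleC_left w_def mult.commute)
      then show "cmod (\<Sum>j<n. w i j * c j) \<le> norm (\<Sum>j<n. A i j (scaleC (c j) \<xi>))"
        using norm_cinner_le[of "\<Sum>j<n. A i j (scaleC (c j) \<xi>)" \<xi>] u by simp
    qed simp
    also have "\<dots> \<le> ?K\<^sup>2 * (\<Sum>j<n. (norm (scaleC (c j) \<xi>))\<^sup>2)" by (rule matrix_norm_apply)
    finally show ?thesis using u by (simp add: norm_scaleC)
  qed
  show "(\<Sum>i<n. (norm (\<Sum>j<n. state_map \<xi> (A i j) (x j)))\<^sup>2) \<le> ?K\<^sup>2 * (\<Sum>j<n. (norm (x j))\<^sup>2)"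
  proof -
    let ?y = "\<lambda>i. \<Sum>j<n. state_map \<xi> (A i j) (x j)"
    have s1: "(\<lambda>k. \<Sum>i<n. (cmod (cinner (?y i) (e k)))\<^sup>2) sums (\<Sum>i<n. (norm (?y i))\<^sup>2)"
      by (rule sums_sum) (rule parseval)
    have s2: "(\<lambda>k. ?K\<^sup>2 * (\<Sum>j<n. (cmod (cinner (x j) (e k)))\<^sup>2)) sums (?K\<^sup>2 * (\<Sum>j<n. (norm (x j))\<^sup>2))"
      by (rule sums_mult, rule sums_sum, rule parseval)
    have "(\<Sum>i<n. (cmod (cinner (?y i) (e k)))\<^sup>2) \<le> ?K\<^sup>2 * (\<Sum>j<n. (cmod (cinner (x j) (e k)))\<^sup>2)" for k
    proof -
      have "(\<Sum>i<n. (cmod (cinner (?y i) (e k)))\<^sup>2) = (\<Sum>i<n. (cmod (\<Sum>j<n. w i j * cinner (x j) (e k)))\<^sup>2)"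
        by (simp add: cinner.sum_left state_map_def scalar_op_apply cinner_scaleC_left w_def)
      also have "\<dots> \<le> ?K\<^sup>2 * (\<Sum>j<n. (cmod (cinner (x j) (e k)))\<^sup>2)" by (rule scal)
      finally show ?thesis .
    qed
    then show ?thesis by (rule sums_le[OF _ s1 s2])
  qed
qed

lemma continuous_map_mult_const:
  assumes "continuous_map X euclidean f"
  shows "continuous_map X euclidean (\<lambda>A. f A * (c::complex))"
  using continuous_map_compose[OF assms, of euclidean "\<lambda>z. z * c"]
  by (simp add: o_def continuous_on_mult_right)

lemma (in vN) state_map_CB_sigma:
  assumes sep: "separable_space (euclidean :: 'h topology)" and u: "norm \<xi> = 1"
  shows "state_map \<xi> \<in> CB_sigma M"
  unfolding CB_sigma_def
proof (intro CollectI conjI)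
  show "linear_map M (state_map \<xi>)" unfolding linear_map_def
    by (auto simp: state_map_def scalar blinfun.add_left cinner_add_left scalar_op_add scalar_op_apply
        cinner_scaleC_left scalar_op_compose_left)
  show "normal_map M (state_map \<xi>)"
  proof (rule normal_mapI[OF subset_BH])
    show "state_map \<xi> A \<in> M" for A by (simp add: state_map_def scalar)
    fix x y :: "nat \<Rightarrow> 'h" assume xy: "square_summable x" "square_summable y"
    have "sigma_weak_functional x y (state_map \<xi> A) = cinner (A \<xi>) \<xi> * sigma_weak_functional x y id_blinfun" for A
    proof -
      have "state_map \<xi> A = scalar_op (cinner (A \<xi>) \<xi>) o\<^sub>L id_blinfun"
        by (rule blinfun_eqI) (simp add: state_map_def)
      then show ?thesis by (simp only: swf_scalar[OF xy])
    qed
    then show "continuous_map (subtopology sigma_weak M) euclidean (\<lambda>A. sigma_weak_functional x y (state_map \<xi> A))"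
      by (simp add: continuous_map_mult_const continuous_map_from_subtopology continuous_vector_functional)
  qed
  show "completely_bounded M (state_map \<xi>)"
    unfolding completely_bounded_def
    using state_map_matrix_bound[OF sep u] BH by (intro exI[of _ 1]) simp
qed

section \<open>Normal extensions force a minimal projection\<close>

lemma linear_map_zero: "linear_map S \<phi> \<Longrightarrow> 0 \<in> S \<Longrightarrow> \<phi> 0 = 0"
proof -
  assume l: "linear_map S \<phi>" and z: "0 \<in> S"
  then have "\<phi> (0 + 0) = \<phi> 0 + \<phi> 0" unfolding linear_map_def by blast
  then show ?thesis by simp
qed

lemma linear_map_sum:
  assumes l: "linear_map S \<phi>" and z: "0 \<in> S" and add: "\<And>A B. A \<in> S \<Longrightarrow> B \<in> S \<Longrightarrow> A + B \<in> S"
    and f: "\<And>i. i \<in> I \<Longrightarrow> f i \<in> S"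
  shows "\<phi> (sum f I) = (\<Sum>i\<in>I. \<phi> (f i))"
proof (cases "finite I")
  case True
  then have "sum f I \<in> S \<and> \<phi> (sum f I) = (\<Sum>i\<in>I. \<phi> (f i))" using f
  proof (induction I)
    case empty then show ?case using linear_map_zero[OF l z] z by simp
  next
    case (insert a I)
    then show ?case using l add unfolding linear_map_def by simp
  qed
  then show ?thesis by simp
qed (simp add: linear_map_zero[OF l z])

text \<open>C is absorbed into the first sequence of the functional, which stays
  square-summable.\<close>

lemma continuous_compose_right:
  assumes "C \<in> BH"
  shows "continuous_map sigma_weak sigma_weak (\<lambda>T. T o\<^sub>L C)"
proof -
  have "normal_map BH (\<lambda>T. T o\<^sub>L C)"
  proof (rule normal_mapI)
    fix x y :: "nat \<Rightarrow> 'a" assume xy: "square_summable x" "square_summable y"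
    have "sigma_weak_functional x y (A o\<^sub>L C) = sigma_weak_functional (\<lambda>n. C (x n)) y A" for A
      by (simp add: sigma_weak_functional_def)
    then show "continuous_map (subtopology sigma_weak BH) euclidean (\<lambda>A. sigma_weak_functional x y (A o\<^sub>L C))"
      using continuous_swf[OF square_summable_blinfun[OF xy(1)] xy(2), of C]
      by (simp add: continuous_map_from_subtopology)
  qed (use assms BH_compose in auto)
  then show ?thesis
    using normal_map_continuous[of BH] by (simp add: subtopology_topspace[of sigma_weak, unfolded topspace_sigma_weak])
qed

section \<open>Properties of a normal extension of the tilde map of a state\<close>

context vN_factor
begin

context
  fixes \<xi> :: 'h and \<Phi> :: "('h \<Rightarrow>\<^sub>L 'h) \<Rightarrow> ('h \<Rightarrow>\<^sub>L 'h)"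
  assumes unit: "norm \<xi> = 1" and lin: "linear_map BH \<Phi>" and normal: "normal_map BH \<Phi>"
    and ext: "extends_tilde M (state_map \<xi>) \<Phi>"
begin

lemma \<Phi>_BH: "T \<in> BH \<Longrightarrow> \<Phi> T \<in> BH"
  using lin unfolding linear_map_def by blast

lemma \<Phi>_alg: "(\<And>i. i < (n::nat) \<Longrightarrow> A i \<in> commutant M \<and> B i \<in> M) \<Longrightarrow>
    \<Phi> (\<Sum>i<n. A i o\<^sub>L B i) = (\<Sum>i<n. A i o\<^sub>L state_map \<xi> (B i))"
proof -
  assume "\<And>i. i < n \<Longrightarrow> A i \<in> commutant M \<and> B i \<in> M"
  then have "(\<Sum>i<n. A i o\<^sub>L B i, \<Sum>i<n. A i o\<^sub>L state_map \<xi> (B i)) \<in> tilde_graph M (state_map \<xi>)"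
    unfolding tilde_graph_def by blast
  then show ?thesis using ext unfolding extends_tilde_def by fast
qed

lemma continuous_\<Phi>: "continuous_map sigma_weak sigma_weak \<Phi>"
  using normal_map_continuous[OF normal] by (simp add: subtopology_topspace[of sigma_weak, unfolded topspace_sigma_weak])

lemma continuous_\<Phi>_vector: "continuous_map sigma_weak euclidean (\<lambda>T. cinner (\<Phi> T x) y)"
  using continuous_map_compose[OF continuous_\<Phi> continuous_vector_functional[of x y]] by (simp add: o_def)

text \<open>On the generated algebra, C moves past the factors from M and past the scalar values of
  the state; density and normality do the rest.\<close>

lemma \<Phi>_commutant_right:
  assumes C: "C \<in> commutant M" and T: "T \<in> BH"
  shows "\<Phi> (T o\<^sub>L C) = \<Phi> T o\<^sub>L C"
proof (rule blinfun_eqI, rule cinner_eqI)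
  fix x y
  interpret N: vN "commutant M" by (rule vN_commutant)
  have "cinner (\<Phi> (T o\<^sub>L C) x) y = cinner (\<Phi> T (C x)) y"
  proof (rule sigma_weak_continuous_eq[OF _ continuous_\<Phi>_vector _ T])
    show "continuous_map sigma_weak euclidean (\<lambda>T. cinner (\<Phi> (T o\<^sub>L C) x) y)"
      using continuous_map_compose[OF continuous_compose_right[OF N.BH[OF C]] continuous_\<Phi>_vector[of x y]]
      by (simp add: o_def)
    fix S assume "S \<in> alg_generated M"
    then obtain n :: nat and A B where S: "S = (\<Sum>i<n. A i o\<^sub>L B i)" "\<forall>i<n. A i \<in> commutant M \<and> B i \<in> M"
      unfolding alg_generated_def by blast
    have bc: "B i (C x) = C (B i x)" if "i < n" for i x using commutes[OF _ C] S(2) that by blast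
    have "S o\<^sub>L C = (\<Sum>i<n. (A i o\<^sub>L C) o\<^sub>L B i)"
      by (rule blinfun_eqI) (simp add: S(1) blinfun.sum_left bc)
    then have "\<Phi> (S o\<^sub>L C) = (\<Sum>i<n. (A i o\<^sub>L C) o\<^sub>L state_map \<xi> (B i))"
      using S(2) N.comp C by (simp add: \<Phi>_alg)
    moreover have "\<Phi> S = (\<Sum>i<n. A i o\<^sub>L state_map \<xi> (B i))" using S by (simp add: \<Phi>_alg)
    ultimately show "cinner (\<Phi> (S o\<^sub>L C) x) y = cinner (\<Phi> S (C x)) y"
      by (simp add: blinfun.sum_left state_map_def scalar_op_apply BH_apply[OF N.BH[OF C]])
  qed
  then show "cinner (\<Phi> (T o\<^sub>L C) x) y = cinner ((\<Phi> T o\<^sub>L C) x) y" by simp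
qed

lemma \<Phi>_mem_commutant:
  assumes T: "T \<in> BH"
  shows "\<Phi> T \<in> commutant M"
proof (rule commutantI[OF \<Phi>_BH[OF T]], rule cinner_eqI)
  interpret N: vN "commutant M" by (rule vN_commutant)
  fix B x y assume B: "B \<in> M"
  \<comment> \<open>B is moved to the right as its adjoint, so that both sides are vector
    functionals of \<open>\<Phi> T\<close>.\<close>
  have "cinner (\<Phi> T (B x)) y = cinner (\<Phi> T x) (adj B y)"
  proof (rule sigma_weak_continuous_eq[OF continuous_\<Phi>_vector continuous_\<Phi>_vector _ T])
    fix S assume "S \<in> alg_generated M"
    then obtain n :: nat and A B' where S: "S = (\<Sum>i<n. A i o\<^sub>L B' i)" "\<forall>i<n. A i \<in> commutant M \<and> B' i \<in> M"
      unfolding alg_generated_def by blast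
    have "\<Phi> S = (\<Sum>i<n. A i o\<^sub>L state_map \<xi> (B' i))" using S by (simp add: \<Phi>_alg)
    also have "\<dots> \<in> commutant M" using S(2) by (intro N.sum N.comp) (auto simp: state_map_def N.scalar)
    finally have "\<Phi> S (B x) = B (\<Phi> S x)" by (rule commutantD(3)[OF _ B])
    then show "cinner (\<Phi> S (B x)) y = cinner (\<Phi> S x) (adj B y)" by (simp add: adj_right[OF BH[OF B]])
  qed
  then show "cinner (\<Phi> T (B x)) y = cinner (B (\<Phi> T x)) y" by (simp add: adj_right[OF BH[OF B]])
qed

text \<open>Otherwise \<open>\<Phi>\<close> would vanish on the finite-rank projections
  \<open>P N\<close>, and normality would carry this to their strong limit, the identity. But
  \<open>\<Phi>\<close> fixes the identity, as \<xi> is a unit vector.\<close>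

lemma \<Phi>_rank_one_nonzero:
  assumes sep: "separable_space (euclidean :: 'h topology)"
  shows "\<exists>x y. \<Phi> (rank_one x y) \<noteq> 0"
proof (rule ccontr)
  interpret N: vN "commutant M" by (rule vN_commutant)
  assume "\<nexists>x y. \<Phi> (rank_one x y) \<noteq> 0"
  then have z: "\<Phi> (rank_one x y) = 0" for x y by blast
  obtain e :: "nat \<Rightarrow> 'h" where "onb e" using onb_exists[OF sep] by blast
  then interpret onb e .
  have "\<Phi> (P N) = (\<Sum>n<N. \<Phi> (rank_one (e n) (e n)))" for N
    unfolding P_def by (rule linear_map_sum[OF lin BH_zero BH_add rank_one_BH])
  then have "\<Phi> (P N) = 0" for N by (simp add: z)
  moreover have "(\<lambda>N. cinner (\<Phi> (P N) \<xi>) \<xi>) \<longlonglongrightarrow> cinner (\<Phi> id_blinfun \<xi>) \<xi>"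
    by (rule continuous_map_sigma_weak_tendsto[OF continuous_\<Phi>_vector P.BH BH_id norm_P_le]) (simp add: P.lim)
  ultimately have "(\<lambda>N. 0) \<longlonglongrightarrow> cinner (\<Phi> id_blinfun \<xi>) \<xi>" by simp
  then have 0: "cinner (\<Phi> id_blinfun \<xi>) \<xi> = 0" by (simp add: LIMSEQ_const_iff)
  have "\<Phi> (\<Sum>i<Suc 0. id_blinfun o\<^sub>L id_blinfun) = (\<Sum>i<Suc 0. id_blinfun o\<^sub>L state_map \<xi> id_blinfun)"
    by (rule \<Phi>_alg) (simp add: id N.id)
  moreover have "id_blinfun o\<^sub>L A = A" for A :: "'h \<Rightarrow>\<^sub>L 'h" by (rule blinfun_eqI) simp
  ultimately have "\<Phi> id_blinfun = state_map \<xi> id_blinfun" by simp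
  then show False using 0 unit by (simp add: state_map_def scalar_op_apply cinner_self)
qed

end

end

section \<open>Dividing projections when none is minimal\<close>

context vN
begin

text \<open>In the absence of minimal projections r has a proper subprojection s, and by Pythagoras
  s or r - s carries at most half of the squared norm of \<open>r x\<close>.\<close>

lemma halving_projection:
  assumes r: "r \<in> M" "is_projection r" "r \<noteq> 0" and nm: "\<nexists>p. minimal_in M p"
  shows "\<exists>t\<in>M. is_projection t \<and> t \<noteq> 0 \<and> t \<noteq> r \<and> t o\<^sub>L r = t \<and> (norm (t x))\<^sup>2 \<le> (norm (blinfun_apply r x))\<^sup>2 / 2"
proof -
  obtain s where s: "s \<in> M" "is_projection s" "s o\<^sub>L r = s" "s \<noteq> 0" "s \<noteq> r"
    using unsplittable_imp_minimal[OF r] nm by blast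
  note rD = is_projectionD[OF r(2)] and sD = is_projectionD[OF s(2)]
  have sr: "s (r x) = s x" for x using s(3) by (metis blinfun_apply_blinfun_compose)
  have "r o\<^sub>L s = s" using arg_cong[OF s(3), of adj] by (simp add: adj_compose sD rD)
  then have rs: "r (s x) = s x" for x by (metis blinfun_apply_blinfun_compose)
  have d: "is_projection (r - s)" unfolding is_projection_def
    by (auto intro!: BH_intros blinfun_eqI[of "_ o\<^sub>L _"] simp: rD sD adj_diff blinfun.diff_left blinfun.diff_right sr rs)
  have dr: "(r - s) o\<^sub>L r = r - s" by (rule blinfun_eqI) (simp add: blinfun.diff_left rD sr)
  have "(norm (r x))\<^sup>2 = (norm (r x - s x))\<^sup>2 + (norm (s x))\<^sup>2"
    using norm_decomp_projection[OF s(2), of "r x"] by (simp add: sr)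
  then consider "(norm (s x))\<^sup>2 \<le> (norm (r x))\<^sup>2 / 2" | "(norm ((r - s) x))\<^sup>2 \<le> (norm (r x))\<^sup>2 / 2"
    unfolding blinfun.diff_left by linarith
  then show ?thesis
  proof cases
    case 1 then show ?thesis using s by (intro bexI[of _ s]) auto
  next
    case 2 then show ?thesis using s d dr diff[OF r(1) s(1)] by (intro bexI[of _ "r - s"]) auto
  qed
qed

text \<open>Repeated halving yields a strictly decreasing chain t below q. Its successive
  differences are nonzero and mutually orthogonal, and on x their norms are at most those of the
  chain.\<close>

lemma shrinking_projections:
  assumes q: "q \<in> M" "is_projection q" "q \<noteq> 0" and nm: "\<nexists>p. minimal_in M p"
  shows "\<exists>r. \<forall>n. is_projection (r n) \<and> r n \<in> M \<and> r n \<noteq> 0 \<and> (\<forall>y. q (r n y) = r n y) \<and>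
    (norm (blinfun_apply (r n) x))\<^sup>2 \<le> (norm x)\<^sup>2 / 2 ^ n \<and> (\<forall>m y. m \<noteq> n \<longrightarrow> blinfun_apply (r m) (r n y) = 0)"
proof -
  define good where "good n t \<longleftrightarrow> t \<in> M \<and> is_projection t \<and> t \<noteq> 0 \<and> q o\<^sub>L t = t \<and> (norm (blinfun_apply t x))\<^sup>2 \<le> (norm x)\<^sup>2 / 2 ^ n"
    for n :: nat and t
  have "\<exists>t. \<forall>n. good n (t n) \<and> (t (Suc n) o\<^sub>L t n = t (Suc n) \<and> t (Suc n) \<noteq> t n)"
  proof (rule dependent_nat_choice)
    show "\<exists>t. good 0 t" unfolding good_def using q is_projectionD(2,6)[OF q(2)]
      by (intro exI[of _ q]) (simp add: power_mono)
    fix t n assume t: "good n t"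
    then obtain s where s: "s \<in> M" "is_projection s" "s \<noteq> 0" "s \<noteq> t" "s o\<^sub>L t = s"
      "(norm (s x))\<^sup>2 \<le> (norm (t x))\<^sup>2 / 2" using halving_projection[of t x] nm unfolding good_def by blast
    have tD: "is_projection t" "q o\<^sub>L t = t" "(norm (t x))\<^sup>2 \<le> (norm x)\<^sup>2 / 2 ^ n" using t by (auto simp: good_def)
    have "t o\<^sub>L s = s" using arg_cong[OF s(5), of adj] by (simp add: adj_compose is_projectionD[OF s(2)] is_projectionD[OF tD(1)])
    then have "q o\<^sub>L s = s" using tD(2) by (metis blinfun_compose_assoc)
    moreover have "(norm (s x))\<^sup>2 \<le> (norm x)\<^sup>2 / 2 ^ Suc n" using s(6) tD(3) by simp
    ultimately show "\<exists>s. good (Suc n) s \<and> s o\<^sub>L t = s \<and> s \<noteq> t" using s unfolding good_def by blast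
  qed
  then obtain t where t: "\<And>n. good n (t n)" "\<And>n. t (Suc n) o\<^sub>L t n = t (Suc n)" "\<And>n. t (Suc n) \<noteq> t n" by blast
  have tp: "is_projection (t n)" and tM: "t n \<in> M" for n using t(1)[of n] by (auto simp: good_def)
  note tD = is_projectionD[OF tp]
  have down: "t n (t m y) = t n y" if "m \<le> n" for m n y
    using that
  proof (induction n rule: dec_induct)
    case (step n)
    have "t (Suc n) z = t (Suc n) (t n z)" for z using t(2)[of n] by (metis blinfun_apply_blinfun_compose)
    then show ?case using step.IH by metis
  qed (simp add: tD)
  have up: "t m (t n y) = t n y" if "m \<le> n" for m n y
  proof (rule cinner_eqI2)
    fix z
    have "cinner z (t m (t n y)) = cinner (t n (t m z)) y"
      by (simp only: tD(5))
    then show "cinner z (t m (t n y)) = cinner z (t n y)" by (simp only: down[OF that] tD(5))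
  qed
  define r where "r n = t n - t (Suc n)" for n
  have rp: "is_projection (r n)" for n unfolding is_projection_def r_def
    by (auto intro!: BH_intros blinfun_eqI[of "_ o\<^sub>L _"] simp: tD adj_diff blinfun.diff_left blinfun.diff_right up down)
  have rt: "r n y = t n (r n y)" for n y by (simp add: r_def blinfun.diff_left blinfun.diff_right up tD)
  have rt': "r n y = r n (t n y)" for n y by (simp add: r_def blinfun.diff_left blinfun.diff_right down tD)
  have tr: "t k (r n y) = 0" if "n < k" for n k y
    using that by (simp add: r_def blinfun.diff_left blinfun.diff_right down)
  have orth: "r m (r n y) = 0" if "n < m" for m n y
    by (subst rt') (simp add: tr[OF that])
  have orth': "r m (r n y) = 0" if "m < n" for m n y
  proof (rule cinner_eqI2)
    fix z
    have "cinner z (r m (r n y)) = cinner (r n (r m z)) y"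
      by (simp only: is_projectionD(5)[OF rp])
    then show "cinner z (r m (r n y)) = cinner z 0" by (simp add: orth[OF that])
  qed
  have "q (r n y) = r n y" for n y
  proof -
    have "q (t n z) = t n z" for z using t(1)[of n] unfolding good_def by (metis blinfun_apply_blinfun_compose)
    then show ?thesis using rt[of n y] by metis
  qed
  moreover have "(norm (r n x))\<^sup>2 \<le> (norm x)\<^sup>2 / 2 ^ n" for n
  proof -
    have "norm (r n x) \<le> norm (t n x)" using rt'[of n x] is_projectionD(6)[OF rp[of n], of "t n x"] by simp
    then have "(norm (r n x))\<^sup>2 \<le> (norm (t n x))\<^sup>2" by (simp add: power_mono)
    also have "\<dots> \<le> (norm x)\<^sup>2 / 2 ^ n" using t(1)[of n] by (simp add: good_def)
    finally show ?thesis .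
  qed
  moreover have "r n \<noteq> 0" for n using t(3)[of n] by (auto simp: r_def)
  moreover have "r n \<in> M" for n unfolding r_def by (intro diff tM)
  moreover have "r m (r n y) = 0" if "m \<noteq> n" for m n y using orth orth' that by (cases m n rule: linorder_cases) auto
  ultimately show ?thesis using rp by (intro exI[of _ r] allI conjI impI) simp_all
qed

end

text \<open>
  A gliding hump: \<open>G = \<Phi> (rank_one \<eta> \<zeta>)\<close> is bounded below on a projection \<open>q\<close>. If \<open>q\<close> contained orthogonal
  projections \<open>r n\<close> almost annihilating \<open>\<zeta>\<close>, then inflating the components \<open>r n \<zeta>\<close> would yield a vector
  \<open>\<zeta>'\<close> for which \<open>\<Phi> (rank_one \<eta> \<zeta>')\<close> is unbounded.
\<close>

lemma (in vN_factor) extension_imp_minimal: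
  assumes sep: "separable_space (euclidean :: 'h topology)"
    and unit: "norm \<xi> = 1" and lin: "linear_map BH \<Phi>" and normal: "normal_map BH \<Phi>"
    and ext: "extends_tilde M (state_map \<xi>) \<Phi>"
  shows "\<exists>p. minimal_in M p"
proof -
  interpret N: vN "commutant M" by (rule vN_commutant)
  note \<Phi> = unit lin normal ext
  \<comment> \<open>The contradiction arises in the commutant, over which \<open>\<Phi>\<close> is
    right-linear; \<open>minimal_commutant\<close> then leads back to M.\<close>
  have "\<exists>p. minimal_in (commutant M) p"
  proof (rule ccontr)
    assume nm: "\<nexists>p. minimal_in (commutant M) p"
    obtain \<eta> \<zeta> where nz: "\<Phi> (rank_one \<eta> \<zeta>) \<noteq> 0" using \<Phi>_rank_one_nonzero[OF \<Phi> sep] by blast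
    define G where "G = \<Phi> (rank_one \<eta> \<zeta>)"
    have G: "G \<in> commutant M" unfolding G_def by (rule \<Phi>_mem_commutant[OF \<Phi> rank_one_BH])
    obtain v where v: "G v \<noteq> 0" using nz unfolding G_def by (metis blinfun_eqI zero_blinfun.rep_eq)
    then have v0: "v \<noteq> 0" by auto
    \<comment> \<open>Half of the quotient of squared norms at v, so that the form of D is positive
      at v and the spectral projection q is nonzero.\<close>
    define \<delta> where "\<delta> = (norm (G v))\<^sup>2 / (2 * (norm v)\<^sup>2)"
    have \<delta>: "\<delta> > 0" using v v0 by (simp add: \<delta>_def)
    define D where "D = (adj G o\<^sub>L G) - \<delta> *\<^sub>R id_blinfun"
    have DM: "D \<in> commutant M" unfolding D_def by (intro N.diff N.comp N.adj N.scaleR N.id G)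
    have Dadj: "adj D = D" unfolding D_def
      by (simp add: adj_diff adj_compose adj_adj adj_scaleR adj_id BH_intros N.BH[OF G])
    have Dform: "inner (D x) x = (norm (G x))\<^sup>2 - \<delta> * (norm x)\<^sup>2" for x
      by (simp add: D_def blinfun.diff_left blinfun.scaleR_left inner_diff_left power2_norm_eq_inner)
        (simp add: inner_eq_Re_cinner adj_left[OF N.BH[OF G]])
    obtain q where q: "q \<in> commutant M" "is_projection q" "\<And>x. 0 \<le> inner (D (q x)) (q x)"
      "\<And>x. inner (D (x - q x)) (x - q x) \<le> 0" using N.spectral_projection_mem[OF DM Dadj] by blast
    have q0: "q \<noteq> 0"
    proof
      assume "q = 0"
      then have "inner (D v) v \<le> 0" using q(4)[of v] by simp
      then show False unfolding Dform using v v0 by (simp add: \<delta>_def)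
    qed
    have lower: "\<delta> * (norm x)\<^sup>2 \<le> (norm (G x))\<^sup>2" if "q x = x" for x
      using q(3)[of x] unfolding that Dform by simp
    obtain r where r: "\<And>n. is_projection (r n)" "\<And>n. r n \<in> commutant M" "\<And>n. r n \<noteq> 0" "\<And>n y. q (r n y) = r n y"
      "\<And>n. (norm (r n \<zeta>))\<^sup>2 \<le> (norm \<zeta>)\<^sup>2 / 2 ^ n" "\<And>m n y. m \<noteq> n \<Longrightarrow> blinfun_apply (r m) (r n y) = 0"
      using N.shrinking_projections[OF q(1,2) q0 nm, of \<zeta>] by metis
    \<comment> \<open>The rate, the square root of 1/2, is relaxed to the rational 3/4, as 9/16
      exceeds 1/2.\<close>
    have rn: "norm (r n \<zeta>) \<le> norm \<zeta> * (3/4) ^ n" for n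
    proof (rule power2_le_imp_le)
      have "(norm (r n \<zeta>))\<^sup>2 \<le> (norm \<zeta>)\<^sup>2 * (1/2) ^ n" using r(5)[of n] by (simp add: power_one_over)
      also have "\<dots> \<le> (norm \<zeta>)\<^sup>2 * (9/16) ^ n" by (intro mult_left_mono power_mono) simp_all
      also have "\<dots> = (norm \<zeta> * (3/4) ^ n)\<^sup>2"
        by (simp add: power_mult_distrib power_mult[symmetric] mult.commute[of n]) (simp add: power_mult power2_eq_square)
      finally show "(norm (r n \<zeta>))\<^sup>2 \<le> (norm \<zeta> * (3/4) ^ n)\<^sup>2" .
    qed simp
    \<comment> \<open>The factor 5/4 exceeds 1, yet 5/4 times 3/4 is 15/16, so the inflated
      components still sum to a vector.\<close>
    define z where "z n = (5/4) ^ n *\<^sub>R r n \<zeta>" for n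
    have "summable z"
    proof (rule summable_comparison_test')
      show "summable (\<lambda>n. norm \<zeta> * (15/16) ^ n)" by (intro summable_mult summable_geometric) simp
      show "norm (z n) \<le> norm \<zeta> * (15/16) ^ n" if "n \<ge> 0" for n
      proof -
        have "norm (z n) = (5/4) ^ n * norm (r n \<zeta>)" by (simp add: z_def)
        also have "\<dots> \<le> (5/4) ^ n * (norm \<zeta> * (3/4) ^ n)" by (intro mult_left_mono rn) simp
        also have "\<dots> = norm \<zeta> * ((5/4) * (3/4)) ^ n" unfolding power_mult_distrib by simp
        finally show ?thesis by simp
      qed
    qed
    define \<zeta>' where "\<zeta>' = suminf z"
    have comp: "r k \<zeta>' = (5/4) ^ k *\<^sub>R r k \<zeta>" for k
    proof -
      have "r k \<zeta>' = (\<Sum>n. r k (z n))"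
        unfolding \<zeta>'_def by (rule bounded_linear.suminf[OF blinfun.bounded_linear_right \<open>summable z\<close>])
      also have "\<dots> = (\<Sum>n\<in>{k}. r k (z n))"
        by (rule suminf_finite) (auto simp: z_def blinfun.scaleR_right r(6))
      finally show ?thesis by (simp add: z_def blinfun.scaleR_right is_projectionD(4)[OF r(1)])
    qed
    define G' where "G' = \<Phi> (rank_one \<eta> \<zeta>')"
    \<comment> \<open>Composing a rank-one operator with \<open>r k\<close> on the right replaces
      its second vector by the image under \<open>r k\<close>; right linearity thus isolates the
      component k.\<close>
    have GG: "G' (r k x) = (5/4) ^ k *\<^sub>R G (r k x)" for k x
    proof -
      note rk = is_projectionD[OF r(1)[of k]]
      have "G' o\<^sub>L r k = \<Phi> (rank_one \<eta> (r k \<zeta>'))"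
        unfolding G'_def \<Phi>_commutant_right[OF \<Phi> r(2) rank_one_BH, symmetric] by (simp add: rank_one_compose_right rk)
      also have "\<dots> = scalar_op (of_real ((5/4) ^ k)) o\<^sub>L \<Phi> (rank_one \<eta> (r k \<zeta>))"
        unfolding comp rank_one_scaleR_right using lin rank_one_BH unfolding linear_map_def by blast
      also have "\<Phi> (rank_one \<eta> (r k \<zeta>)) = G o\<^sub>L r k"
        unfolding G_def \<Phi>_commutant_right[OF \<Phi> r(2) rank_one_BH, symmetric] by (simp add: rank_one_compose_right rk)
      finally have "(G' o\<^sub>L r k) x = (scalar_op (of_real ((5/4) ^ k)) o\<^sub>L (G o\<^sub>L r k)) x" by simp
      then show ?thesis by (simp only: blinfun_apply_blinfun_compose scalar_op_apply scaleC_of_real)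
    qed
    \<comment> \<open>On the range of \<open>r k\<close>, G' is (5/4)^k times G, and G is bounded
      below there since that range lies in the range of q.\<close>
    have big: "(25/16) ^ k * \<delta> \<le> (norm G')\<^sup>2" for k
    proof -
      obtain w where "r k w \<noteq> 0" using r(3)[of k] by (metis blinfun_eqI zero_blinfun.rep_eq)
      define x where "x = r k w"
      have x: "x \<noteq> 0" "r k x = x" "q x = x" using \<open>r k w \<noteq> 0\<close> is_projectionD(4)[OF r(1)] r(4) by (auto simp: x_def)
      have "((25/16) ^ k * \<delta>) * (norm x)\<^sup>2 \<le> (25/16) ^ k * (norm (G x))\<^sup>2"
        using lower[OF x(3)] by (simp add: mult.assoc)
      also have "\<dots> = (norm (G' x))\<^sup>2"
        using GG[of k x] x(2) by (simp add: power_mult_distrib power_mult[symmetric] mult.commute[of k])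
          (simp add: power_mult power2_eq_square)
      also have "\<dots> \<le> (norm G')\<^sup>2 * (norm x)\<^sup>2"
        using power_mono[OF norm_blinfun[of G' x] norm_ge_zero, of 2] by (simp add: power_mult_distrib)
      finally show ?thesis using x(1) by simp
    qed
    obtain k where "(norm G')\<^sup>2 / \<delta> < (25/16) ^ k" using real_arch_pow[of "25/16"] by auto
    then show False using big[of k] \<delta> by (simp add: field_simps)
  qed
  then obtain e where "minimal_in (commutant M) e" by blast
  then show ?thesis using N.minimal_commutant bicommutant by metis
qed

section \<open>A sequential criterion for normality\<close>

lemma norm_rank_one: "norm (rank_one x y) \<le> norm x * norm y"
proof (rule norm_blinfun_bound)
  fix z
  have "norm (rank_one x y z) = cmod (cinner z y) * norm x" by (simp add: rank_one_apply norm_scaleC)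
  also have "\<dots> \<le> (norm z * norm y) * norm x" by (intro mult_right_mono norm_cinner_le) simp
  finally show "norm (rank_one x y z) \<le> norm x * norm y * norm z" by (simp add: mult_ac)
qed simp

lemma positive_opD:
  assumes "positive_op D"
  shows "D \<in> BH" "cinner (D x) y = cinner x (D y)" "0 \<le> inner (D x) x"
  using assms adj_right[of D x y] by (auto simp: positive_op_def)

context onb
begin

text \<open>With G the square root of D, the trace bound says that the vectors
  \<open>G (e n)\<close> are square-summable. The functional that they define is A \<mapsto> trace
  of G A G.\<close>

lemma positive_trace_class_functional:
  assumes D: "positive_op D" and tr: "\<And>N. (\<Sum>n<N. inner (D (e n)) (e n)) \<le> C"
  shows "\<exists>g. continuous_map sigma_weak euclidean g \<and> (\<forall>A B. g (A + B) = g A + g B) \<and>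
    (\<forall>x y. g (rank_one x y) = cinner (blinfun_apply D x) y)"
proof -
  obtain G where G: "positive_op G" "G o\<^sub>L G = D" using positive_sqrt[OF D] by blast
  have GG: "G (G x) = D x" for x using G(2) by (metis blinfun_apply_blinfun_compose)
  have nG: "(norm (G x))\<^sup>2 = inner (D x) x" for x
  proof -
    have "cinner (G x) (G x) = cinner (D x) x" using positive_opD(2)[OF G(1), of "G x" x] by (simp add: GG)
    then show ?thesis by (simp add: inner_eq_Re_cinner Re_cinner_self[symmetric])
  qed
  have ss: "square_summable (\<lambda>n. G (e n))"
    unfolding square_summable_def nG using tr by (intro summableI_nonneg_bounded positive_opD(3)[OF D])
  let ?g = "sigma_weak_functional (\<lambda>n. G (e n)) (\<lambda>n. G (e n))"
  have "?g (rank_one x y) = cinner (D x) y" for x y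
  proof -
    have "(\<lambda>n. cinner (rank_one x y (G (e n))) (G (e n))) = (\<lambda>n. cinner (G x) (e n) * cinner (e n) (G y))"
      by (simp add: rank_one_apply cinner_scaleC_left positive_opD(2)[OF G(1)] mult.commute)
    moreover have "(\<lambda>n. cinner (G x) (e n) * cinner (e n) (G y)) sums cinner (G x) (G y)" by (rule parseval_inner)
    ultimately show ?thesis
      unfolding sigma_weak_functional_def by (simp add: sums_iff positive_opD(2)[OF G(1), symmetric] GG)
  qed
  then show ?thesis using continuous_swf[OF ss ss] swf_add[OF ss ss] by (intro exI[of _ ?g]) simp
qed

lemma compose_P: "T \<in> BH \<Longrightarrow> T o\<^sub>L P N = (\<Sum>n<N. rank_one (T (e n)) (e n))"
  by (rule blinfun_eqI) (simp add: P_def blinfun.sum_left blinfun.sum_right rank_one_apply BH_apply)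

lemma P_compose: "T \<in> BH \<Longrightarrow> P N o\<^sub>L T = (\<Sum>n<N. rank_one (e n) (adj T (e n)))"
  by (rule blinfun_eqI) (simp add: P_def blinfun.sum_left rank_one_apply adj_right)

lemma norm_compose_P: "norm (T o\<^sub>L P N) \<le> norm T" and norm_P_compose: "norm (P N o\<^sub>L T) \<le> norm T"
proof -
  show "norm (T o\<^sub>L P N) \<le> norm T"
    using order_trans[OF norm_blinfun_compose[of T "P N"] mult_left_mono[OF norm_P_le norm_ge_zero]] by simp
  show "norm (P N o\<^sub>L T) \<le> norm T"
    using order_trans[OF norm_blinfun_compose[of "P N" T] mult_right_mono[OF norm_P_le norm_ge_zero]] by simp
qed

text \<open>
  The functional is given by an operator \<open>\<rho>\<close> on rank-one operators. Boundedness makes the positive and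
  negative parts of the real and imaginary parts of \<open>\<rho>\<close> trace class, and the continuity assumption
  shows that the functional is determined by \<open>\<rho>\<close>.
\<close>

lemma sequentially_continuous_functional_normal:
  fixes f :: "('h \<Rightarrow>\<^sub>L 'h) \<Rightarrow> complex"
  assumes add: "\<And>A B. A \<in> BH \<Longrightarrow> B \<in> BH \<Longrightarrow> f (A + B) = f A + f B"
    and scal: "\<And>c A. A \<in> BH \<Longrightarrow> f (scalar_op c o\<^sub>L A) = c * f A"
    and bd: "\<And>A. A \<in> BH \<Longrightarrow> cmod (f A) \<le> C * norm A"
    and cont: "\<And>T S K. (\<And>k::nat. T k \<in> BH) \<Longrightarrow> S \<in> BH \<Longrightarrow> (\<And>k. norm (T k) \<le> K) \<Longrightarrow>
      (\<And>x. (\<lambda>k. T k x) \<longlonglongrightarrow> blinfun_apply S x) \<Longrightarrow> (\<lambda>k. f (T k)) \<longlonglongrightarrow> f S"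
  shows "continuous_map sigma_weak euclidean f"
proof -
  have fsum: "f (\<Sum>n<N. A n) = (\<Sum>n<N. f (A n))" if "\<And>n. A n \<in> BH" for A and N :: nat
  proof (induction N)
    case 0
    show ?case using add[OF BH_zero BH_zero] by simp
  next
    case (Suc N)
    then show ?case using add[OF BH_sum that, of "{..<N}" "\<lambda>n. A n"] that by simp
  qed
  have "\<exists>\<rho>\<in>BH. \<forall>x y. cinner (blinfun_apply \<rho> x) y = f (rank_one x y)"
  proof (rule sesquilinear_operator[where K = "\<bar>C\<bar>"])
    fix x x' y y' :: 'h and c
    have "rank_one (x + x') y = rank_one x y + rank_one x' y"
      by (rule blinfun_eqI) (simp add: rank_one_apply blinfun.add_left scaleC_add_right)
    then show "f (rank_one (x + x') y) = f (rank_one x y) + f (rank_one x' y)" by (simp add: add rank_one_BH)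
    have "rank_one x (y + y') = rank_one x y + rank_one x y'"
      by (rule blinfun_eqI) (simp add: rank_one_apply blinfun.add_left cinner_add_right scaleC_add_left)
    then show "f (rank_one x (y + y')) = f (rank_one x y) + f (rank_one x y')" by (simp add: add rank_one_BH)
    have "rank_one (scaleC c x) y = scalar_op c o\<^sub>L rank_one x y"
      by (rule blinfun_eqI) (simp add: rank_one_apply scalar_op_apply scaleC_scaleC mult.commute)
    then show "f (rank_one (scaleC c x) y) = c * f (rank_one x y)" by (simp add: scal rank_one_BH)
    have "rank_one x (scaleC c y) = scalar_op (cnj c) o\<^sub>L rank_one x y"
      by (rule blinfun_eqI) (simp add: rank_one_apply scalar_op_apply scaleC_scaleC cinner_scaleC_right)
    then show "f (rank_one x (scaleC c y)) = cnj c * f (rank_one x y)" by (simp add: scal rank_one_BH)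
    have "cmod (f (rank_one x y)) \<le> \<bar>C\<bar> * norm (rank_one x y)"
      by (rule order_trans[OF bd[OF rank_one_BH]]) (simp add: mult_right_mono)
    also have "\<dots> \<le> \<bar>C\<bar> * (norm x * norm y)" by (intro mult_left_mono norm_rank_one) simp
    finally show "cmod (f (rank_one x y)) \<le> \<bar>C\<bar> * norm x * norm y" by (simp add: mult.assoc)
  qed
  then obtain \<rho> where \<rho>: "\<rho> \<in> BH" "\<And>x y. cinner (\<rho> x) y = f (rank_one x y)" by blast
  \<comment> \<open>The real part of c \<rho>: the choices 1 and -\<i> of c give the real and the
    imaginary part of \<rho>.\<close>
  define D where "D c = (1/2) *\<^sub>R ((scalar_op c o\<^sub>L \<rho>) + adj (scalar_op c o\<^sub>L \<rho>))" for c
  have cr: "scalar_op c o\<^sub>L \<rho> \<in> BH" for c by (intro BH_intros \<rho>)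
  have D: "D c \<in> BH" "adj (D c) = D c" for c
    unfolding D_def by (auto intro!: BH_intros cr \<rho> simp: adj_scaleR adj_add adj_adj BH_intros cr \<rho> add.commute)
  have Dform: "cinner (D c x) y = (1/2) * (c * cinner (\<rho> x) y + cnj (c * cinner (\<rho> y) x))" for c x y
  proof -
    have "cinner (adj (scalar_op c o\<^sub>L \<rho>) x) y = cnj (c * cinner (\<rho> y) x)"
      by (simp add: adj_left[OF cr] scalar_op_apply cinner_scaleC_right cinner_commute[of x "\<rho> y"])
    then show ?thesis
      by (simp add: D_def blinfun.scaleR_left blinfun.add_left cinner.scaleR_left cinner_add_left scalar_op_apply
          cinner_scaleC_left scaleR_conv_of_real)
  qed
  \<comment> \<open>One statement for both signs: q cuts out a part where the form of
    \<open>D c\<close> is nonnegative, and the negative part is the same for \<open>- c\<close> and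
    the complementary projection.\<close>
  have part: "\<exists>g. continuous_map sigma_weak euclidean g \<and> (\<forall>A B. g (A + B) = g A + g B) \<and>
    (\<forall>x y. g (rank_one x y) = cinner (D c (q x)) y)"
    if c: "cmod c = 1" and q: "is_projection q" and comm: "\<And>x. q (D c x) = D c (q x)"
      and pos: "\<And>x. 0 \<le> inner (D c (q x)) (q x)" for c q
  proof -
    note qD = is_projectionD[OF q]
    have move: "cinner (D c (q x)) y = cinner (D c x) (q y)" for x y by (simp add: comm[symmetric] qD)
    have "adj (D c o\<^sub>L q) = D c o\<^sub>L q"
      by (simp add: adj_compose D qD) (rule blinfun_eqI, simp add: comm)
    moreover have "0 \<le> inner (D c (q x)) x" for x
      using pos[of x] move[of "q x" x] by (simp add: inner_eq_Re_cinner qD)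
    ultimately have Dq: "positive_op (D c o\<^sub>L q)" unfolding positive_op_def by (simp add: BH_intros D qD)
    have "(\<Sum>n<N. inner ((D c o\<^sub>L q) (e n)) (e n)) \<le> \<bar>C\<bar>" for N
    proof -
      have nq: "norm q \<le> 1" by (rule norm_blinfun_bound) (simp_all add: qD)
      have fb: "cmod (f A) \<le> \<bar>C\<bar>" if "A \<in> BH" "norm A \<le> norm q" for A
      proof -
        have "cmod (f A) \<le> \<bar>C\<bar> * norm A" by (rule order_trans[OF bd[OF that(1)]]) (simp add: mult_right_mono)
        also have "\<dots> \<le> \<bar>C\<bar> * 1" using that nq by (intro mult_left_mono) auto
        finally show ?thesis by simp
      qed
      \<comment> \<open>A partial trace is made of the values of f at the contractions
        \<open>P N o\<^sub>L q\<close> and \<open>q o\<^sub>L P N\<close>, so the bound on f is a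
        bound on the trace.\<close>
      have "(\<Sum>n<N. cinner (D c (q (e n))) (e n)) =
          (\<Sum>n<N. (1/2) * (c * f (rank_one (e n) (q (e n))) + cnj (c * f (rank_one (q (e n)) (e n)))))"
        unfolding move by (simp only: Dform \<rho>(2))
      also have "\<dots> = (1/2) * (c * f (P N o\<^sub>L q) + cnj (c * f (q o\<^sub>L P N)))"
        unfolding compose_P[OF qD(1)] P_compose[OF qD(1)] qD(3)
        by (simp only: fsum[OF rank_one_BH] sum_distrib_left[symmetric] sum.distrib cnj_sum[symmetric])
      finally have eq: "(\<Sum>n<N. cinner (D c (q (e n))) (e n)) = (1/2) * (c * f (P N o\<^sub>L q) + cnj (c * f (q o\<^sub>L P N)))" .
      have "(\<Sum>n<N. inner ((D c o\<^sub>L q) (e n)) (e n)) = Re (\<Sum>n<N. cinner (D c (q (e n))) (e n))"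
        by (simp add: inner_eq_Re_cinner)
      also have "\<dots> \<le> cmod (\<Sum>n<N. cinner (D c (q (e n))) (e n))" by (rule complex_Re_le_cmod)
      also have "\<dots> = (1/2) * cmod (c * f (P N o\<^sub>L q) + cnj (c * f (q o\<^sub>L P N)))"
        unfolding eq by (simp add: norm_mult)
      also have "\<dots> \<le> (1/2) * (cmod (f (P N o\<^sub>L q)) + cmod (f (q o\<^sub>L P N)))"
        using norm_triangle_ineq[of "c * f (P N o\<^sub>L q)" "cnj (c * f (q o\<^sub>L P N))"] c by (simp add: norm_mult)
      also have "\<dots> \<le> (1/2) * (\<bar>C\<bar> + \<bar>C\<bar>)"
        by (intro mult_left_mono add_mono fb BH_compose P.BH qD norm_compose_P norm_P_compose) simp
      finally show ?thesis by simp
    qed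
    from positive_trace_class_functional[OF Dq this] show ?thesis by simp
  qed
  have herm: "\<exists>g. continuous_map sigma_weak euclidean g \<and> (\<forall>A B. g (A + B) = g A + g B) \<and>
    (\<forall>x y. g (rank_one x y) = cinner (D c x) y)" if c: "cmod c = 1" for c
  proof -
    obtain q where q: "is_projection q" "\<And>A. A\<in>BH \<Longrightarrow> A o\<^sub>L D c = D c o\<^sub>L A \<Longrightarrow> A o\<^sub>L q = q o\<^sub>L A"
      "\<And>x. 0 \<le> inner (D c (q x)) (q x)" "\<And>x. inner (D c (x - q x)) (x - q x) \<le> 0"
      using spectral_projection[OF D] by blast
    have comm: "q (D c x) = D c (q x)" for x
      using q(2)[OF D(1) refl] by (metis blinfun_apply_blinfun_compose)
    obtain g where g: "continuous_map sigma_weak euclidean g" "\<And>A B. g (A + B) = g A + g B"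
      "\<And>x y. g (rank_one x y) = cinner (D c (q x)) y" using part[OF c q(1) comm q(3)] by blast
    let ?q = "id_blinfun - q"
    have Dm: "D (- c) x = - D c x" for x
      by (rule cinner_eqI) (simp add: Dform cinner.minus_left field_simps)
    have "?q (D (- c) x) = D (- c) (?q x)" for x
      by (simp add: Dm blinfun.diff_left blinfun.diff_right blinfun.minus_right comm)
    moreover have "0 \<le> inner (D (- c) (?q x)) (?q x)" for x
      using q(4)[of x] by (simp add: Dm blinfun.diff_left)
    ultimately obtain h where h: "continuous_map sigma_weak euclidean h" "\<And>A B. h (A + B) = h A + h B"
      "\<And>x y. h (rank_one x y) = cinner (D (- c) (?q x)) y"
      using part[of "- c" ?q] c is_projection_compl[OF q(1)] by force
    have "g (rank_one x y) - h (rank_one x y) = cinner (D c x) y" for x y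
      by (simp add: g h Dm blinfun.diff_left blinfun.diff_right cinner.diff_left cinner.minus_left)
    then show ?thesis using g h continuous_map_diff[OF g(1) h(1)]
      by (intro exI[of _ "\<lambda>A. g A - h A"]) simp
  qed
  obtain g1 where g1: "continuous_map sigma_weak euclidean g1" "\<And>A B. g1 (A + B) = g1 A + g1 B"
    "\<And>x y. g1 (rank_one x y) = cinner (D 1 x) y" using herm[of 1] by force
  obtain g2 where g2: "continuous_map sigma_weak euclidean g2" "\<And>A B. g2 (A + B) = g2 A + g2 B"
    "\<And>x y. g2 (rank_one x y) = cinner (D (- \<i>) x) y" using herm[of "- \<i>"] by force
  \<comment> \<open>This is g1 + \<i> g2, matching \<rho> as its real part plus \<i> times its
    imaginary part.\<close>
  define g where "g A = g1 A - g2 A * (- \<i>)" for A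
  have gc: "continuous_map sigma_weak euclidean g"
    unfolding g_def by (intro continuous_map_diff continuous_map_mult_const g1 g2)
  have ga: "g (A + B) = g A + g B" for A B by (simp add: g_def g1 g2 algebra_simps)
  have gr: "g (rank_one x y) = f (rank_one x y)" for x y
    unfolding \<rho>(2)[symmetric] by (simp add: g_def g1 g2 Dform field_simps)
  have gsum: "g (\<Sum>n<N. A n) = (\<Sum>n<N. g (A n))" for A and N :: nat
  proof (induction N)
    case 0
    show ?case using ga[of 0 0] by simp
  qed (simp add: ga)
  have "f T = g T" if T: "T \<in> BH" for T
  proof -
    \<comment> \<open>f and g agree on the finite-rank operators \<open>T o\<^sub>L P N\<close>,
      which tend strongly and boundedly to T; f passes to the limit by \<open>cont\<close>, g by its
      sigma-weak continuity.\<close>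
    have TP: "T o\<^sub>L P N \<in> BH" for N by (intro BH_compose T P.BH)
    have lim: "(\<lambda>N. (T o\<^sub>L P N) x) \<longlonglongrightarrow> T x" for x
      by (simp add: blinfun.tendsto[OF tendsto_const P.lim])
    have "(\<lambda>N. f (T o\<^sub>L P N)) \<longlonglongrightarrow> f T" by (rule cont[OF TP T norm_compose_P lim])
    moreover have "(\<lambda>N. g (T o\<^sub>L P N)) \<longlonglongrightarrow> g T"
      by (rule continuous_map_sigma_weak_tendsto[OF gc TP T norm_compose_P lim])
    moreover have "f (T o\<^sub>L P N) = g (T o\<^sub>L P N)" for N
      unfolding compose_P[OF T] by (simp add: fsum gsum rank_one_BH gr)
    ultimately show ?thesis using LIMSEQ_unique by simp
  qed
  then show ?thesis using gc by (intro continuous_map_eq[OF gc]) (simp add: topspace_sigma_weak)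
qed

text \<open>The criterion for functionals is applied to each sigma-weak functional after
  \<open>\<Phi>\<close>. The limit is taken termwise in the series, with a majorant from the norm
  bound.\<close>

lemma sequentially_continuous_map_normal:
  assumes lin: "linear_map BH \<Phi>" and bd: "\<And>A. A \<in> BH \<Longrightarrow> norm (\<Phi> A) \<le> C * norm A" and C: "C \<ge> 0"
    and cont: "\<And>T S K x y. (\<And>k::nat. T k \<in> BH) \<Longrightarrow> S \<in> BH \<Longrightarrow> (\<And>k. norm (T k) \<le> K) \<Longrightarrow>
      (\<And>x. (\<lambda>k. T k x) \<longlonglongrightarrow> blinfun_apply S x) \<Longrightarrow>
      (\<lambda>k. cinner (blinfun_apply (\<Phi> (T k)) x) y) \<longlonglongrightarrow> cinner (blinfun_apply (\<Phi> S) x) (y :: 'h)"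
  shows "normal_map BH \<Phi>"
proof (rule normal_mapI)
  show im: "\<Phi> A \<in> BH" if "A \<in> BH" for A using lin that unfolding linear_map_def by blast
  fix x y :: "nat \<Rightarrow> 'h" assume xy: "square_summable x" "square_summable y"
  let ?m = "\<lambda>n. (norm (x n))\<^sup>2 + (norm (y n))\<^sup>2"
  have sm: "summable ?m" using xy by (simp add: square_summable_def summable_add)
  have term_le: "norm (cinner (\<Phi> A (x n)) (y n)) \<le> (C * norm A) * ?m n" if A: "A \<in> BH" for A n
  proof -
    have "norm (cinner (\<Phi> A (x n)) (y n)) \<le> norm (\<Phi> A (x n)) * norm (y n)" by (rule norm_cinner_le)
    also have "\<dots> \<le> (norm (\<Phi> A) * norm (x n)) * norm (y n)" by (intro mult_right_mono norm_blinfun) simp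
    also have "\<dots> \<le> ((C * norm A) * norm (x n)) * norm (y n)" by (intro mult_right_mono bd[OF A]) simp_all
    also have "\<dots> = (C * norm A) * (norm (x n) * norm (y n))" by simp
    also have "\<dots> \<le> (C * norm A) * ?m n"
      using norm_mult_le_squares[of 1 "x n" "y n"] C by (intro mult_left_mono) simp_all
    finally show ?thesis .
  qed
  have "continuous_map sigma_weak euclidean (\<lambda>A. sigma_weak_functional x y (\<Phi> A))"
  proof (rule sequentially_continuous_functional_normal[where C = "C * suminf ?m"])
    show "sigma_weak_functional x y (\<Phi> (A + B)) = sigma_weak_functional x y (\<Phi> A) + sigma_weak_functional x y (\<Phi> B)"
      if "A \<in> BH" "B \<in> BH" for A B using lin that unfolding linear_map_def by (simp add: swf_add[OF xy])
    show "sigma_weak_functional x y (\<Phi> (scalar_op c o\<^sub>L A)) = c * sigma_weak_functional x y (\<Phi> A)" if "A \<in> BH" for c A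
      using lin that unfolding linear_map_def by (simp add: swf_scalar[OF xy])
    show "cmod (sigma_weak_functional x y (\<Phi> A)) \<le> C * suminf ?m * norm A" if A: "A \<in> BH" for A
    proof -
      have "cmod (sigma_weak_functional x y (\<Phi> A)) \<le> (\<Sum>n. norm (cinner (\<Phi> A (x n)) (y n)))"
        unfolding sigma_weak_functional_def by (rule summable_norm[OF swf_summable_norm[OF xy]])
      also have "\<dots> \<le> (\<Sum>n. (C * norm A) * ?m n)"
        by (intro suminf_le swf_summable_norm[OF xy] summable_mult sm term_le A)
      also have "\<dots> = (C * norm A) * suminf ?m" by (rule suminf_mult[OF sm])
      finally show ?thesis by (simp add: mult_ac)
    qed
    fix T :: "nat \<Rightarrow> ('h \<Rightarrow>\<^sub>L 'h)" and S K
    assume T: "\<And>k. T k \<in> BH" "S \<in> BH" "\<And>k. norm (T k) \<le> K" "\<And>x. (\<lambda>k. T k x) \<longlonglongrightarrow> blinfun_apply S x"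
    show "(\<lambda>k. sigma_weak_functional x y (\<Phi> (T k))) \<longlonglongrightarrow> sigma_weak_functional x y (\<Phi> S)"
      unfolding sigma_weak_functional_def
    proof (rule conjunct2[OF conjunct2[OF tannerys_theorem]])
      show "(\<lambda>k. cinner (\<Phi> (T k) (x n)) (y n)) \<longlonglongrightarrow> cinner (\<Phi> S (x n)) (y n)" for n by (rule cont[OF T])
      show "summable (\<lambda>n. (C * K) * ?m n)" by (rule summable_mult[OF sm])
      have "norm (cinner (\<Phi> (T k) (x n)) (y n)) \<le> (C * K) * ?m n" for k n
        by (rule order_trans[OF term_le[OF T(1)]]) (intro mult_right_mono mult_left_mono T(3) C; simp)
      then show "\<forall>\<^sub>F (n, k) in sequentially \<times>\<^sub>F sequentially. norm (cinner (\<Phi> (T k) (x n)) (y n)) \<le> (C * K) * ?m n"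
        by (intro always_eventually) auto
    qed simp
  qed
  then show "continuous_map (subtopology sigma_weak BH) euclidean (\<lambda>A. sigma_weak_functional x y (\<Phi> A))"
    by (rule continuous_map_from_subtopology)
qed simp

end

section \<open>Matrix units from a minimal projection\<close>

text \<open>In contrast to \<open>convergent_of_dense\<close> the limit is identified: that lemma is
  applied to \<open>T n - S\<close>, and the limit found there has arbitrarily small norm.\<close>

lemma tendsto_of_dense:
  fixes T :: "nat \<Rightarrow> ('h::complex_hilbert \<Rightarrow>\<^sub>L 'h)"
  assumes bd: "\<And>n. norm (T n) \<le> C" and S: "norm S \<le> C"
    and dense: "\<And>e. e > 0 \<Longrightarrow> \<exists>w. norm (x - w) < e \<and> (\<lambda>n. T n w) \<longlonglongrightarrow> blinfun_apply S w"
  shows "(\<lambda>n. T n x) \<longlonglongrightarrow> S x"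
proof -
  have "convergent (\<lambda>n. (T n - S) x)"
  proof (rule convergent_of_dense)
    show "norm (T n - S) \<le> C + C" for n
      using norm_triangle_ineq4[of "T n" S] bd[of n] S by linarith
    fix e :: real assume "e > 0"
    then obtain w where w: "norm (x - w) < e" "(\<lambda>n. T n w) \<longlonglongrightarrow> S w" using dense by blast
    have "(\<lambda>n. (T n - S) w) \<longlonglongrightarrow> S w - S w" unfolding blinfun.diff_left by (intro tendsto_diff w tendsto_const)
    then show "\<exists>w. norm (x - w) < e \<and> convergent (\<lambda>n. (T n - S) w)" using w(1) convergentI by blast
  qed
  then obtain l where l: "(\<lambda>n. (T n - S) x) \<longlonglongrightarrow> l" unfolding convergent_def by blast
  have "norm l \<le> e" if e: "e > 0" for e
  proof -
    have C: "C \<ge> 0" by (rule order_trans[OF norm_ge_zero S])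
    define d where "d = e / (C + C + 1)"
    have d: "d > 0" using e C by (simp add: d_def)
    obtain w where w: "norm (x - w) < d" "(\<lambda>n. T n w) \<longlonglongrightarrow> S w" using dense[OF d] by blast
    have "(\<lambda>n. (T n - S) (x - w)) \<longlonglongrightarrow> l - (S w - S w)"
      unfolding blinfun.diff_right[of _ x w] by (intro tendsto_diff l) (simp add: blinfun.diff_left LIM_zero[OF w(2)])
    then have "(\<lambda>n. norm ((T n - S) (x - w))) \<longlonglongrightarrow> norm l" by (intro tendsto_norm) simp
    then show ?thesis
    proof (rule LIMSEQ_le_const2, intro exI allI impI)
      fix n
      have "norm ((T n - S) (x - w)) \<le> norm (T n - S) * norm (x - w)" by (rule norm_blinfun)
      also have "\<dots> \<le> (C + C + 1) * d"
        using norm_triangle_ineq4[of "T n" S] bd[of n] S w(1) C by (intro mult_mono) auto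
      also have "\<dots> = e" using C by (simp add: d_def)
      finally show "norm ((T n - S) (x - w)) \<le> e" .
    qed
  qed
  then have "norm l \<le> 0 + e" if "e > 0" for e using that by simp
  then have "norm l \<le> 0" by (rule field_le_epsilon)
  then have "l = 0" by simp
  then have "(\<lambda>n. T n x - S x) \<longlonglongrightarrow> 0" using l by (simp add: blinfun.diff_left)
  then show ?thesis by (rule LIM_zero_cancel)
qed

text \<open>Orthonormalizing M \<zeta> gives vectors \<open>k n = a n \<zeta>\<close>, and
  \<open>u n = a n o\<^sub>L e\<close> inherits their relations, because an element of the corner of
  e is determined by its vector state at \<zeta>. Zero vectors give zero units.\<close>

lemma (in vN_factor) matrix_units_exist:
  assumes sep: "separable_space (euclidean :: 'h topology)" and e: "minimal_in M e"
  shows "\<exists>u :: nat \<Rightarrow> 'h \<Rightarrow>\<^sub>L 'h. (\<forall>n. u n \<in> M) \<and> (\<forall>n x. u n (e x) = u n x) \<and>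
    (\<forall>m n x. m \<noteq> n \<longrightarrow> adj (u n) (u m x) = 0) \<and> (\<forall>n. u n = 0 \<or> (\<forall>x. adj (u n) (u n x) = e x)) \<and>
    (\<forall>x. (\<forall>n. adj (u n) x = 0) \<longrightarrow> x = 0)"
proof -
  have e': "is_projection e" "e \<in> M" "e \<noteq> 0" "\<And>A. A \<in> M \<Longrightarrow> \<exists>c. e o\<^sub>L A o\<^sub>L e = scalar_op c o\<^sub>L e"
    using e by (auto simp: minimal_in_def)
  note eD = is_projectionD[OF e'(1)]
  obtain w where w: "e w \<noteq> 0" using e'(3) by (metis blinfun_eqI zero_blinfun.rep_eq)
  define \<zeta> where "\<zeta> = e w /\<^sub>R norm (e w)"
  have \<zeta>: "e \<zeta> = \<zeta>" "norm \<zeta> = 1" using w by (simp_all add: \<zeta>_def blinfun.scaleR_right eD)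
  have sandwich: "e (A (e x)) = scaleC (cinner (A \<zeta>) \<zeta>) (e x)" if A: "A \<in> M" for A x
  proof -
    obtain c where "e o\<^sub>L A o\<^sub>L e = scalar_op c o\<^sub>L e" using e'(4)[OF A] by blast
    then have c: "e (A (e x)) = scaleC c (e x)" for x by (metis blinfun_apply_blinfun_compose scalar_op_apply)
    have "cinner (A \<zeta>) \<zeta> = cinner (e (A (e \<zeta>))) \<zeta>" by (simp add: \<zeta> eD(5))
    also have "\<dots> = c" unfolding c by (simp add: \<zeta> cinner_scaleC_left cinner_self)
    finally show ?thesis using c by simp
  qed
  define L where "L = (\<lambda>B. blinfun_apply B \<zeta>) ` M"
  have L: "csubspace L" unfolding L_def by (rule csubspace_orbit)
  from orthonormal_sequence[OF sep L] obtain k :: "nat \<Rightarrow> 'h" where k: "\<forall>n. k n \<in> L" "\<forall>n. k n = 0 \<or> norm (k n) = 1"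
    "\<forall>m n. m \<noteq> n \<longrightarrow> cinner (k m) (k n) = 0" "\<forall>x. (\<forall>n. cinner (k n) x = 0) \<longrightarrow> (\<forall>y\<in>L. cinner y x = 0)" by blast
  have "\<forall>n. \<exists>A. A \<in> M \<and> k n = A \<zeta>" using k(1) by (auto simp: L_def)
  from choice[OF this] obtain a where a: "\<And>n. a n \<in> M" "\<And>n. k n = blinfun_apply (a n) \<zeta>" by blast
  define u where "u n = a n o\<^sub>L e" for n
  have uM: "u n \<in> M" for n unfolding u_def by (intro comp a e')
  have uz: "u n \<zeta> = k n" for n by (simp add: u_def \<zeta> a)
  have uadj: "adj (u n) x = e (adj (a n) x)" for n x
    by (simp add: u_def adj_compose BH[OF a(1)] eD)
  have uu: "adj (u n) (u m x) = scaleC (cinner (k m) (k n)) (e x)" for m n x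
  proof -
    have "e (((adj (a n)) o\<^sub>L a m) (e x)) = scaleC (cinner (((adj (a n)) o\<^sub>L a m) \<zeta>) \<zeta>) (e x)"
      by (rule sandwich) (intro comp adj a)
    then show ?thesis unfolding uadj by (simp add: u_def a(2) adj_left[OF BH[OF a(1)]])
  qed
  have "u n = 0 \<or> (\<forall>x. adj (u n) (u n x) = e x)" for n
  proof (cases "k n = 0")
    case True
    have "cinner (u n x) (u n x) = 0" for x
      using uu[of n n x] True by (simp add: adj_left[OF BH[OF uM], symmetric])
    then have "u n = 0" by (intro blinfun_eqI) (simp add: cinner_self_zero)
    then show ?thesis ..
  next
    case False
    then have "norm (k n) = 1" using k(2) by blast
    then have "cinner (k n) (k n) = 1" by (simp add: cinner_self)
    then show ?thesis using uu[of n n] by simp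
  qed
  moreover have "x = 0" if x: "\<And>n. adj (u n) x = 0" for x
  proof -
    \<comment> \<open>The projection r onto the common kernel lies in M. The aim is r B e = 0 for
      all B in M, which in a factor forces r = 0.\<close>
    define R where "R = {x. \<forall>n. adj (u n) x = 0}"
    have R: "csubspace R" unfolding csubspace_def R_def
      by (auto simp: blinfun.add_right BH_apply[OF adj_BH[OF BH[OF uM]]])
    have "R = (\<Inter>n. {x. adj (u n) x = 0})" by (auto simp: R_def)
    then have Rc: "closed R" by (auto intro: closed_kernel)
    define r where "r = proj_on R"
    have rM: "r \<in> M" unfolding r_def
    proof (rule proj_on_mem[OF R Rc])
      fix B x assume "B \<in> commutant M" "x \<in> R"
      then show "B x \<in> R" using commutes[OF adj[OF uM]] by (simp add: R_def)
    qed
    have rp: "is_projection r" unfolding r_def by (rule is_projection_proj_on[OF R Rc])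
    have rR: "adj (u n) (r y) = 0" for n y using proj_on_in[OF R Rc, of y] by (simp add: r_def R_def)
    have "r o\<^sub>L B o\<^sub>L e = 0" if B: "B \<in> M" for B
    proof -
      have v: "(r o\<^sub>L B) \<zeta> \<in> L" unfolding L_def using comp[OF rM B] by blast
      \<comment> \<open>The vector \<open>r (B \<zeta>)\<close> lies in M \<zeta> and is orthogonal
        to all \<open>k n\<close>, hence is zero.\<close>
      have "cinner (k n) ((r o\<^sub>L B) \<zeta>) = 0" for n
        unfolding uz[symmetric] by (simp add: adj_right[OF BH[OF uM]] rR)
      then have "cinner ((r o\<^sub>L B) \<zeta>) ((r o\<^sub>L B) \<zeta>) = 0" using k(4) v by blast
      then have z: "r (B \<zeta>) = 0" by (simp add: cinner_self_zero)
      \<comment> \<open>Vanishing at \<zeta> makes the corner scalar of this operator zero, which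
        spreads the conclusion from \<zeta> to the whole range of e.\<close>
      have "e (((adj B) o\<^sub>L (r o\<^sub>L B)) (e x)) = 0" for x
        using sandwich[OF comp[OF adj[OF B] comp[OF rM B]], of x] z by simp
      then have ez: "e (adj B (r (B (e x)))) = 0" for x by simp
      have "cinner (r (B (e x))) (r (B (e x))) = cinner (e (adj B (r (B (e x))))) x" for x
        by (simp add: is_projectionD(4,5)[OF rp] eD(5) adj_left[OF BH[OF B]])
      then have "r (B (e x)) = 0" for x using ez[of x] cinner_self_zero by force
      then show ?thesis by (intro blinfun_eqI) simp
    qed
    then have "r = 0" using product_zero[OF rM e'(2)] e'(3) by blast
    moreover have "r x = x" unfolding r_def by (rule proj_on_id[OF R Rc]) (simp add: R_def x)
    ultimately show ?thesis by simp
  qed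
  moreover have "adj (u n) (u m x) = 0" if "m \<noteq> n" for m n x using k(3) that by (simp add: uu)
  moreover have "u n (e x) = u n x" for n x by (simp add: u_def eD)
  ultimately show ?thesis using uM by (intro exI[of _ u] conjI allI impI) simp_all
qed

text \<open>H splits into the ranges of the \<open>u n\<close>, each zero or a copy of the range of
  e. The units lie in the commutant, so that M acts alike on all copies and entries of operators can
  be realized in M.\<close>

locale matrix_units = vN_factor M for M :: "('h::complex_hilbert \<Rightarrow>\<^sub>L 'h) set" +
  fixes e :: "'h \<Rightarrow>\<^sub>L 'h" and u :: "nat \<Rightarrow> 'h \<Rightarrow>\<^sub>L 'h"
  assumes minimal_e: "minimal_in (commutant M) e"
    and u_mem: "u n \<in> commutant M"
    and ue: "u n (e x) = u n x"
    and u_orth: "m \<noteq> n \<Longrightarrow> adj (u n) (u m x) = 0"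
    and u_iso: "u n = 0 \<or> (\<forall>x. adj (u n) (u n x) = e x)"
    and u_total: "(\<And>n. adj (u n) x = 0) \<Longrightarrow> x = 0"
begin

sublocale N: vN "commutant M" by (rule vN_commutant)

abbreviation U :: "nat \<Rightarrow> 'h \<Rightarrow>\<^sub>L 'h" where "U n \<equiv> adj (u n)"

lemma e_proj: "is_projection e" and e_mem: "e \<in> commutant M"
  using minimal_e by (auto simp: minimal_in_def)

lemma U_mem: "U n \<in> commutant M" by (rule N.adj[OF u_mem])

lemma u_BH: "u n \<in> BH" and U_BH: "U n \<in> BH" and e_BH: "e \<in> BH"
  by (rule N.BH[OF u_mem], rule N.BH[OF U_mem], rule N.BH[OF e_mem])

lemma u_right: "cinner (u n x) y = cinner x (U n y)" and U_right: "cinner (U n x) y = cinner x (u n y)"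
  by (rule adj_right[OF u_BH], rule adj_left[OF u_BH])

lemma eU: "e (U n x) = U n x"
  by (rule cinner_eqI) (simp add: is_projectionD(5)[OF e_proj] U_right ue)

lemma uUu: "u n (U n (u n x)) = u n x"
  using u_iso[of n] by (elim disjE) (simp_all add: ue)

lemma uXUu: "u n (blinfun_apply X (U n (u n x))) = u n (X (e x))"
  using u_iso[of n] by (elim disjE) simp_all

lemma norm_u_le: "norm (u n x) \<le> norm x"
proof (cases "u n = 0")
  case False
  then have "cinner (u n x) (u n x) = cinner (e x) x" using u_iso[of n] by (simp add: u_right is_projectionD(5)[OF e_proj])
  also have "\<dots> = of_real ((norm (e x))\<^sup>2)" by (rule is_projectionD(7)[OF e_proj])
  finally have "(norm (u n x))\<^sup>2 = (norm (e x))\<^sup>2" unfolding cinner_self of_real_eq_iff .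
  then show ?thesis using is_projectionD(6)[OF e_proj, of x] by simp
qed simp

definition p :: "nat \<Rightarrow> 'h \<Rightarrow>\<^sub>L 'h" where "p n = u n o\<^sub>L U n"
definition Q :: "nat \<Rightarrow> 'h \<Rightarrow>\<^sub>L 'h" where "Q N = (\<Sum>n<N. p n)"

lemma p_proj: "is_projection (p n)"
  unfolding is_projection_def p_def
  by (intro conjI BH_compose u_BH U_BH blinfun_eqI[of "_ o\<^sub>L _"] adj_eqI) (simp_all add: uUu u_right U_right)

lemma norm_p: "norm (p n x) = norm (U n x)"
proof -
  have "of_real ((norm (p n x))\<^sup>2) = cinner (U n x) (U n x)"
    unfolding is_projectionD(7)[OF p_proj, symmetric] by (simp add: p_def u_right)
  then have "(norm (p n x))\<^sup>2 = (norm (U n x))\<^sup>2" unfolding cinner_self of_real_eq_iff .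
  then show ?thesis by simp
qed

lemma Q_filtration: "proj_filtration Q" and norm_Q: "(norm (Q N x))\<^sup>2 = (\<Sum>n<N. (norm (U n x))\<^sup>2)"
proof -
  have o: "p m (p n x) = 0" if "m \<noteq> n" for m n x using u_orth[of n m] that by (simp add: p_def)
  have t: "x = 0" if "\<And>n. p n x = 0" for x
    by (rule u_total) (metis norm_p norm_eq_zero that)
  note * = orthogonal_projections_filtration[of p, OF p_proj o t]
  show "proj_filtration Q" unfolding Q_def using *(1) by blast
  show "(norm (Q N x))\<^sup>2 = (\<Sum>n<N. (norm (U n x))\<^sup>2)"
    unfolding Q_def norm_p[symmetric] using *(2) by blast
qed

sublocale Q: proj_filtration Q by (rule Q_filtration)

lemma bessel: "(\<Sum>n<N. (norm (U n x))\<^sup>2) \<le> (norm x)\<^sup>2"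
  unfolding norm_Q[symmetric] by (intro power_mono is_projectionD(6)[OF Q.proj] norm_ge_zero)

lemma Q_apply: "Q N x = (\<Sum>n<N. u n (U n x))"
  by (simp add: Q_def p_def blinfun.sum_left)

lemma norm_U_le: "norm (U n x) \<le> norm x"
  unfolding norm_p[symmetric] by (rule is_projectionD(6)[OF p_proj])

lemma norm_sum_u: "(norm (\<Sum>k<N. u k (z k)))\<^sup>2 = (\<Sum>k<N. (norm (u k (z k)))\<^sup>2)"
proof (induction N)
  case (Suc N)
  have "cinner (\<Sum>k<N. u k (z k)) (u N (z N)) = 0"
    unfolding cinner.sum_left by (rule sum.neutral) (simp add: u_right u_orth)
  from norm_add_orthogonal[OF this] show ?case using Suc by simp
qed simp

lemma norm_sum_u_le: "(norm (\<Sum>k<N. u k (z k)))\<^sup>2 \<le> (\<Sum>k<N. (norm (z k))\<^sup>2)"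
  unfolding norm_sum_u by (intro sum_mono power_mono norm_u_le norm_ge_zero)

lemma U_Q: "U k (Q N x) = (if k < N then U k x else 0)"
proof -
  have UuU: "U k (u k (U k x)) = U k x" using u_iso[of k] eU[of k x] by (elim disjE) (simp_all add: adj_zero)
  have "U k (Q N x) = (\<Sum>n<N. if n = k then U k x else 0)"
    unfolding Q_apply blinfun.sum_right by (rule sum.cong) (auto simp: UuU u_orth)
  then show ?thesis by simp
qed

lemma Q_u: "Q N (u k x) = (if k < N then u k x else 0)"
proof -
  have "Q N (u k x) = (\<Sum>n<N. if n = k then u k x else 0)"
    unfolding Q_apply by (rule sum.cong) (auto simp: uUu u_orth)
  then show ?thesis by simp
qed

text \<open>The ranges of the \<open>u j\<close> span a dense subspace, so identities for entries
  may be checked on one copy at a time.\<close>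

lemma eq_on_units:
  assumes "\<And>j z. blinfun_apply S (u j z) = blinfun_apply T (u j z)"
  shows "S = T"
proof (rule blinfun_eqI)
  fix x
  have "S (Q N x) = T (Q N x)" for N by (simp add: Q_apply blinfun.sum_right assms)
  moreover have "(\<lambda>N. S (Q N x)) \<longlonglongrightarrow> S x" "(\<lambda>N. T (Q N x)) \<longlonglongrightarrow> T x"
    by (intro blinfun.tendsto tendsto_const Q.lim)+
  ultimately show "S x = T x" using LIMSEQ_unique by simp
qed

definition tau_sum :: "nat \<Rightarrow> ('h \<Rightarrow>\<^sub>L 'h) \<Rightarrow> ('h \<Rightarrow>\<^sub>L 'h)" where
  "tau_sum K X = (\<Sum>k<K. u k o\<^sub>L X o\<^sub>L U k)"

lemma tau_sum_apply: "tau_sum K X x = (\<Sum>k<K. u k (X (U k x)))"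
  by (simp add: tau_sum_def blinfun.sum_left)

text \<open>
  The space is the orthogonal sum of the ranges of the \<open>u k\<close>, which are copies of the range of \<open>e\<close>.
  Acting as \<open>X\<close> on each copy, \<open>tau X\<close> is the element of \<open>M\<close> with the same restriction to the range of \<open>e\<close>
  as \<open>X\<close>, if \<open>e X = X\<close>.
\<close>

definition tau :: "('h \<Rightarrow>\<^sub>L 'h) \<Rightarrow> ('h \<Rightarrow>\<^sub>L 'h)" where
  "tau X = (SOME S. S \<in> BH \<and> norm S \<le> norm X \<and> (\<forall>x. (\<lambda>K. tau_sum K X x) \<longlonglongrightarrow> blinfun_apply S x))"

text \<open>The truncations are compressions of each other by Q; orthogonality of the ranges and
  Bessel's inequality bound them by the norm of X.\<close>

lemma
  assumes X: "X \<in> BH"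
  shows tau_BH: "tau X \<in> BH" and norm_tau: "norm (tau X) \<le> norm X" and tau_lim: "(\<lambda>K. tau_sum K X x) \<longlonglongrightarrow> tau X x"
proof -
  have "\<exists>S\<in>BH. norm S \<le> norm X \<and> (\<forall>x. (\<lambda>K. tau_sum K X x) \<longlonglongrightarrow> blinfun_apply S x)"
  proof (rule Q.compression_limit)
    show "tau_sum K X \<in> BH" for K unfolding tau_sum_def by (intro BH_sum BH_compose u_BH U_BH X)
    show "norm (tau_sum K X) \<le> norm X" for K
    proof (rule norm_blinfun_bound)
      fix x
      have "(norm (tau_sum K X x))\<^sup>2 \<le> (\<Sum>k<K. (norm (X (U k x)))\<^sup>2)"
        unfolding tau_sum_apply by (rule norm_sum_u_le)
      also have "\<dots> \<le> (\<Sum>k<K. (norm X)\<^sup>2 * (norm (U k x))\<^sup>2)"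
        by (intro sum_mono) (simp add: power_mult_distrib[symmetric] power_mono norm_blinfun)
      also have "\<dots> \<le> (norm X)\<^sup>2 * (norm x)\<^sup>2"
        unfolding sum_distrib_left[symmetric] by (intro mult_left_mono bessel) simp
      finally have "(norm (tau_sum K X x))\<^sup>2 \<le> (norm X * norm x)\<^sup>2" by (simp add: power_mult_distrib)
      then show "norm (tau_sum K X x) \<le> norm X * norm x" by (rule power2_le_imp_le) simp
    qed simp
    fix m n :: nat and x assume mn: "m \<le> n"
    have "Q m (tau_sum n X (Q m x)) = (\<Sum>k<n. if k < m then u k (X (U k x)) else 0)"
      unfolding tau_sum_apply blinfun.sum_right by (rule sum.cong) (auto simp: Q_u U_Q)
    also have "\<dots> = (\<Sum>k<m. u k (X (U k x)))" by (rule sum.mono_neutral_cong_right) (use mn in auto)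
    finally show "Q m (tau_sum n X (Q m x)) = tau_sum m X x" by (simp add: tau_sum_apply)
  qed
  then have "\<exists>S. S \<in> BH \<and> norm S \<le> norm X \<and> (\<forall>x. (\<lambda>K. tau_sum K X x) \<longlonglongrightarrow> blinfun_apply S x)"
    by (simp only: Bex_def)
  then have "tau X \<in> BH \<and> norm (tau X) \<le> norm X \<and> (\<forall>x. (\<lambda>K. tau_sum K X x) \<longlonglongrightarrow> tau X x)"
    unfolding tau_def by (rule someI_ex)
  then show "tau X \<in> BH" "norm (tau X) \<le> norm X" "(\<lambda>K. tau_sum K X x) \<longlonglongrightarrow> tau X x" by simp_all
qed

lemma tau_u:
  assumes X: "X \<in> BH"
  shows "tau X (u j z) = u j (X (e z))"
proof (rule LIMSEQ_unique[OF tau_lim[OF X]])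
  have "tau_sum K X (u j z) = u j (X (e z))" if "j < K" for K
  proof -
    have "tau_sum K X (u j z) = (\<Sum>k<K. if k = j then u j (X (e z)) else 0)"
      unfolding tau_sum_apply by (rule sum.cong) (auto simp: uXUu u_orth)
    then show ?thesis using that by simp
  qed
  then show "(\<lambda>K. tau_sum K X (u j z)) \<longlonglongrightarrow> u j (X (e z))"
    by (intro tendsto_eventually eventually_sequentiallyI[of "Suc j"]) simp
qed

text \<open>\<open>U m o\<^sub>L A o\<^sub>L u n\<close> lies in the corner of e in the commutant,
  by \<open>eU\<close> and \<open>ue\<close>, and that corner is scalar.\<close>

lemma coefficient:
  assumes A: "A \<in> commutant M"
  shows "\<exists>c. \<forall>x. U m (A (u n x)) = scaleC c (e x)"
proof -
  obtain c where "e o\<^sub>L (U m o\<^sub>L A o\<^sub>L u n) o\<^sub>L e = scalar_op c o\<^sub>L e"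
    using minimal_e N.comp[OF N.comp[OF U_mem A] u_mem] unfolding minimal_in_def by blast
  then have "(e o\<^sub>L (U m o\<^sub>L A o\<^sub>L u n) o\<^sub>L e) x = (scalar_op c o\<^sub>L e) x" for x by simp
  then show ?thesis by (simp add: eU ue scalar_op_apply) blast
qed

text \<open>In terms of the units, an A of the commutant is a matrix of scalars, and scalars commute
  with X acting alike on each copy.\<close>

lemma tau_mem:
  assumes X: "X \<in> BH" "\<And>x. e (X x) = X x"
  shows "tau X \<in> M"
proof (rule memI[OF tau_BH[OF X(1)]])
  fix A x assume A: "A \<in> commutant M"
  have "tau X o\<^sub>L A = A o\<^sub>L tau X"
  proof (rule eq_on_units)
    fix j z
    have fin: "tau X (Q K (A (u j z))) = Q K (A (u j (X (e z))))" for K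
      unfolding Q_apply blinfun.sum_right
    proof (rule sum.cong[OF refl])
      fix k
      obtain c where c: "\<And>x. U k (A (u j x)) = scaleC c (e x)" using coefficient[OF A] by blast
      show "tau X (u k (U k (A (u j z)))) = u k (U k (A (u j (X (e z)))))"
        by (simp add: tau_u[OF X(1)] c X(2) BH_apply X(1) u_BH e_BH tau_BH is_projectionD(4)[OF e_proj])
    qed
    have "(\<lambda>K. tau X (Q K (A (u j z)))) \<longlonglongrightarrow> tau X (A (u j z))"
      by (intro blinfun.tendsto tendsto_const Q.lim)
    moreover have "(\<lambda>K. Q K (A (u j (X (e z))))) \<longlonglongrightarrow> A (u j (X (e z)))" by (rule Q.lim)
    ultimately have "tau X (A (u j z)) = A (u j (X (e z)))" unfolding fin by (rule LIMSEQ_unique)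
    then show "(tau X o\<^sub>L A) (u j z) = (A o\<^sub>L tau X) (u j z)" by (simp add: tau_u[OF X(1)])
  qed
  then show "tau X (A x) = A (tau X x)" by (metis blinfun_apply_blinfun_compose)
qed

text \<open>The block of T from copy n to copy m, viewed as an operator on the range of e and spread
  by \<open>tau\<close> over all copies to become an element of M.\<close>

definition entry :: "nat \<Rightarrow> nat \<Rightarrow> ('h \<Rightarrow>\<^sub>L 'h) \<Rightarrow> ('h \<Rightarrow>\<^sub>L 'h)" where
  "entry m n T = tau (U m o\<^sub>L T o\<^sub>L u n)"

lemma entry_arg_BH: "T \<in> BH \<Longrightarrow> U m o\<^sub>L T o\<^sub>L u n \<in> BH"
  by (intro BH_compose U_BH u_BH)

lemma entry_mem: "T \<in> BH \<Longrightarrow> entry m n T \<in> M"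
  unfolding entry_def by (rule tau_mem[OF entry_arg_BH]) (simp_all add: eU)

lemma entry_u: "T \<in> BH \<Longrightarrow> entry m n T (u j z) = u j (U m (T (u n z)))"
  unfolding entry_def by (simp add: tau_u[OF entry_arg_BH] ue)

lemma norm_entry_le: 
  assumes T: "T \<in> BH"
  shows "norm (entry m n T) \<le> norm T"
  unfolding entry_def
proof (rule order_trans[OF norm_tau[OF entry_arg_BH[OF T]]], rule norm_blinfun_bound)
  fix x
  have "norm (U m (T (u n x))) \<le> norm (T (u n x))" by (rule norm_U_le)
  also have "\<dots> \<le> norm T * norm (u n x)" by (rule norm_blinfun)
  also have "\<dots> \<le> norm T * norm x" by (intro mult_left_mono norm_u_le) simp
  finally show "norm ((U m o\<^sub>L T o\<^sub>L u n) x) \<le> norm T * norm x" by simp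
qed simp

lemma entry_add: "S \<in> BH \<Longrightarrow> T \<in> BH \<Longrightarrow> entry m n (S + T) = entry m n S + entry m n T"
  by (rule eq_on_units) (simp add: entry_u BH_add blinfun.add_left blinfun.add_right)

lemma entry_scal: "T \<in> BH \<Longrightarrow> entry m n (scalar_op c o\<^sub>L T) = scalar_op c o\<^sub>L entry m n T"
  by (rule eq_on_units) (simp add: entry_u BH_compose BH_scalar_op scalar_op_apply BH_apply U_BH u_BH)

text \<open>The reason why applying \<phi> to entries agrees with the tilde map: A contributes only
  a scalar coefficient and B passes through unchanged.\<close>

lemma entry_product:
  assumes A: "A \<in> commutant M" and B: "B \<in> M" and c: "\<And>x. U m (A (u n x)) = scaleC c (e x)"
  shows "entry m n (A o\<^sub>L B) = scalar_op c o\<^sub>L B"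
proof (rule eq_on_units)
  fix j z
  have "entry m n (A o\<^sub>L B) (u j z) = u j (U m (A (u n (B z))))"
    by (simp add: entry_u BH_compose N.BH[OF A] BH[OF B] commutes[OF B u_mem])
  also have "\<dots> = scaleC c (B (u j z))" by (simp add: c BH_apply u_BH ue commutes[OF B u_mem])
  finally show "entry m n (A o\<^sub>L B) (u j z) = (scalar_op c o\<^sub>L B) (u j z)" by (simp add: scalar_op_apply)
qed

text \<open>On a truncated vector an entry involves finitely many values of \<open>T k\<close>; the
  uniform bound covers the remaining vectors.\<close>

lemma entry_tendsto:
  assumes T: "\<And>k. T k \<in> BH" "S \<in> BH" "\<And>k. norm (T k) \<le> K" "\<And>x. (\<lambda>k. T k x) \<longlonglongrightarrow> blinfun_apply S x"
    and SK: "norm S \<le> K"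
  shows "(\<lambda>k. entry m n (T k) x) \<longlonglongrightarrow> entry m n S x"
proof (rule tendsto_of_dense)
  show "norm (entry m n (T k)) \<le> K" for k by (rule order_trans[OF norm_entry_le[OF T(1)] T(3)])
  show "norm (entry m n S) \<le> K" by (rule order_trans[OF norm_entry_le[OF T(2)] SK])
  fix d :: real assume "d > 0"
  then obtain N where N: "dist (Q N x) x < d" using Q.lim[of x] unfolding lim_sequentially by blast
  have "(\<lambda>k. entry m n (T k) (Q N x)) \<longlonglongrightarrow> entry m n S (Q N x)"
    unfolding Q_apply blinfun.sum_right entry_u[OF T(1)] entry_u[OF T(2)]
    by (intro tendsto_sum blinfun.tendsto tendsto_const T(4))
  then show "\<exists>w. norm (x - w) < d \<and> (\<lambda>k. entry m n (T k) w) \<longlonglongrightarrow> entry m n S w"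
    using N by (intro exI[of _ "Q N x"]) (simp add: dist_norm norm_minus_commute)
qed

end

section \<open>The normal completely bounded extension\<close>

text \<open>Matrix norms take a single index, so a pair (a, m) is coded as
  \<open>a * N + m\<close>.\<close>

lemma sum_flatten: "(\<Sum>i<r * N. g (i div N) (i mod N)) = (\<Sum>a<r. \<Sum>m<N. g a (m::nat))"
proof -
  have "(\<Sum>i<r * N. g (i div N) (i mod N)) = (\<Sum>a<r. \<Sum>i\<in>{a * N..<a * N + N}. g (i div N) (i mod N))"
    by (rule sum.nat_group[symmetric])
  also have "\<dots> = (\<Sum>a<r. \<Sum>m<N. g a m)"
  proof (rule sum.cong[OF refl])
    fix a
    have "(\<Sum>i\<in>{a * N..<a * N + N}. g (i div N) (i mod N)) = (\<Sum>m\<in>{0..<N}. g ((m + a * N) div N) ((m + a * N) mod N))"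
      using sum.shift_bounds_nat_ivl[of "\<lambda>i. g (i div N) (i mod N)" 0 "a * N" N] by (simp add: add.commute)
    also have "\<dots> = (\<Sum>m<N. g a m)"
      unfolding atLeast0LessThan by (rule sum.cong) auto
    finally show "(\<Sum>i\<in>{a * N..<a * N + N}. g (i div N) (i mod N)) = (\<Sum>m<N. g a m)" .
  qed
  finally show ?thesis .
qed

context matrix_units
begin

text \<open>The matrix of entries is an amplification of T over the copies of the range of e, framed
  by contractions built from the \<open>u n\<close> and \<open>U m\<close>, so the norm cannot grow.
  The estimate is made for the truncated sums and survives the limit.\<close>

lemma entry_matrix_norm:
  assumes T: "\<And>a b. a < r \<Longrightarrow> b < r \<Longrightarrow> T a b \<in> BH"
  shows "matrix_norm (r * N) (\<lambda>i j. entry (i mod N) (j mod N) (T (i div N) (j div N))) \<le> matrix_norm r T"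
proof (rule matrix_norm_leI[OF matrix_norm_nonneg])
  fix y :: "nat \<Rightarrow> 'h"
  define Y where "Y b n = y (b * N + n)" for b n
  have y: "y j = Y (j div N) (j mod N)" for j by (simp add: Y_def)
  have bound: "(\<Sum>a<r. \<Sum>m<N. (norm (\<Sum>b<r. \<Sum>n<N. tau_sum K (U m o\<^sub>L T a b o\<^sub>L u n) (Y b n)))\<^sup>2)
      \<le> (matrix_norm r T)\<^sup>2 * (\<Sum>b<r. \<Sum>n<N. (norm (Y b n))\<^sup>2)" for K
  proof -
    \<comment> \<open>For each copy k, w gathers the k-th components of the vectors into one vector
      per column of T. Its image v is then resolved into components by Bessel's inequality.\<close>
    define w where "w k b = (\<Sum>n<N. u n (U k (Y b n)))" for k b
    define v where "v a k = (\<Sum>b<r. T a b (w k b))" for a k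
    have "(\<Sum>b<r. \<Sum>n<N. tau_sum K (U m o\<^sub>L T a b o\<^sub>L u n) (Y b n)) = (\<Sum>k<K. u k (U m (v a k)))" for a m
    proof -
      have "(\<Sum>b<r. \<Sum>n<N. tau_sum K (U m o\<^sub>L T a b o\<^sub>L u n) (Y b n)) =
          (\<Sum>b<r. \<Sum>n<N. \<Sum>k<K. u k (U m (T a b (u n (U k (Y b n))))))" by (simp add: tau_sum_apply)
      also have "\<dots> = (\<Sum>b<r. \<Sum>k<K. \<Sum>n<N. u k (U m (T a b (u n (U k (Y b n))))))"
        by (rule sum.cong[OF refl], rule sum.swap)
      also have "\<dots> = (\<Sum>k<K. \<Sum>b<r. \<Sum>n<N. u k (U m (T a b (u n (U k (Y b n))))))" by (rule sum.swap)
      finally show ?thesis by (simp add: v_def w_def blinfun.sum_right)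
    qed
    then have "(\<Sum>a<r. \<Sum>m<N. (norm (\<Sum>b<r. \<Sum>n<N. tau_sum K (U m o\<^sub>L T a b o\<^sub>L u n) (Y b n)))\<^sup>2)
        \<le> (\<Sum>a<r. \<Sum>m<N. \<Sum>k<K. (norm (U m (v a k)))\<^sup>2)"
      by (simp only:) (intro sum_mono norm_sum_u_le)
    also have "\<dots> = (\<Sum>a<r. \<Sum>k<K. \<Sum>m<N. (norm (U m (v a k)))\<^sup>2)"
      by (rule sum.cong[OF refl], rule sum.swap)
    also have "\<dots> \<le> (\<Sum>a<r. \<Sum>k<K. (norm (v a k))\<^sup>2)" by (intro sum_mono bessel)
    also have "\<dots> = (\<Sum>k<K. \<Sum>a<r. (norm (v a k))\<^sup>2)" by (rule sum.swap)
    also have "\<dots> \<le> (\<Sum>k<K. (matrix_norm r T)\<^sup>2 * (\<Sum>b<r. (norm (w k b))\<^sup>2))"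
      unfolding v_def by (intro sum_mono matrix_norm_apply)
    also have "\<dots> \<le> (\<Sum>k<K. (matrix_norm r T)\<^sup>2 * (\<Sum>b<r. \<Sum>n<N. (norm (U k (Y b n)))\<^sup>2))"
      unfolding w_def by (intro sum_mono mult_left_mono norm_sum_u_le) simp
    also have "\<dots> = (matrix_norm r T)\<^sup>2 * (\<Sum>b<r. \<Sum>n<N. \<Sum>k<K. (norm (U k (Y b n)))\<^sup>2)"
    proof -
      have "(\<Sum>k<K. \<Sum>b<r. \<Sum>n<N. (norm (U k (Y b n)))\<^sup>2) = (\<Sum>b<r. \<Sum>k<K. \<Sum>n<N. (norm (U k (Y b n)))\<^sup>2)"
        by (rule sum.swap)
      also have "\<dots> = (\<Sum>b<r. \<Sum>n<N. \<Sum>k<K. (norm (U k (Y b n)))\<^sup>2)"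
        by (rule sum.cong[OF refl], rule sum.swap)
      finally show ?thesis by (simp only: sum_distrib_left[symmetric])
    qed
    also have "\<dots> \<le> (matrix_norm r T)\<^sup>2 * (\<Sum>b<r. \<Sum>n<N. (norm (Y b n))\<^sup>2)"
      by (intro mult_left_mono sum_mono bessel) simp
    finally show ?thesis .
  qed
  have flat: "(\<Sum>i<r * N. (norm (\<Sum>j<r * N. entry (i mod N) (j mod N) (T (i div N) (j div N)) (y j)))\<^sup>2) =
      (\<Sum>a<r. \<Sum>m<N. (norm (\<Sum>b<r. \<Sum>n<N. entry m n (T a b) (Y b n)))\<^sup>2)"
  proof -
    have "(\<Sum>j<r * N. entry m (j mod N) (T a (j div N)) (y j)) = (\<Sum>b<r. \<Sum>n<N. entry m n (T a b) (Y b n))" for a m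
      unfolding y by (rule sum_flatten[where g = "\<lambda>b n. entry m n (T a b) (Y b n)"])
    then show ?thesis
      by (simp only: sum_flatten[where g = "\<lambda>a m. (norm (\<Sum>b<r. \<Sum>n<N. entry m n (T a b) (Y b n)))\<^sup>2"])
  qed
  have flaty: "(\<Sum>j<r * N. (norm (y j))\<^sup>2) = (\<Sum>b<r. \<Sum>n<N. (norm (Y b n))\<^sup>2)"
    unfolding y by (rule sum_flatten)
  have "(\<lambda>K. \<Sum>a<r. \<Sum>m<N. (norm (\<Sum>b<r. \<Sum>n<N. tau_sum K (U m o\<^sub>L T a b o\<^sub>L u n) (Y b n)))\<^sup>2) \<longlonglongrightarrow>
      (\<Sum>a<r. \<Sum>m<N. (norm (\<Sum>b<r. \<Sum>n<N. entry m n (T a b) (Y b n)))\<^sup>2)"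
    unfolding entry_def by (intro tendsto_sum tendsto_power tendsto_norm tau_lim entry_arg_BH T) simp_all
  then show "(\<Sum>i<r * N. (norm (\<Sum>j<r * N. entry (i mod N) (j mod N) (T (i div N) (j div N)) (y j)))\<^sup>2)
      \<le> (matrix_norm r T)\<^sup>2 * (\<Sum>j<r * N. (norm (y j))\<^sup>2)"
    unfolding flat flaty by (rule LIMSEQ_le_const2) (use bound in blast)
qed

section \<open>Applying a completely bounded map to the entries\<close>

context
  fixes \<phi> :: "('h \<Rightarrow>\<^sub>L 'h) \<Rightarrow> ('h \<Rightarrow>\<^sub>L 'h)" and C :: real
  assumes lin: "linear_map M \<phi>" and normal: "normal_map M \<phi>" and C: "C \<ge> 0"
    and cb: "\<And>n A. (\<And>i j. i < n \<Longrightarrow> j < n \<Longrightarrow> A i j \<in> M) \<Longrightarrow>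
      matrix_norm n (\<lambda>i j. \<phi> (A i j)) \<le> C * matrix_norm n A"
begin

lemma \<phi>_mem: "A \<in> M \<Longrightarrow> \<phi> A \<in> M"
  using lin unfolding linear_map_def by blast

lemma \<phi>_add: "A \<in> M \<Longrightarrow> B \<in> M \<Longrightarrow> \<phi> (A + B) = \<phi> A + \<phi> B"
  using lin unfolding linear_map_def by blast

lemma \<phi>_scal: "A \<in> M \<Longrightarrow> \<phi> (scalar_op c o\<^sub>L A) = scalar_op c o\<^sub>L \<phi> A"
  using lin unfolding linear_map_def by blast

text \<open>The finite matrix on the first N copies, which is to be the compression of the extension
  by \<open>Q N\<close>.\<close>

definition ext_sum :: "nat \<Rightarrow> ('h \<Rightarrow>\<^sub>L 'h) \<Rightarrow> ('h \<Rightarrow>\<^sub>L 'h)" where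
  "ext_sum N T = (\<Sum>m<N. \<Sum>n<N. u m o\<^sub>L \<phi> (entry m n T) o\<^sub>L U n)"

lemma ext_sum_apply: "ext_sum N T x = (\<Sum>m<N. u m (\<Sum>n<N. \<phi> (entry m n T) (U n x)))"
  by (simp add: ext_sum_def blinfun.sum_left blinfun.sum_right)

lemma ext_sum_BH: "T \<in> BH \<Longrightarrow> ext_sum N T \<in> BH"
  unfolding ext_sum_def by (intro BH_sum BH_compose u_BH U_BH BH[OF \<phi>_mem[OF entry_mem]])

text \<open>The entries of an r by r matrix of operators form one matrix of size r * N over M. A
  bound independent of N thus needs complete boundedness of \<phi>; with r arbitrary it also yields
  complete boundedness of the extension.\<close>

lemma ext_sum_matrix_bound:
  assumes T: "\<And>a b. a < r \<Longrightarrow> b < r \<Longrightarrow> T a b \<in> BH"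
  shows "(\<Sum>a<r. (norm (\<Sum>b<r. ext_sum N (T a b) (x b)))\<^sup>2) \<le> (C * matrix_norm r T)\<^sup>2 * (\<Sum>b<r. (norm (x b))\<^sup>2)"
proof -
  define A where "A i j = entry (i mod N) (j mod N) (T (i div N) (j div N))" for i j
  define y where "y j = U (j mod N) (x (j div N))" for j
  have A: "A i j \<in> M" if "i < r * N" "j < r * N" for i j
    unfolding A_def using that by (intro entry_mem T less_mult_imp_div_less)
  have "(\<Sum>a<r. (norm (\<Sum>b<r. ext_sum N (T a b) (x b)))\<^sup>2) \<le>
      (\<Sum>a<r. \<Sum>m<N. (norm (\<Sum>b<r. \<Sum>n<N. \<phi> (entry m n (T a b)) (U n (x b))))\<^sup>2)"
  proof (rule sum_mono)
    fix a
    have "(\<Sum>b<r. ext_sum N (T a b) (x b)) = (\<Sum>m<N. u m (\<Sum>b<r. \<Sum>n<N. \<phi> (entry m n (T a b)) (U n (x b))))"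
      unfolding ext_sum_apply blinfun.sum_right[of "u _" _ "{..<r}"] by (rule sum.swap)
    then show "(norm (\<Sum>b<r. ext_sum N (T a b) (x b)))\<^sup>2 \<le>
        (\<Sum>m<N. (norm (\<Sum>b<r. \<Sum>n<N. \<phi> (entry m n (T a b)) (U n (x b))))\<^sup>2)"
      by (simp only: norm_sum_u_le)
  qed
  also have "\<dots> = (\<Sum>i<r * N. (norm (\<Sum>j<r * N. \<phi> (A i j) (y j)))\<^sup>2)"
  proof -
    have "(\<Sum>j<r * N. \<phi> (A i j) (y j)) = (\<Sum>b<r. \<Sum>n<N. \<phi> (entry (i mod N) n (T (i div N) b)) (U n (x b)))" for i
      unfolding A_def y_def
      by (rule sum_flatten[where g = "\<lambda>b n. \<phi> (entry (i mod N) n (T (i div N) b)) (U n (x b))"])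
    then show ?thesis
      by (simp only: sum_flatten[where g = "\<lambda>a m. (norm (\<Sum>b<r. \<Sum>n<N. \<phi> (entry m n (T a b)) (U n (x b))))\<^sup>2"])
  qed
  also have "\<dots> \<le> (matrix_norm (r * N) (\<lambda>i j. \<phi> (A i j)))\<^sup>2 * (\<Sum>j<r * N. (norm (y j))\<^sup>2)"
    by (rule matrix_norm_apply)
  also have "\<dots> \<le> (C * matrix_norm r T)\<^sup>2 * (\<Sum>b<r. (norm (x b))\<^sup>2)"
  proof (intro mult_mono power_mono)
    have "matrix_norm (r * N) (\<lambda>i j. \<phi> (A i j)) \<le> C * matrix_norm (r * N) A" by (rule cb[OF A])
    also have "\<dots> \<le> C * matrix_norm r T"
      unfolding A_def by (intro mult_left_mono entry_matrix_norm T C)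
    finally show "matrix_norm (r * N) (\<lambda>i j. \<phi> (A i j)) \<le> C * matrix_norm r T" .
    have "(\<Sum>j<r * N. (norm (y j))\<^sup>2) = (\<Sum>b<r. \<Sum>n<N. (norm (U n (x b)))\<^sup>2)"
      unfolding y_def by (rule sum_flatten)
    also have "\<dots> \<le> (\<Sum>b<r. (norm (x b))\<^sup>2)" by (intro sum_mono bessel)
    finally show "(\<Sum>j<r * N. (norm (y j))\<^sup>2) \<le> (\<Sum>b<r. (norm (x b))\<^sup>2)" .
  qed (simp_all add: matrix_norm_nonneg sum_nonneg)
  finally show ?thesis .
qed

lemma norm_ext_sum:
  assumes T: "T \<in> BH"
  shows "norm (ext_sum N T) \<le> C * norm T"
proof (rule norm_blinfun_bound)
  fix x
  have n1: "matrix_norm 1 (\<lambda>_ _. T) \<le> norm T"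
    by (rule matrix_norm_leI) (simp_all add: power_mult_distrib[symmetric] power_mono norm_blinfun)
  have "(norm (ext_sum N T x))\<^sup>2 \<le> (C * matrix_norm 1 (\<lambda>_ _. T))\<^sup>2 * (norm x)\<^sup>2"
    using ext_sum_matrix_bound[of 1 "\<lambda>_ _. T" N "\<lambda>_. x"] T by simp
  also have "\<dots> \<le> (C * norm T)\<^sup>2 * (norm x)\<^sup>2"
    by (intro mult_right_mono power_mono mult_left_mono n1 C mult_nonneg_nonneg matrix_norm_nonneg) simp
  finally have "(norm (ext_sum N T x))\<^sup>2 \<le> (C * norm T * norm x)\<^sup>2" by (simp add: power_mult_distrib)
  then show "norm (ext_sum N T x) \<le> C * norm T * norm x" by (rule power2_le_imp_le) (simp add: C)
qed (simp add: C)

lemma ext_sum_compat: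
  assumes "m \<le> n"
  shows "Q m (ext_sum n T (Q m x)) = ext_sum m T x"
proof -
  have "Q m (ext_sum n T (Q m x)) = (\<Sum>k<n. if k < m then u k (\<Sum>l<n. \<phi> (entry k l T) (U l (Q m x))) else 0)"
    unfolding ext_sum_apply blinfun.sum_right[of "Q m"] by (rule sum.cong) (auto simp: Q_u)
  also have "\<dots> = (\<Sum>k<m. u k (\<Sum>l<n. \<phi> (entry k l T) (U l (Q m x))))"
    by (rule sum.mono_neutral_cong_right) (use assms in auto)
  also have "\<dots> = (\<Sum>k<m. u k (\<Sum>l<m. \<phi> (entry k l T) (U l x)))"
  proof (rule sum.cong[OF refl])
    fix k
    have "(\<Sum>l<n. \<phi> (entry k l T) (U l (Q m x))) = (\<Sum>l<m. \<phi> (entry k l T) (U l x))"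
      by (rule sum.mono_neutral_cong_right) (use assms in \<open>auto simp: U_Q\<close>)
    then show "u k (\<Sum>l<n. \<phi> (entry k l T) (U l (Q m x))) = u k (\<Sum>l<m. \<phi> (entry k l T) (U l x))" by simp
  qed
  finally show ?thesis by (simp add: ext_sum_apply)
qed

definition ext :: "('h \<Rightarrow>\<^sub>L 'h) \<Rightarrow> ('h \<Rightarrow>\<^sub>L 'h)" where
  "ext T = (SOME S. S \<in> BH \<and> norm S \<le> C * norm T \<and> (\<forall>x. (\<lambda>N. ext_sum N T x) \<longlonglongrightarrow> blinfun_apply S x))"

lemma
  assumes T: "T \<in> BH"
  shows ext_BH: "ext T \<in> BH" and norm_ext: "norm (ext T) \<le> C * norm T" and ext_lim: "(\<lambda>N. ext_sum N T x) \<longlonglongrightarrow> ext T x"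
proof -
  have "\<exists>S\<in>BH. norm S \<le> C * norm T \<and> (\<forall>x. (\<lambda>N. ext_sum N T x) \<longlonglongrightarrow> blinfun_apply S x)"
    by (rule Q.compression_limit[OF ext_sum_BH[OF T] norm_ext_sum[OF T] ext_sum_compat])
  then have "\<exists>S. S \<in> BH \<and> norm S \<le> C * norm T \<and> (\<forall>x. (\<lambda>N. ext_sum N T x) \<longlonglongrightarrow> blinfun_apply S x)"
    by (simp only: Bex_def)
  then have "ext T \<in> BH \<and> norm (ext T) \<le> C * norm T \<and> (\<forall>x. (\<lambda>N. ext_sum N T x) \<longlonglongrightarrow> ext T x)"
    unfolding ext_def by (rule someI_ex)
  then show "ext T \<in> BH" "norm (ext T) \<le> C * norm T" "(\<lambda>N. ext_sum N T x) \<longlonglongrightarrow> ext T x" by simp_all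
qed

lemma ext_eqI:
  assumes "T \<in> BH" "\<And>x. (\<lambda>N. ext_sum N T x) \<longlonglongrightarrow> blinfun_apply S x"
  shows "ext T = S"
  by (rule blinfun_eqI) (rule LIMSEQ_unique[OF ext_lim[OF assms(1)] assms(2)])

lemma linear_ext: "linear_map BH ext"
  unfolding linear_map_def
proof (intro conjI ballI allI)
  show "ext ` BH \<subseteq> BH" using ext_BH by blast
  fix A :: "'h \<Rightarrow>\<^sub>L 'h" and c assume A: "A \<in> BH"
  show "ext (scalar_op c o\<^sub>L A) = scalar_op c o\<^sub>L ext A"
  proof (rule ext_eqI)
    have "ext_sum N (scalar_op c o\<^sub>L A) x = scaleC c (ext_sum N A x)" for N x
      unfolding ext_sum_apply
      by (simp add: entry_scal A \<phi>_scal entry_mem scalar_op_apply scaleC.sum_right[symmetric] BH_apply[OF u_BH])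
    then show "(\<lambda>N. ext_sum N (scalar_op c o\<^sub>L A) x) \<longlonglongrightarrow> (scalar_op c o\<^sub>L ext A) x" for x
      by (simp add: scalar_op_apply scaleC.tendsto[OF tendsto_const ext_lim[OF A]])
  qed (intro BH_compose BH_scalar_op A)
  fix B :: "'h \<Rightarrow>\<^sub>L 'h" assume B: "B \<in> BH"
  show "ext (A + B) = ext A + ext B"
  proof (rule ext_eqI)
    have "ext_sum N (A + B) x = ext_sum N A x + ext_sum N B x" for N x
      unfolding ext_sum_apply
      by (simp add: entry_add A B \<phi>_add entry_mem blinfun.add_left blinfun.add_right sum.distrib)
    then show "(\<lambda>N. ext_sum N (A + B) x) \<longlonglongrightarrow> (ext A + ext B) x" for x
      by (simp add: blinfun.add_left tendsto_add[OF ext_lim[OF A] ext_lim[OF B]])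
  qed (intro BH_add A B)
qed

lemma completely_bounded_ext: "completely_bounded BH ext"
  unfolding completely_bounded_def
proof (intro exI[of _ C] allI impI)
  fix n and A :: "nat \<Rightarrow> nat \<Rightarrow> ('h \<Rightarrow>\<^sub>L 'h)" assume A: "\<forall>i<n. \<forall>j<n. A i j \<in> BH"
  show "matrix_norm n (\<lambda>i j. ext (A i j)) \<le> C * matrix_norm n A"
  proof (rule matrix_norm_leI)
    show "0 \<le> C * matrix_norm n A" by (intro mult_nonneg_nonneg C matrix_norm_nonneg)
    fix x :: "nat \<Rightarrow> 'h"
    have "(\<lambda>N. \<Sum>i<n. (norm (\<Sum>j<n. ext_sum N (A i j) (x j)))\<^sup>2) \<longlonglongrightarrow> (\<Sum>i<n. (norm (\<Sum>j<n. ext (A i j) (x j)))\<^sup>2)"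
      by (intro tendsto_sum tendsto_power tendsto_norm ext_lim) (use A in simp)
    then show "(\<Sum>i<n. (norm (\<Sum>j<n. ext (A i j) (x j)))\<^sup>2) \<le> (C * matrix_norm n A)\<^sup>2 * (\<Sum>j<n. (norm (x j))\<^sup>2)"
      by (rule LIMSEQ_le_const2) (use ext_sum_matrix_bound A in blast)
  qed
qed

text \<open>Each entry is a scalar coefficient of A times B, which \<phi> turns into the same
  multiple of \<open>\<phi> B\<close>. The finite sums thus become A between two truncations,
  applied to \<open>\<phi> B x\<close>.\<close>

lemma ext_product:
  assumes A: "A \<in> commutant M" and B: "B \<in> M"
  shows "ext (A o\<^sub>L B) = A o\<^sub>L \<phi> B"
proof (rule ext_eqI)
  show "A o\<^sub>L B \<in> BH" by (intro BH_compose N.BH[OF A] BH[OF B])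
  fix x
  have "ext_sum N (A o\<^sub>L B) x = Q N (A (Q N (\<phi> B x)))" for N
  proof -
    have eq: "u m (\<phi> (entry m n (A o\<^sub>L B)) (U n x)) = u m (U m (A (u n (U n (\<phi> B x)))))" for m n
    proof -
      obtain c where c: "\<And>x. U m (A (u n x)) = scaleC c (e x)" using coefficient[OF A] by blast
      show ?thesis
        by (simp add: entry_product[OF A B c] \<phi>_scal B scalar_op_apply c eU commutes[OF \<phi>_mem[OF B] U_mem])
    qed
    show ?thesis unfolding ext_sum_apply Q_apply blinfun.sum_right eq by (rule sum.swap)
  qed
  \<comment> \<open>The outer truncation is a contraction and cannot enlarge the error made by the
    inner one.\<close>
  moreover have "(\<lambda>N. Q N (A (Q N (\<phi> B x)))) \<longlonglongrightarrow> A (\<phi> B x)"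
  proof (rule Lim_transform)
    show "(\<lambda>N. Q N (A (\<phi> B x))) \<longlonglongrightarrow> A (\<phi> B x)" by (rule Q.lim)
    have "(\<lambda>N. A (Q N (\<phi> B x)) - A (\<phi> B x)) \<longlonglongrightarrow> A (\<phi> B x) - A (\<phi> B x)"
      by (intro tendsto_diff tendsto_const blinfun.tendsto Q.lim)
    then have "(\<lambda>N. A (Q N (\<phi> B x)) - A (\<phi> B x)) \<longlonglongrightarrow> 0" by simp
    then have 0: "(\<lambda>N. norm (A (Q N (\<phi> B x)) - A (\<phi> B x))) \<longlonglongrightarrow> 0" by (rule tendsto_norm_zero)
    have "\<forall>\<^sub>F N in sequentially. norm (Q N (A (Q N (\<phi> B x))) - Q N (A (\<phi> B x))) \<le> norm (A (Q N (\<phi> B x)) - A (\<phi> B x))"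
      by (intro always_eventually allI) (simp add: blinfun.diff_right[symmetric] is_projectionD(6)[OF Q.proj])
    from Lim_null_comparison[OF this 0]
    show "(\<lambda>N. Q N (A (Q N (\<phi> B x))) - Q N (A (\<phi> B x))) \<longlonglongrightarrow> 0" .
  qed
  ultimately show "(\<lambda>N. ext_sum N (A o\<^sub>L B) x) \<longlonglongrightarrow> (A o\<^sub>L \<phi> B) x" by simp
qed

lemma extends_tilde_ext: "extends_tilde M \<phi> ext"
  unfolding extends_tilde_def
proof (intro ballI, clarify)
  fix T S assume "(T, S) \<in> tilde_graph M \<phi>"
  then obtain n :: nat and A B where TS: "T = (\<Sum>i<n. A i o\<^sub>L B i)" "S = (\<Sum>i<n. A i o\<^sub>L \<phi> (B i))"
    and AB: "\<forall>i<n. A i \<in> commutant M \<and> B i \<in> M" unfolding tilde_graph_def by blast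
  have "ext T = (\<Sum>i<n. ext (A i o\<^sub>L B i))"
    unfolding TS(1)
  proof (rule linear_map_sum[OF linear_ext BH_zero BH_add])
    show "A i o\<^sub>L B i \<in> BH" if "i \<in> {..<n}" for i using AB that by (intro BH_compose N.BH BH) auto
  qed
  also have "\<dots> = S" unfolding TS(2) by (rule sum.cong) (use AB in \<open>auto simp: ext_product\<close>)
  finally show "ext T = S" .
qed

text \<open>The entries converge strongly and boundedly, hence sigma-weakly. Normality of \<phi>
  speaks about the sigma-weak topology, so the conclusion is about vector functionals.\<close>

lemma \<phi>_entry_tendsto:
  assumes T: "\<And>k. T k \<in> BH" "S \<in> BH" "\<And>k. norm (T k) \<le> K" "\<And>x. (\<lambda>k. T k x) \<longlonglongrightarrow> blinfun_apply S x"
    and SK: "norm S \<le> K"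
  shows "(\<lambda>k. cinner (\<phi> (entry m n (T k)) x) y) \<longlonglongrightarrow> cinner (\<phi> (entry m n S) x) y"
proof -
  have "limitin sigma_weak (\<lambda>k. entry m n (T k)) (entry m n S) sequentially"
    by (rule limitin_sigma_weak[where C = K])
      (auto intro!: BH entry_mem T(1,2) entry_tendsto[OF T SK] order_trans[OF norm_entry_le[OF T(1)] T(3)])
  then have "limitin (subtopology sigma_weak M) (\<lambda>k. entry m n (T k)) (entry m n S) sequentially"
    by (simp add: limitin_subtopology entry_mem T)
  from continuous_map_limit[OF continuous_map_compose[OF normal_map_continuous[OF normal] continuous_vector_functional[of x y]] this]
  show ?thesis by (simp add: o_def)
qed

text \<open>By the sequential criterion only limits along bounded sequences are needed. On operators
  of norm at most K the extension is approximated by its compressions with a uniform error in the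
  given functional, and each compression is a finite sum covered by
  \<open>\<phi>_entry_tendsto\<close>.\<close>

lemma normal_ext:
  assumes sep: "separable_space (euclidean :: 'h topology)"
  shows "normal_map BH ext"
proof -
  obtain f :: "nat \<Rightarrow> 'h" where "onb f" using onb_exists[OF sep] by blast
  then interpret F: onb f .
  show ?thesis
  proof (rule F.sequentially_continuous_map_normal[OF linear_ext norm_ext C])
    fix T :: "nat \<Rightarrow> ('h \<Rightarrow>\<^sub>L 'h)" and S K' x y
    assume T: "\<And>k. T k \<in> BH" "S \<in> BH" "\<And>k. norm (T k) \<le> K'" "\<And>x. (\<lambda>k. T k x) \<longlonglongrightarrow> blinfun_apply S x"
    \<comment> \<open>Covers the limit S, about which the bound on the sequence says
      nothing.\<close>
    define K where "K = max K' (norm S)"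
    have TK: "norm (T k) \<le> K" for k using T(3)[of k] by (simp add: K_def)
    have SK: "norm S \<le> K" by (simp add: K_def)
    have K: "C * K \<ge> 0" using C SK norm_ge_zero[of S] by (intro mult_nonneg_nonneg) linarith+
    have ext_K: "norm (ext A) \<le> C * K" if "A \<in> BH" "norm A \<le> K" for A
      by (rule order_trans[OF norm_ext[OF that(1)]]) (intro mult_left_mono that C)
    \<comment> \<open>The compressed sums are constant from index N on by
      \<open>ext_sum_compat\<close>, so their limit is read off.\<close>
    have compress: "cinner (ext A (Q N x)) (Q N y) = cinner (ext_sum N A x) y" if A: "A \<in> BH" for A N
    proof -
      have "(\<lambda>n. cinner (Q N (ext_sum n A (Q N x))) y) \<longlonglongrightarrow> cinner (Q N (ext A (Q N x))) y"
        by (intro cinner.tendsto blinfun.tendsto tendsto_const ext_lim A)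
      moreover have "(\<lambda>n. cinner (Q N (ext_sum n A (Q N x))) y) \<longlonglongrightarrow> cinner (ext_sum N A x) y"
        by (intro tendsto_eventually eventually_sequentiallyI[of N]) (simp add: ext_sum_compat)
      ultimately have "cinner (Q N (ext A (Q N x))) y = cinner (ext_sum N A x) y" by (rule LIMSEQ_unique)
      then show ?thesis by (simp add: is_projectionD(5)[OF Q.proj])
    qed
    have fin: "(\<lambda>k. cinner (ext_sum N (T k) x) y) \<longlonglongrightarrow> cinner (ext_sum N S x) y" for N
    proof -
      have "cinner (ext_sum N A x) y = (\<Sum>m<N. \<Sum>n<N. cinner (\<phi> (entry m n A) (U n x)) (U m y))" for A
        by (simp add: ext_sum_apply cinner.sum_left u_right)
      then show ?thesis by (simp only:) (intro tendsto_sum \<phi>_entry_tendsto[OF T(1,2) TK T(4) SK])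
    qed
    have approx: "cmod (cinner (ext A x) y - cinner (ext_sum N A x) y) \<le>
        C * K * (norm (x - Q N x) * norm y + norm x * norm (y - Q N y))" if A: "A \<in> BH" "norm A \<le> K" for A N
    proof -
      have "cinner (ext A x) y - cinner (ext A (Q N x)) (Q N y) =
          cinner (ext A (x - Q N x)) y + cinner (ext A (Q N x)) (y - Q N y)"
        by (simp add: blinfun.diff_right cinner.diff_left cinner.diff_right)
      also have "cmod \<dots> \<le> cmod (cinner (ext A (x - Q N x)) y) + cmod (cinner (ext A (Q N x)) (y - Q N y))"
        by (rule norm_triangle_ineq)
      also have "\<dots> \<le> (C * K * norm (x - Q N x)) * norm y + (C * K * norm x) * norm (y - Q N y)"
      proof (intro add_mono order_trans[OF norm_cinner_le] mult_right_mono norm_ge_zero)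
        show "norm (ext A (x - Q N x)) \<le> C * K * norm (x - Q N x)"
          by (rule order_trans[OF norm_blinfun]) (intro mult_right_mono ext_K A norm_ge_zero)
        have "norm (ext A (Q N x)) \<le> norm (ext A) * norm (Q N x)" by (rule norm_blinfun)
        also have "\<dots> \<le> C * K * norm x"
          by (intro mult_mono ext_K A is_projectionD(6)[OF Q.proj] K norm_ge_zero)
        finally show "norm (ext A (Q N x)) \<le> C * K * norm x" .
      qed
      finally show ?thesis unfolding compress[OF A(1)] by (simp add: algebra_simps)
    qed
    define d where "d N = C * K * (norm (x - Q N x) * norm y + norm x * norm (y - Q N y))" for N
    have "d \<longlonglongrightarrow> C * K * (norm (x - x) * norm y + norm x * norm (y - y))"
      unfolding d_def by (intro tendsto_mult tendsto_add tendsto_norm tendsto_diff tendsto_const Q.lim)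
    then have d0: "d \<longlonglongrightarrow> 0" by simp
    show "(\<lambda>k. cinner (ext (T k) x) y) \<longlonglongrightarrow> cinner (ext S x) y"
    proof (rule LIMSEQ_I)
      fix r :: real assume r: "0 < r"
      then obtain N where N: "d N < r / 3"
        using order_tendstoD(2)[OF d0, of "r / 3"] by (auto simp: eventually_sequentially)
      obtain k0 where k0: "\<And>k. k \<ge> k0 \<Longrightarrow> norm (cinner (ext_sum N (T k) x) y - cinner (ext_sum N S x) y) < r / 3"
        using LIMSEQ_D[OF fin[of N], of "r / 3"] r by auto
      have "norm (cinner (ext (T k) x) y - cinner (ext S x) y) < r" if "k \<ge> k0" for k
      proof -
        have "dist (cinner (ext (T k) x) y) (cinner (ext S x) y) \<le> dist (cinner (ext (T k) x) y) (cinner (ext_sum N (T k) x) y)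
            + dist (cinner (ext_sum N (T k) x) y) (cinner (ext_sum N S x) y) + dist (cinner (ext_sum N S x) y) (cinner (ext S x) y)"
          using dist_triangle[of "cinner (ext (T k) x) y" "cinner (ext S x) y" "cinner (ext_sum N (T k) x) y"]
            dist_triangle[of "cinner (ext_sum N (T k) x) y" "cinner (ext S x) y" "cinner (ext_sum N S x) y"] by linarith
        moreover have "dist (cinner (ext (T k) x) y) (cinner (ext_sum N (T k) x) y) < r / 3"
          using approx[OF T(1) TK, of k N] N by (simp add: dist_norm d_def)
        moreover have "dist (cinner (ext_sum N S x) y) (cinner (ext S x) y) < r / 3"
          using approx[OF T(2) SK, of N] N by (simp add: dist_norm d_def norm_minus_commute)
        moreover have "dist (cinner (ext_sum N (T k) x) y) (cinner (ext_sum N S x) y) < r / 3"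
          using k0[OF that] by (simp add: dist_norm)
        ultimately show ?thesis by (simp add: dist_norm)
      qed
      then show "\<exists>no. \<forall>k\<ge>no. norm (cinner (ext (T k) x) y - cinner (ext S x) y) < r" by blast
    qed
  qed
qed

end

end

section \<open>The characterization\<close>

text \<open>The minimal projection is first moved to the commutant, where the matrix units must live
  for the entries to lie in M.\<close>

lemma (in vN_factor) minimal_imp_extension:
  assumes sep: "separable_space (euclidean :: 'h topology)" and min: "minimal_in M p" and \<phi>: "\<phi> \<in> CB_sigma M"
  shows "\<exists>\<Phi>. linear_map BH \<Phi> \<and> normal_map BH \<Phi> \<and> completely_bounded BH \<Phi> \<and> extends_tilde M \<phi> \<Phi>"
proof -
  interpret N: vN_factor "commutant M" by (rule factor_commutant)
  obtain e where e: "minimal_in (commutant M) e" using minimal_commutant[OF min] by blast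
  obtain u :: "nat \<Rightarrow> 'h \<Rightarrow>\<^sub>L 'h" where u: "\<forall>n. u n \<in> commutant M" "\<forall>n x. u n (e x) = u n x"
    "\<forall>m n x. m \<noteq> n \<longrightarrow> adj (u n) (u m x) = 0" "\<forall>n. u n = 0 \<or> (\<forall>x. adj (u n) (u n x) = e x)"
    "\<forall>x. (\<forall>n. adj (u n) x = 0) \<longrightarrow> x = 0"
    using N.matrix_units_exist[OF sep e] by (elim exE conjE) (rule that)
  interpret matrix_units M e u
  proof
    show "minimal_in (commutant M) e" by (rule e)
    show "u n \<in> commutant M" for n using u(1) by blast
    show "u n (e x) = u n x" for n x using u(2) by blast
    show "adj (u n) (u m x) = 0" if "m \<noteq> n" for m n x using u(3) that by blast
    show "u n = 0 \<or> (\<forall>x. adj (u n) (u n x) = e x)" for n using u(4) by blast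
    show "x = 0" if "\<And>n. adj (u n) x = 0" for x using u(5) that by blast
  qed
  obtain K where K: "\<And>n A. (\<forall>i<n. \<forall>j<n. A i j \<in> M) \<Longrightarrow> matrix_norm n (\<lambda>i j. \<phi> (A i j)) \<le> K * matrix_norm n A"
    using \<phi> unfolding CB_sigma_def completely_bounded_def by blast
  \<comment> \<open>The constant of complete boundedness is made nonnegative, as the monotone
    estimates for the extension require.\<close>
  have cb: "matrix_norm n (\<lambda>i j. \<phi> (A i j)) \<le> \<bar>K\<bar> * matrix_norm n A" if "\<And>i j. i < n \<Longrightarrow> j < n \<Longrightarrow> A i j \<in> M" for n A
  proof -
    have "matrix_norm n (\<lambda>i j. \<phi> (A i j)) \<le> K * matrix_norm n A" using K that by blast
    also have "\<dots> \<le> \<bar>K\<bar> * matrix_norm n A" by (intro mult_right_mono matrix_norm_nonneg) simp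
    finally show ?thesis .
  qed
  have \<phi>': "linear_map M \<phi>" "normal_map M \<phi>" using \<phi> by (auto simp: CB_sigma_def)
  note * = \<phi>' abs_ge_zero cb
  show ?thesis
    using linear_ext[OF *] normal_ext[OF * sep] completely_bounded_ext[OF *] extends_tilde_ext[OF *] by blast
qed

lemma id_eq_scalar_op: "id_blinfun = scalar_op 1"
  by (rule blinfun_eqI) (simp add: scalar_op_apply)

text \<open>The centre is scalar, so the identity is the only nonzero central projection, and a
  nonzero vector makes it nonzero. Nonzero abelian and minimal projections coincide in a
  factor.\<close>

lemma (in vN_factor) type_I_iff_minimal:
  assumes x: "(x :: 'h) \<noteq> 0"
  shows "type_I M \<longleftrightarrow> (\<exists>p. minimal_in M p)"
proof
  assume "type_I M"
  moreover have "id_blinfun \<in> center M" using center unfolding id_eq_scalar_op by blast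
  moreover have "is_projection (id_blinfun :: 'h \<Rightarrow>\<^sub>L 'h)"
    unfolding is_projection_def by (auto simp: BH_id adj_id intro: blinfun_eqI)
  moreover have "(id_blinfun :: 'h \<Rightarrow>\<^sub>L 'h) \<noteq> 0"
    using x by (metis blinfun_apply_id_blinfun zero_blinfun.rep_eq)
  ultimately obtain p where "abelian_projection M p" "p \<noteq> 0" unfolding type_I_def by blast
  then show "\<exists>p. minimal_in M p" using abelian_imp_minimal by blast
next
  assume "\<exists>p. minimal_in M p"
  then obtain p where p: "minimal_in M p" by blast
  show "type_I M" unfolding type_I_def
  proof (intro ballI impI exI conjI)
    fix z assume z: "z \<in> center M" "is_projection z \<and> z \<noteq> 0"
    show "abelian_projection M p" by (rule minimal_imp_abelian[OF p])
    show "p \<noteq> 0" using p by (simp add: minimal_in_def)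
    obtain c where c: "z = scalar_op c" using z(1) center by blast
    then have "is_projection (scalar_op c :: 'h \<Rightarrow>\<^sub>L 'h)" using z(2) by simp
    from is_projection_scalar[OF this] have "z = id_blinfun" using c z(2) by simp
    then show "proj_le p z" unfolding proj_le_def by (metis UNIV_I blinfun_apply_id_blinfun rangeI subsetI)
  qed
qed

theorem theorem4p1:
  fixes M :: "('h::complex_hilbert \<Rightarrow>\<^sub>L 'h) set" and \<xi> :: 'h
  assumes separable: "separable_space (euclidean :: 'h topology)"
    and factor: "factor M"
    and unit: "norm \<xi> = 1"
    and cyclic: "cyclic M \<xi>"
    and separating: "separating M \<xi>"
  shows "((\<forall>\<phi>\<in>CB_sigma M. \<exists>\<Phi>. linear_map BH \<Phi> \<and> normal_map BH \<Phi> \<and> completely_bounded BH \<Phi> \<and>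
              extends_tilde M \<phi> \<Phi>) \<longleftrightarrow>
          (\<forall>\<phi>\<in>CB_sigma M. \<exists>\<Phi>. linear_map BH \<Phi> \<and> normal_map BH \<Phi> \<and> extends_tilde M \<phi> \<Phi>)) \<and>
         ((\<forall>\<phi>\<in>CB_sigma M. \<exists>\<Phi>. linear_map BH \<Phi> \<and> normal_map BH \<Phi> \<and> extends_tilde M \<phi> \<Phi>) \<longleftrightarrow>
          type_I M)"
    (is "(?i \<longleftrightarrow> ?ii) \<and> (?ii \<longleftrightarrow> ?iii)")
proof -
  interpret vN_factor M
    using factor unfolding factor_def by unfold_locales auto
  have "\<xi> \<noteq> 0" using unit by auto
  then have I: "?iii \<longleftrightarrow> (\<exists>p. minimal_in M p)" by (rule type_I_iff_minimal)
  have "?i \<Longrightarrow> ?ii" by meson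
  moreover have "?iii" if ii: ?ii
  proof -
    obtain \<Phi> where \<Phi>: "linear_map BH \<Phi>" "normal_map BH \<Phi>" "extends_tilde M (state_map \<xi>) \<Phi>"
      using bspec[OF ii state_map_CB_sigma[OF separable unit]] by blast
    show ?thesis unfolding I by (rule extension_imp_minimal[OF separable unit \<Phi>])
  qed
  moreover have "?i" if iii: ?iii
  proof
    fix \<phi> assume \<phi>: "\<phi> \<in> CB_sigma M"
    obtain p where "minimal_in M p" using iii unfolding I by blast
    from minimal_imp_extension[OF separable this \<phi>]
    show "\<exists>\<Phi>. linear_map BH \<Phi> \<and> normal_map BH \<Phi> \<and> completely_bounded BH \<Phi> \<and> extends_tilde M \<phi> \<Phi>" .
  qed
  ultimately show ?thesis by blast
qed

end
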